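(* Let $0\le\alpha\le 1$ and $0\le\gamma\le\alpha$, and let $(T_n,n\ge 1)$ be the alpha-gamma trees with parameters $(\alpha,\gamma)$, with delabelled trees $T_n^\circ$. Then: (a) The sequence of delabelled trees $(T_n^\circ,n\ge 1)$ has the Markov branching property. If moreover $0\le\alpha<1$, its splitting rule $q^{\rm seq}_{\alpha,\gamma}$ satisfies, for all $n\ge 2$ and all $n_1\ge\ldots\ge n_k\ge 1$, $k\ge 2$, with $n_1+\ldots+n_k=n$, $$q_{\alpha,\gamma}^{\rm seq}(n_1,\ldots,n_k)\ \propto\ \left(\gamma+(1-\alpha-\gamma)\frac{1}{n(n-1)}\sum_{i\neq j}n_in_j\right)q_{\alpha,-\alpha-\gamma}^{\rm PD^*}(n_1,\ldots,n_k),$$ where the sum is over ordered pairs $(i,j)\in\{1,\ldots,k\}^2$ with $i\ne j$, and $\propto$ means equality up to a multiplicative constant depending only on $n$ and $(\alpha,\gamma)$ that makes the left-hand side a probability function for each fixed $n$. (b) The labelling of $T_n$ is exchangeable for all $n\ge 1$ (i.e. for every $n$ the distribution of $T_n$ is invariant under all permutations of the leaf labels $\{1,\ldots,n\}$) if and only if $\gamma=1-\alpha$ and $1/2\le\alpha\le 1$.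
   Context: Trees. Write $[n]=\{1,\ldots,n\}$. Let $\mathbb{T}_n$ be the set of combinatorial trees without degree-2 vertices that have one degree-1 vertex called the root and exactly $n$ further degree-1 vertices, called leaves, labelled by $[n]$; the other vertices are called branch points. Edges are directed away from the root. Trees are identified if there is an isomorphism preserving root and leaf labels. Alpha-gamma trees. For $0\le\alpha\le 1$, $0\le\gamma\le\alpha$, the random trees $T_n\in\mathbb{T}_n$, $n\ge1$, are defined as follows. $T_1,T_2$ are the unique elements of $\mathbb{T}_1,\mathbb{T}_2$. Given $T_n$, $n\ge 2$: (i) assign weight $1-\alpha$ to each of the $n$ edges adjacent to a leaf, weight $\gamma$ to each other edge (including the edge adjacent to the root), and weight $(k-1)\alpha-\gamma$ to each vertex of degree $k+1\ge 3$ (the total weight is $n-\alpha$); (ii) select an edge $a\to c$ or a branch point $v$ at random with probability proportional to weight; (iii) if an edge $a\to c$ was selected, replace it by three edges $a\to b$, $b\to c$, $b\to n+1$, where $b$ is a new branch point and $n+1$ a new leaf; if a vertex $v$ was selected, add an edge $v\to n+1$ to a new leaf $n+1$. The result is $T_{n+1}$. Delabelling. $T_n^\circ$ is the equivalence class of $T_n$ under relabelling of leaves (an unlabelled rooted tree with $n$ leaves). Markov branching property and splitting rule. For $n\ge2$, the first split of a tree with $n$ leaves is the sequence $n_1\ge\ldots\ge n_k\ge1$, $k\ge 2$, $n_1+\ldots+n_k=n$, of numbers of leaves of the tree components (subtrees, each rooted via one of the edges leaving the branch point) above the branch point adjacent to the root. A sequence $(T_n^\circ,n\ge1)$ of random unlabelled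 trees has the Markov branching property if for all $n\ge 2$, conditionally given that the first split of $T_n^\circ$ is $(n_1,\ldots,n_k)$, the $k$ tree components are independent copies of $T_{n_i}^\circ$, $1\le i\le k$. The splitting rule is the probability function $q(n_1,\ldots,n_k)$ of the first split of $T_n^\circ$, $n\ge2$. The rule $q^{\rm PD^*}_{\alpha,\theta}$. For $0\le\alpha<1$ and $\theta\ge-2\alpha$ put $w_m=\Gamma(m-\alpha)/\Gamma(1-\alpha)$ and $a_k=\prod_{j=2}^{k-1}(\theta+j\alpha)$ (which equals $\alpha^{k-2}\Gamma(k+\theta/\alpha)/\Gamma(2+\theta/\alpha)$ when the latter is defined, boundary cases being understood by continuity). Then $$p^{\rm PD^*}_{\alpha,\theta}(n_1,\ldots,n_k)=\frac{a_k}{Z_n}\prod_{j=1}^kw_{n_j},\qquad k\ge2,\ n=n_1+\ldots+n_k,$$ and, for $n_1\ge\ldots\ge n_k\ge1$, with $m_r$ the number of $r$'s in $(n_1,\ldots,n_k)$, $$q^{\rm PD^*}_{\alpha,\theta}(n_1,\ldots,n_k)=\frac{1}{m_1!\cdots m_n!}\binom{n}{n_1,\ldots,n_k}p^{\rm PD^*}_{\alpha,\theta}(n_1,\ldots,n_k),$$ where $Z_n$ is the constant that makes $q^{\rm PD^*}_{\alpha,\theta}$ a probability function on $\{(n_1,\ldots,n_k):k\ge 2,\ n_1\ge\ldots\ge n_k\ge1,\ n_1+\ldots+n_k=n\}$. *)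

theory Defs
  imports "HOL-Probability.Product_PMF" "HOL-Library.Multiset" "HOL-Combinatorics.Permutations"
begin

text \<open>
  Planted trees up to isomorphism. A value of type \<open>'a ptree\<close> stands for everything above an edge
  pointing away from the root: the upper end of that edge is either a labelled leaf, or a branch
  point together with the multiset of subtrees above its outgoing edges. A whole tree is
  represented by what is above the edge adjacent to the root, so the root and that edge are implicit.
  Since the children form a multiset, isomorphic trees (with respect to root and leaf labels)
  are equal. A vertex \<open>Branch M\<close> has degree \<open>size M + 1\<close>.
\<close>

datatype 'a ptree = Leaf 'a | Branch "'a ptree multiset"

primrec leaf_labels :: "'a ptree \<Rightarrow> 'a multiset" where
  "leaf_labels (Leaf l) = {#l#}"
| "leaf_labels (Branch M) = \<Sum>\<^sub># (image_mset leaf_labels M)"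

definition leaf_count :: "'a ptree \<Rightarrow> nat" where
  "leaf_count t = size (leaf_labels t)"

primrec subtrees :: "'a ptree \<Rightarrow> 'a ptree set" where
  "subtrees (Leaf l) = {Leaf l}"
| "subtrees (Branch M) = insert (Branch M) (\<Union> (set_mset (image_mset subtrees M)))"

text \<open>The set of trees without degree-2 vertices and with leaves labelled by \<open>1, ..., n\<close>.\<close>

definition labelled_trees :: "nat \<Rightarrow> nat ptree set" where
  "labelled_trees n =
     {t. leaf_labels t = mset_set {1..n} \<and> (\<forall>M. Branch M \<in> subtrees t \<longrightarrow> size M \<ge> 2)}"

text \<open>
  Edges and branch points of a tree are addressed by subtrees: \<open>Edge s\<close> is the edge carrying \<open>s\<close> (for
  \<open>s = t\<close> the edge adjacent to the root), and \<open>Vertex s\<close> is the branch point from which the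
  components of \<open>s\<close> emanate. As leaf labels are distinct, each subtree occurs only once in a
  labelled tree, so this addressing is unambiguous.
\<close>

datatype 'a site = Edge "'a ptree" | Vertex "'a ptree"

definition sites :: "'a ptree \<Rightarrow> 'a site set" where
  "sites t = Edge ` subtrees t \<union> Vertex ` (subtrees t \<inter> range Branch)"

fun weight :: "real \<Rightarrow> real \<Rightarrow> 'a site \<Rightarrow> real" where
  "weight \<alpha> \<gamma> (Edge (Leaf l)) = 1 - \<alpha>"
| "weight \<alpha> \<gamma> (Edge (Branch M)) = \<gamma>"
| "weight \<alpha> \<gamma> (Vertex (Branch M)) = (real (size M) - 1) * \<alpha> - \<gamma>"

definition select_site :: "real \<Rightarrow> real \<Rightarrow> 'a ptree \<Rightarrow> 'a site pmf" where
  "select_site \<alpha> \<gamma> t =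
     embed_pmf (\<lambda>x. if x \<in> sites t then weight \<alpha> \<gamma> x / (\<Sum>y\<in>sites t. weight \<alpha> \<gamma> y) else 0)"

text \<open>\<open>replace s s' t\<close> is \<open>t\<close> with the subtree \<open>s\<close> replaced by \<open>s'\<close>.\<close>

primrec replace :: "'a ptree \<Rightarrow> 'a ptree \<Rightarrow> 'a ptree \<Rightarrow> 'a ptree" where
  "replace s s' (Leaf l) = (if Leaf l = s then s' else Leaf l)"
| "replace s s' (Branch M) = (if Branch M = s then s' else Branch (image_mset (replace s s') M))"

fun insert_leaf :: "'a \<Rightarrow> 'a ptree \<Rightarrow> 'a site \<Rightarrow> 'a ptree" where
  "insert_leaf l t (Edge s) = replace s (Branch {#s, Leaf l#}) t"
| "insert_leaf l t (Vertex (Branch M)) = replace (Branch M) (Branch (add_mset (Leaf l) M)) t"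

text \<open>The law of the alpha-gamma tree \<open>T\<^sub>n\<close> for \<open>n \<ge> 1\<close> (unspecified for \<open>n = 0\<close>).\<close>

fun alpha_gamma_tree :: "real \<Rightarrow> real \<Rightarrow> nat \<Rightarrow> nat ptree pmf" where
  "alpha_gamma_tree \<alpha> \<gamma> (Suc 0) = return_pmf (Leaf 1)"
| "alpha_gamma_tree \<alpha> \<gamma> (Suc (Suc 0)) = return_pmf (Branch {#Leaf 1, Leaf 2#})"
| "alpha_gamma_tree \<alpha> \<gamma> (Suc (Suc (Suc n))) =
     bind_pmf (alpha_gamma_tree \<alpha> \<gamma> (Suc (Suc n)))
       (\<lambda>t. map_pmf (insert_leaf (Suc (Suc (Suc n))) t) (select_site \<alpha> \<gamma> t))"

text \<open>
  Unlabelled trees are trees all of whose leaves carry the trivial label; lemma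
  \<open>delabel_eq_iff\<close> below shows that they represent the classes of labelled trees under relabelling.
\<close>

definition delabel :: "'a ptree \<Rightarrow> unit ptree" where
  "delabel = map_ptree (\<lambda>_. ())"

definition delabelled_alpha_gamma_tree :: "real \<Rightarrow> real \<Rightarrow> nat \<Rightarrow> unit ptree pmf" where
  "delabelled_alpha_gamma_tree \<alpha> \<gamma> n = map_pmf delabel (alpha_gamma_tree \<alpha> \<gamma> n)"

definition exchangeable_labels :: "nat \<Rightarrow> nat ptree pmf \<Rightarrow> bool" where
  "exchangeable_labels n T \<longleftrightarrow> (\<forall>\<pi>. \<pi> permutes {1..n} \<longrightarrow> map_pmf (map_ptree \<pi>) T = T)"

primrec components :: "'a ptree \<Rightarrow> 'a ptree multiset" where
  "components (Leaf l) = {#}"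
| "components (Branch M) = M"

definition first_split :: "'a ptree \<Rightarrow> nat list" where
  "first_split t = rev (sorted_list_of_multiset (image_mset leaf_count (components t)))"

definition splits :: "nat \<Rightarrow> nat list set" where
  "splits n = {ns. length ns \<ge> 2 \<and> sorted_wrt (\<ge>) ns \<and> (\<forall>m\<in>set ns. m \<ge> 1) \<and> sum_list ns = n}"

text \<open>
  The components of an unlabelled tree are unordered, so the conditional law is that
  of the multiset of components: it is the law of the multiset of independent
  \<open>S\<^sub>1, ..., S\<^sub>k\<close> with \<open>S\<^sub>i\<close> distributed as the tree with \<open>n\<^sub>i\<close> leaves.
\<close>

definition markov_branching :: "(nat \<Rightarrow> unit ptree pmf) \<Rightarrow> bool" where
  "markov_branching T \<longleftrightarrow>
     (\<forall>n\<ge>2. \<forall>ns \<in> first_split ` set_pmf (T n).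
        map_pmf components (cond_pmf (T n) {t. first_split t = ns}) =
        map_pmf (\<lambda>S. image_mset S (mset_set {..<length ns}))
          (Pi_pmf {..<length ns} undefined (\<lambda>i. T (ns ! i))))"

definition splitting_rule :: "(nat \<Rightarrow> unit ptree pmf) \<Rightarrow> nat list \<Rightarrow> real" where
  "splitting_rule T ns = pmf (map_pmf first_split (T (sum_list ns))) ns"

definition PD_w :: "real \<Rightarrow> nat \<Rightarrow> real" where
  "PD_w \<alpha> m = Gamma (real m - \<alpha>) / Gamma (1 - \<alpha>)"

definition PD_a :: "real \<Rightarrow> real \<Rightarrow> nat \<Rightarrow> real" where
  "PD_a \<alpha> \<theta> k = (\<Prod>j\<in>{2..<k}. \<theta> + real j * \<alpha>)"

text \<open>The combinatorial factor \<open>1 / (m\<^sub>1! \<cdots> m\<^sub>n!)\<close> times the multinomial coefficient.\<close>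

definition split_multiplicity :: "nat list \<Rightarrow> real" where
  "split_multiplicity ns =
     1 / (\<Prod>r\<in>{1..sum_list ns}. fact (count_list ns r)) *
     (fact (sum_list ns) / (\<Prod>m\<leftarrow>ns. fact m))"

definition PD_Z :: "real \<Rightarrow> real \<Rightarrow> nat \<Rightarrow> real" where
  "PD_Z \<alpha> \<theta> n =
     (\<Sum>ns\<in>splits n. split_multiplicity ns * (PD_a \<alpha> \<theta> (length ns) * (\<Prod>m\<leftarrow>ns. PD_w \<alpha> m)))"

definition p_PD :: "real \<Rightarrow> real \<Rightarrow> nat list \<Rightarrow> real" where
  "p_PD \<alpha> \<theta> ns =
     PD_a \<alpha> \<theta> (length ns) / PD_Z \<alpha> \<theta> (sum_list ns) * (\<Prod>m\<leftarrow>ns. PD_w \<alpha> m)"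

definition q_PD :: "real \<Rightarrow> real \<Rightarrow> nat list \<Rightarrow> real" where
  "q_PD \<alpha> \<theta> ns = split_multiplicity ns * p_PD \<alpha> \<theta> ns"


text \<open>Unlabelled trees are exactly the classes of labelled trees under relabelling.\<close>

lemma set_leaf_labels: "set_mset (leaf_labels t) = set_ptree t"
  by (induction t) auto

lemma leaf_labels_map: "leaf_labels (map_ptree f t) = image_mset f (leaf_labels t)"
proof (induction t)
  case (Branch M)
  then show ?case by (induction M) auto
qed simp

lemma delabel_eq_iff:
  assumes t: "t \<in> labelled_trees n" and t': "t' \<in> labelled_trees n"
  shows "delabel t = delabel t' \<longleftrightarrow> (\<exists>\<pi>. \<pi> permutes {1..n} \<and> t' = map_ptree \<pi> t)"
proof
  assume "delabel t = delabel t'"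
  then have "rel_ptree (=) (map_ptree (\<lambda>_. ()) t) (map_ptree (\<lambda>_. ()) t')"
    by (simp add: delabel_def ptree.rel_eq)
  then have "rel_ptree (\<lambda>_ _. True) t t'"
    by (simp add: ptree.rel_map)
  then obtain z where z: "map_ptree fst z = t" "map_ptree snd z = t'"
    by (auto simp: ptree.in_rel)
  have L: "image_mset fst (leaf_labels z) = mset_set {1..n}"
    "image_mset snd (leaf_labels z) = mset_set {1..n}"
    using t t' z by (auto simp: labelled_trees_def leaf_labels_map)
  have S: "fst ` set_ptree z = {1..n}" "snd ` set_ptree z = {1..n}"
    using arg_cong[OF L(1), of set_mset] arg_cong[OF L(2), of set_mset]
    by (simp_all add: set_leaf_labels)
  have fin: "finite (set_ptree z)"
    by (simp flip: set_leaf_labels)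
  have "size (leaf_labels z) = n"
    using arg_cong[OF L(1), of size] by simp
  moreover have "card (set_ptree z) \<le> size (leaf_labels z)"
    using size_mset_mono[OF mset_set_set_mset_msubset[of "leaf_labels z"]]
    by (simp add: set_leaf_labels)
  ultimately have le: "card (set_ptree z) \<le> n" by simp
  have inj: "inj_on fst (set_ptree z)" "inj_on snd (set_ptree z)"
    using S le fin card_image_le[OF fin, of fst] card_image_le[OF fin, of snd]
    by (auto intro!: eq_card_imp_inj_on)
  define g where "g = inv_into (set_ptree z) fst"
  define \<pi> where "\<pi> i = (if i \<in> {1..n} then snd (g i) else i)" for i
  have gb: "bij_betw g {1..n} (set_ptree z)"
    unfolding g_def by (rule bij_betw_inv_into) (simp add: bij_betw_def inj(1) S(1))
  then have "bij_betw (snd \<circ> g) {1..n} {1..n}"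
    by (rule bij_betw_trans) (simp add: bij_betw_def inj(2) S(2))
  then have "bij_betw \<pi> {1..n} {1..n}"
    by (subst bij_betw_cong[of _ _ "snd \<circ> g"]) (auto simp: \<pi>_def)
  then have "\<pi> permutes {1..n}"
    by (rule bij_imp_permutes) (auto simp: \<pi>_def)
  moreover have "map_ptree \<pi> t = t'"
  proof -
    have "map_ptree \<pi> t = map_ptree (\<pi> \<circ> fst) z"
      by (simp add: z(1)[symmetric] ptree.map_comp)
    also have "\<dots> = map_ptree snd z"
    proof (rule ptree.map_cong0)
      fix x assume x: "x \<in> set_ptree z"
      then have "fst x \<in> {1..n}" using S(1) by blast
      then show "(\<pi> \<circ> fst) x = snd x"
        using x inj(1) by (simp add: \<pi>_def g_def)
    qed
    finally show ?thesis using z by simp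
  qed
  ultimately show "\<exists>\<pi>. \<pi> permutes {1..n} \<and> t' = map_ptree \<pi> t" by blast
next
  assume "\<exists>\<pi>. \<pi> permutes {1..n} \<and> t' = map_ptree \<pi> t"
  then show "delabel t = delabel t'"
    by (auto simp: delabel_def ptree.map_comp o_def)
qed


text \<open>
  The total weight is \<open>n - \<alpha>\<close>, so that \<open>select_site\<close> is the intended distribution, and the
  growth rule stays within the labelled trees.
\<close>

lemma finite_subtrees: "finite (subtrees t)"
  by (induction t) auto

lemma self_subtree: "t \<in> subtrees t"
  by (cases t) auto

lemma leaf_labels_subset_Branch:
  assumes "c \<in># M"
  shows "leaf_labels c \<subseteq># leaf_labels (Branch M)"
proof -
  obtain N where "M = add_mset c N"
    using assms by (meson mset_add)
  then show ?thesis by simp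
qed

lemma leaf_labels_subtree: "s \<in> subtrees t \<Longrightarrow> leaf_labels s \<subseteq># leaf_labels t"
proof (induction t)
  case (Branch M)
  show ?case
  proof (cases "s = Branch M")
    case False
    then obtain c where c: "c \<in># M" "s \<in> subtrees c"
      using Branch.prems by auto
    with Branch.IH have "leaf_labels s \<subseteq># leaf_labels c" by blast
    with leaf_labels_subset_Branch[OF c(1)] show ?thesis
      using subset_mset.order_trans by blast
  qed simp
qed simp

definition branching :: "'a ptree \<Rightarrow> bool" where
  "branching t \<longleftrightarrow> (\<forall>M. Branch M \<in> subtrees t \<longrightarrow> size M \<ge> 2)"

lemma branching_simps [simp]:
  "branching (Leaf l)"
  "branching (Branch M) \<longleftrightarrow> size M \<ge> 2 \<and> (\<forall>c\<in>#M. branching c)"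
  by (auto simp: branching_def)

lemma branching_subtree: "s \<in> subtrees t \<Longrightarrow> branching t \<Longrightarrow> branching s"
  by (induction t) auto

lemma leaf_labels_nonempty: "branching t \<Longrightarrow> leaf_labels t \<noteq> {#}"
proof (induction t)
  case (Branch M)
  then have "M \<noteq> {#}" by auto
  then obtain c where c: "c \<in># M" by auto
  with Branch have "leaf_labels c \<noteq> {#}" by auto
  with leaf_labels_subset_Branch[OF c] show ?case
    by (metis subset_mset.le_zero_eq)
qed simp

lemma not_subtree_child:
  assumes br: "branching (Branch M)" and c: "c \<in># M"
  shows "Branch M \<notin> subtrees c"
proof
  assume "Branch M \<in> subtrees c"
  then have sub: "leaf_labels (Branch M) \<subseteq># leaf_labels c"
    by (rule leaf_labels_subtree)
  obtain N where N: "M = add_mset c N" using c by (meson mset_add)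
  with br have "N \<noteq> {#}" by auto
  then obtain d where d: "d \<in># N" by auto
  have "leaf_labels d \<noteq> {#}"
    using br d N by (intro leaf_labels_nonempty) simp
  with leaf_labels_subset_Branch[OF d] have "leaf_labels (Branch N) \<noteq> {#}"
    by (metis subset_mset.le_zero_eq)
  with sub show False
    using N by (auto dest!: size_mset_mono)
qed

lemma children_disjoint:
  assumes dist: "\<And>l. count (leaf_labels (Branch (add_mset c N))) l \<le> 1"
    and br: "\<forall>d\<in>#add_mset c N. branching d" and d: "d \<in># N"
  shows "subtrees c \<inter> subtrees d = {}"
proof (rule ccontr)
  assume "subtrees c \<inter> subtrees d \<noteq> {}"
  then obtain s where s: "s \<in> subtrees c" "s \<in> subtrees d" by blast
  have "branching s" using s(1) br branching_subtree by auto
  then obtain l where l: "l \<in># leaf_labels s"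
    using leaf_labels_nonempty by fastforce
  have "l \<in># leaf_labels c" "l \<in># leaf_labels d"
    using l s leaf_labels_subtree mset_subset_eqD by metis+
  moreover from this(2) have "l \<in># leaf_labels (Branch N)"
    using leaf_labels_subset_Branch[OF d] mset_subset_eqD by metis
  ultimately have "count (leaf_labels c) l \<ge> 1" "count (leaf_labels (Branch N)) l \<ge> 1"
    by (simp_all only: count_greater_eq_one_iff)
  moreover have "count (leaf_labels (Branch (add_mset c N))) l =
      count (leaf_labels c) l + count (leaf_labels (Branch N)) l" by simp
  ultimately show False using dist[of l] by linarith
qed

lemma sum_weight_aux:
  fixes \<alpha> :: real
  assumes "\<And>l. count (leaf_labels t) l \<le> 1" and "branching t"
  shows "(\<Sum>s\<in>subtrees t. case s of Leaf l \<Rightarrow> 1 - \<alpha> | Branch M \<Rightarrow> (real (size M) - 1) * \<alpha>) =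
    real (leaf_count t) - \<alpha>"
  using assms
proof (induction t)
  case (Leaf l)
  then show ?case by (simp add: leaf_count_def)
next
  case (Branch M)
  let ?f = "\<lambda>s. case s of Leaf l \<Rightarrow> 1 - \<alpha> | Branch M \<Rightarrow> (real (size M) - 1) * \<alpha>"
  have IH: "sum ?f (subtrees c) = real (leaf_count c) - \<alpha>" if "c \<in># M" for c
  proof (rule Branch.IH[OF that])
    show "count (leaf_labels c) l \<le> 1" for l
      using leaf_labels_subset_Branch[OF that] Branch.prems(1)[of l] mset_subset_eq_count
      by (metis order_trans)
    show "branching c" using Branch.prems(2) that by simp
  qed
  have "sum ?f (\<Union>c\<in>set_mset N. subtrees c) =
      real (leaf_count (Branch N)) - real (size N) * \<alpha>" if "N \<subseteq># M" for N
    using that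
  proof (induction N)
    case empty
    then show ?case by (simp add: leaf_count_def)
  next
    case (add c N)
    have sub: "add_mset c N \<subseteq># M" by fact
    then have NM: "N \<subseteq># M" and c: "c \<in># M"
      by (auto dest: mset_subset_eq_insertD subset_mset.less_imp_le)
    have "leaf_labels (Branch (add_mset c N)) \<subseteq># leaf_labels (Branch M)"
      using sub by (metis image_mset_subseteq_mono leaf_labels.simps(2) subset_mset.le_iff_add
          sum_mset.union image_mset_union)
    then have dist: "count (leaf_labels (Branch (add_mset c N))) l \<le> 1" for l
      using Branch.prems(1)[of l] mset_subset_eq_count by (metis order_trans)
    have br: "\<forall>d\<in>#add_mset c N. branching d"
      using sub Branch.prems(2) mset_subset_eqD by fastforce
    have disj: "subtrees c \<inter> (\<Union>d\<in>set_mset N. subtrees d) = {}"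
      using children_disjoint[OF dist br] by blast
    have "sum ?f (\<Union>d\<in>set_mset (add_mset c N). subtrees d) =
        sum ?f (subtrees c) + sum ?f (\<Union>d\<in>set_mset N. subtrees d)"
      using disj by (simp add: sum.union_disjoint finite_subtrees)
    then show ?case
      using IH[OF c] add.IH[OF NM] by (simp add: leaf_count_def algebra_simps)
  qed
  from this[of M] have U: "sum ?f (\<Union>c\<in>set_mset M. subtrees c) =
      real (leaf_count (Branch M)) - real (size M) * \<alpha>" by simp
  have "Branch M \<notin> (\<Union>c\<in>set_mset M. subtrees c)"
    using not_subtree_child[OF Branch.prems(2)] by blast
  then have "sum ?f (subtrees (Branch M)) = ?f (Branch M) + sum ?f (\<Union>c\<in>set_mset M. subtrees c)"
    by (simp add: finite_subtrees)
  with U show ?case by (simp add: algebra_simps)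
qed

lemma finite_sites: "finite (sites t)"
  by (simp add: sites_def finite_subtrees)

lemma labelled_treesD:
  assumes "t \<in> labelled_trees n"
  shows "branching t" "count (leaf_labels t) l \<le> 1" "leaf_count t = n"
  using assms by (auto simp: labelled_trees_def branching_def leaf_count_def count_mset_set')

lemma sum_weight:
  assumes "t \<in> labelled_trees n"
  shows "(\<Sum>x\<in>sites t. weight \<alpha> \<gamma> x) = real n - \<alpha>"
proof -
  let ?B = "subtrees t \<inter> range Branch"
  have "(\<Sum>x\<in>sites t. weight \<alpha> \<gamma> x) =
      (\<Sum>s\<in>subtrees t. weight \<alpha> \<gamma> (Edge s)) + (\<Sum>s\<in>?B. weight \<alpha> \<gamma> (Vertex s))"
    unfolding sites_def
    by (subst sum.union_disjoint) (auto simp: finite_subtrees sum.reindex inj_on_def)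
  also have "(\<Sum>s\<in>?B. weight \<alpha> \<gamma> (Vertex s)) =
      (\<Sum>s\<in>subtrees t. if s \<in> range Branch then weight \<alpha> \<gamma> (Vertex s) else 0)"
    by (simp add: finite_subtrees sum.inter_restrict)
  also have "(\<Sum>s\<in>subtrees t. weight \<alpha> \<gamma> (Edge s)) + \<dots> =
      (\<Sum>s\<in>subtrees t. case s of Leaf l \<Rightarrow> 1 - \<alpha> | Branch M \<Rightarrow> (real (size M) - 1) * \<alpha>)"
    unfolding sum.distrib[symmetric]
    by (rule sum.cong) (auto split: ptree.split)
  also have "\<dots> = real n - \<alpha>"
    using labelled_treesD[OF assms] by (subst sum_weight_aux) auto
  finally show ?thesis .
qed

lemma weight_nonneg:
  assumes "t \<in> labelled_trees n" "x \<in> sites t" "0 \<le> \<alpha>" "\<alpha> \<le> 1" "0 \<le> \<gamma>" "\<gamma> \<le> \<alpha>"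
  shows "weight \<alpha> \<gamma> x \<ge> 0"
proof (cases "\<exists>M. x = Vertex (Branch M)")
  case True
  then obtain M where M: "x = Vertex (Branch M)" "size M \<ge> 2"
    using assms(1,2) by (auto simp: sites_def labelled_trees_def)
  then have "1 * \<alpha> \<le> (real (size M) - 1) * \<alpha>"
    using assms by (intro mult_right_mono) auto
  with M assms show ?thesis by simp
next
  case False
  then obtain s where "x = Edge s" using assms(2) by (auto simp: sites_def)
  then show ?thesis using assms by (cases s) auto
qed

lemma pmf_select_site:
  assumes t: "t \<in> labelled_trees n" and n: "n \<ge> 2"
    and par: "0 \<le> \<alpha>" "\<alpha> \<le> 1" "0 \<le> \<gamma>" "\<gamma> \<le> \<alpha>"
  shows "pmf (select_site \<alpha> \<gamma> t) x = (if x \<in> sites t then weight \<alpha> \<gamma> x / (real n - \<alpha>) else 0)"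
proof -
  let ?f = "\<lambda>x. if x \<in> sites t then weight \<alpha> \<gamma> x / (\<Sum>y\<in>sites t. weight \<alpha> \<gamma> y) else 0"
  have pos: "real n - \<alpha> > 0" using n par by linarith
  have nn: "?f x \<ge> 0" for x
    using weight_nonneg[OF t _ par] pos by (auto simp: sum_weight[OF t])
  have "(\<integral>\<^sup>+x. ennreal (?f x) \<partial>count_space UNIV) = (\<Sum>x\<in>sites t. ennreal (?f x))"
    by (rule nn_integral_count_space') (auto simp: finite_sites)
  also have "\<dots> = ennreal (\<Sum>x\<in>sites t. ?f x)"
    by (rule sum_ennreal) (rule nn)
  also have "(\<Sum>x\<in>sites t. ?f x) = 1"
    using pos by (simp add: sum_weight[OF t] flip: sum_divide_distrib)
  finally have "pmf (embed_pmf ?f) x = ?f x"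
    using nn by (intro pmf_embed_pmf) auto
  then show ?thesis by (simp add: select_site_def sum_weight[OF t])
qed

lemma replace_id: "s \<notin> subtrees t \<Longrightarrow> replace s s' t = t"
proof (induction t)
  case (Branch M)
  then have "image_mset (replace s s') M = image_mset (\<lambda>x. x) M"
    by (intro image_mset_cong) auto
  with Branch show ?case by auto
qed auto

lemma branching_replace: "branching t \<Longrightarrow> branching s' \<Longrightarrow> branching (replace s s' t)"
  by (induction t) auto

lemma leaf_labels_replace:
  assumes "s \<in> subtrees t" "branching t" "\<And>l. count (leaf_labels t) l \<le> 1"
  shows "leaf_labels (replace s s' t) + leaf_labels s = leaf_labels t + leaf_labels s'"
  using assms
proof (induction t)
  case (Branch M)
  show ?case
  proof (cases "s = Branch M")
    case False
    then obtain c where c: "c \<in># M" "s \<in> subtrees c"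
      using Branch.prems by auto
    obtain N where N: "M = add_mset c N" using c(1) by (meson mset_add)
    have "s \<notin> subtrees d" if "d \<in># N" for d
      using children_disjoint[of c N d] Branch.prems(2,3) N c(2) that by auto
    then have "image_mset (replace s s') N = image_mset (\<lambda>x. x) N"
      by (intro image_mset_cong replace_id) auto
    moreover have "leaf_labels (replace s s' c) + leaf_labels s = leaf_labels c + leaf_labels s'"
    proof (rule Branch.IH[OF c])
      show "branching c" using Branch.prems(2) c(1) by simp
      show "count (leaf_labels c) l \<le> 1" for l
        using leaf_labels_subset_Branch[OF c(1)] Branch.prems(3)[of l] mset_subset_eq_count
        by (metis order_trans)
    qed
    ultimately show ?thesis using False N by (simp add: ac_simps)
  qed simp
qed auto

lemma insert_leaf_labelled_trees:
  assumes t: "t \<in> labelled_trees n" and x: "x \<in> sites t"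
  shows "insert_leaf (Suc n) t x \<in> labelled_trees (Suc n)"
proof -
  have [simp]: "mset_set {Suc 0..Suc n} = add_mset (Suc n) (mset_set {Suc 0..n})"
    by (simp add: atLeastAtMostSuc_conv)
  obtain s s' where s: "s \<in> subtrees t" "insert_leaf (Suc n) t x = replace s s' t"
    "leaf_labels s' = add_mset (Suc n) (leaf_labels s)" "branching s \<Longrightarrow> branching s'"
    using x by (force simp: sites_def)
  have "leaf_labels (replace s s' t) + leaf_labels s = leaf_labels t + leaf_labels s'"
    using leaf_labels_replace[OF s(1) labelled_treesD(1,2)[OF t]] .
  then have "leaf_labels (replace s s' t) = add_mset (Suc n) (leaf_labels t)"
    by (simp add: s(3))
  moreover have "branching (replace s s' t)"
    using labelled_treesD(1)[OF t] s branching_subtree by (blast intro: branching_replace)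
  ultimately show ?thesis
    using t s(2) by (simp add: labelled_trees_def branching_def)
qed

lemma alpha_gamma_tree_labelled_trees:
  assumes "n \<ge> 1" "0 \<le> \<alpha>" "\<alpha> \<le> 1" "0 \<le> \<gamma>" "\<gamma> \<le> \<alpha>"
  shows "set_pmf (alpha_gamma_tree \<alpha> \<gamma> n) \<subseteq> labelled_trees n"
  using assms
proof (induction \<alpha> \<gamma> n rule: alpha_gamma_tree.induct)
  case 1
  show ?case by (simp add: labelled_trees_def)
next
  case 2
  have "{1..Suc (Suc 0)} = {1, 2}" by auto
  then show ?case by (simp add: labelled_trees_def)
next
  case (3 \<alpha> \<gamma> n)
  note par = 3(3-6)
  show ?case
  proof
    fix t' assume "t' \<in> set_pmf (alpha_gamma_tree \<alpha> \<gamma> (Suc (Suc (Suc n))))"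
    then obtain t x where t: "t \<in> set_pmf (alpha_gamma_tree \<alpha> \<gamma> (Suc (Suc n)))"
      and x: "x \<in> set_pmf (select_site \<alpha> \<gamma> t)"
      and t': "t' = insert_leaf (Suc (Suc (Suc n))) t x"
      by auto
    from t 3 have tl: "t \<in> labelled_trees (Suc (Suc n))" by auto
    have "x \<in> sites t"
      using x pmf_select_site[OF tl _ par, of x] by (auto simp: set_pmf_eq split: if_splits)
    then show "t' \<in> labelled_trees (Suc (Suc (Suc n)))"
      unfolding t' by (rule insert_leaf_labelled_trees[OF tl])
  qed
qed auto

end

theory Submission
  imports Defs "HOL-Combinatorics.Multiset_Permutations"
begin

text \<open>
  Removing the leaf with the largest label shows that every tree arises from exactly one tree and
  one insertion site. Hence for \<open>\<alpha> < 1\<close> the probability of \<open>T\<^sub>n = t\<close> is \<open>1 / PD_w \<alpha> n\<close> times a product over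
  the branch points of \<open>t\<close>: a branch point with \<open>k\<close> children contributes \<open>PD_a \<alpha> (- \<alpha> - \<gamma>) k\<close>, times \<open>\<gamma>\<close>
  if the two least labels above it lie in the same child, and times \<open>1 - \<alpha>\<close> otherwise, because the
  edge split when the second child appeared was an inner edge or a leaf edge, respectively.
  This product is compatible with monotone relabelling, so that summing it over all labellings with
  a given partition of \<open>{1..n}\<close> at the first branch point factorises over the blocks. What remains
  is to count ordered set partitions with given block sizes, and those that have two given points
  in the same block, by double counting.
\<close>

subsection \<open>Removal of a leaf\<close>

text \<open>Labels enter the weight of a tree only through the factors \<gamma> and 1 - \<alpha>.
  These coincide exactly when \<gamma> = 1 - \<alpha>, which is the reason for (b); its necessity is
  already visible at n = 3. For (a), averaging the factor of the first branch point over all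
  partitions with block sizes n_i gives \<gamma> + (1 - \<alpha> - \<gamma>) p, where p = \<Sum> n_i
  n_j / (n (n - 1)) over i \<noteq> j is the probability that two fixed labels fall into different
  blocks. This is the origin of the factor in front of \<open>q_PD\<close>. The obstacle is
  symmetry: components form multisets, and after delabelling several of them may be equal. Sums are
  therefore taken over lists of components. Labelled components have disjoint nonempty label sets,
  so a labelled tree with k components has exactly k! listings, whatever coincidences its shape has;
  rearrangements of a multiset of shapes are counted separately.\<close>

definition trees_on :: "'a set \<Rightarrow> 'a ptree set" where
  "trees_on B = {t. leaf_labels t = mset_set B \<and> branching t}"

lemma labelled_trees_eq: "labelled_trees n = trees_on {1..n}"
  by (simp add: labelled_trees_def trees_on_def branching_def)

text \<open>The multiset \<open>mset_set B\<close> is empty for infinite B, whereas a branching tree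
  has at least one leaf.\<close>

lemma trees_on_finite:
  assumes "t \<in> trees_on B" shows "finite B"
proof (rule ccontr)
  assume "infinite B"
  then have "leaf_labels t = {#}" using assms by (simp add: trees_on_def)
  then show False using leaf_labels_nonempty[of t] assms by (simp add: trees_on_def)
qed

lemma trees_on_set:
  assumes "t \<in> trees_on B" shows "set_ptree t = B"
proof -
  have "leaf_labels t = mset_set B" using assms by (simp add: trees_on_def)
  then have "set_mset (leaf_labels t) = B" using trees_on_finite[OF assms] by simp
  then show ?thesis by (simp add: set_leaf_labels)
qed

lemma trees_on_nonempty:
  assumes "t \<in> trees_on B" shows "B \<noteq> {}"
  using leaf_labels_nonempty[of t] assms by (auto simp: trees_on_def)

lemma Leaf_trees_on [simp]: "Leaf l \<in> trees_on B \<longleftrightarrow> B = {l}"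
proof
  assume "Leaf l \<in> trees_on B"
  from trees_on_set[OF this] show "B = {l}" by simp
qed (simp add: trees_on_def)

lemma subseteq_mset_set:
  assumes "A \<subseteq># mset_set B"
  shows "A = mset_set (set_mset A)"
proof (rule multiset_eqI)
  fix x
  have "count A x \<le> 1"
    using mset_subset_eq_count[OF assms, of x] by (simp add: count_mset_set' split: if_splits)
  then have "count A x = 0 \<or> count A x = 1" by linarith
  then show "count A x = count (mset_set (set_mset A)) x"
    unfolding count_mset_set' using count_eq_zero_iff[of A x] by auto
qed

lemma child_trees_on:
  assumes "Branch M \<in> trees_on B" and c: "c \<in># M"
  shows "c \<in> trees_on (set_ptree c)"
proof -
  have "leaf_labels c \<subseteq># mset_set B"
    using leaf_labels_subset_Branch[OF c] assms by (simp add: trees_on_def)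
  then show ?thesis
    using subseteq_mset_set[of "leaf_labels c" B] assms by (simp add: trees_on_def set_leaf_labels)
qed

text \<open>A common label would have multiplicity at least 2 in \<open>mset_set B\<close>. The
  trees c and d are two members of the multiset of children and need not be assumed distinct as
  trees, so this also excludes repeated children.\<close>

lemma child_labels_disjoint:
  assumes "Branch (add_mset c N) \<in> trees_on B" and d: "d \<in># N"
  shows "set_ptree c \<inter> set_ptree d = {}"
proof -
  have "leaf_labels c + leaf_labels d \<subseteq># mset_set B"
  proof -
    obtain K where "N = add_mset d K" using d by (meson mset_add)
    then have "mset_set B = leaf_labels c + leaf_labels d + leaf_labels (Branch K)"
      using assms by (simp add: trees_on_def add.assoc)
    then show ?thesis by simp
  qed
  then have "count (leaf_labels c) l + count (leaf_labels d) l \<le> 1" for l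
    using mset_subset_eq_count[of "leaf_labels c + leaf_labels d" "mset_set B" l]
    by (simp add: count_mset_set' split: if_splits)
  have "count (leaf_labels c) l \<ge> 1 \<and> count (leaf_labels d) l \<ge> 1"
    if "l \<in> set_ptree c" "l \<in> set_ptree d" for l
    using that unfolding set_leaf_labels[symmetric] by (simp only: count_greater_eq_one_iff)
  have "\<not> (l \<in> set_ptree c \<and> l \<in> set_ptree d)" for l
  proof -
    have "count (leaf_labels c) l + count (leaf_labels d) l \<le> 1" by fact
    moreover have "l \<in> set_ptree c \<Longrightarrow> l \<in> set_ptree d \<Longrightarrow>
        count (leaf_labels c) l \<ge> 1 \<and> count (leaf_labels d) l \<ge> 1" by fact
    ultimately show ?thesis by linarith
  qed
  then show ?thesis by blast
qed

lemma size_children_ge_2: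
  assumes "Branch M \<in> trees_on B" shows "2 \<le> size M"
  using assms by (simp add: trees_on_def)

lemma two_children:
  assumes "Branch M \<in> trees_on B"
  obtains d e K where "M = {#d, e#} + K"
proof -
  from size_children_ge_2[OF assms] obtain d M' where M': "M = add_mset d M'"
    by (cases M) fastforce+
  with size_children_ge_2[OF assms] obtain e K where "M' = add_mset e K"
    by (cases M') fastforce+
  with M' that show ?thesis by simp
qed

lemma sites_Branch:
  "sites (Branch M) = {Edge (Branch M), Vertex (Branch M)} \<union> (\<Union>c\<in>set_mset M. sites c)"
  by (auto simp: sites_def)

text \<open>\<open>replace\<close> acts on every occurrence of the addressed subtree. Here there is
  only one: the whole tree is not a subtree of its child c, and siblings of c share no subtree with
  c.\<close>

lemma insert_leaf_child:
  assumes M: "Branch (add_mset c N) \<in> trees_on B" and x: "x \<in> sites c"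
  shows "insert_leaf l (Branch (add_mset c N)) x = Branch (add_mset (insert_leaf l c x) N)"
proof -
  \<comment> \<open>For either kind of site, insertion replaces one subtree s by some s', and this
    pair does not depend on the surrounding tree.\<close>
  obtain s s' where s: "s \<in> subtrees c" "\<And>t. insert_leaf l t x = replace s s' t"
    using x by (force simp: sites_def)
  have br: "branching (Branch (add_mset c N))" using M by (simp add: trees_on_def)
  have "s \<noteq> Branch (add_mset c N)"
    using s(1) not_subtree_child[OF br, of c] by auto
  moreover have "s \<notin> subtrees d" if "d \<in># N" for d
  proof -
    have "subtrees c \<inter> subtrees d = {}"
      using M that by (intro children_disjoint) (auto simp: trees_on_def count_mset_set')
    then show ?thesis using s(1) by auto
  qed
  then have "image_mset (replace s s') N = image_mset (\<lambda>d. d) N"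
    by (intro image_mset_cong replace_id)
  ultimately show ?thesis using s by auto
qed

text \<open>The recursive description of insertion that the inductions below use: the site is the
  lowest edge, the lowest branch point, or a site of exactly one child.\<close>

lemma insert_leaf_cases [consumes 2, case_names Edge Vertex child]:
  assumes t: "t \<in> trees_on B" and x: "x \<in> sites t"
  obtains "x = Edge t" "insert_leaf l t x = Branch {#t, Leaf l#}"
  | M where "t = Branch M" "x = Vertex t" "insert_leaf l t x = Branch (add_mset (Leaf l) M)"
  | c N where "t = Branch (add_mset c N)" "x \<in> sites c"
    "insert_leaf l t x = Branch (add_mset (insert_leaf l c x) N)"
proof (cases t)
  case (Leaf a)
  then show ?thesis using x that(1) by (auto simp: sites_def)
next
  case (Branch M)
  consider "x = Edge t" | "x = Vertex t" | c where "c \<in># M" "x \<in> sites c"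
    using x by (auto simp: Branch sites_Branch)
  then show ?thesis
  proof cases
    case 1
    then show ?thesis using that(1) by (cases t) auto
  next
    case 2
    then show ?thesis using that(2) Branch by auto
  next
    case 3
    from 3(1) obtain N where "M = add_mset c N" by (meson mset_add)
    then show ?thesis
      using that(3)[of c N] insert_leaf_child[of c N B x l] 3 t Branch by simp
  qed
qed

lemma insert_leaf_trees_on:
  assumes "t \<in> trees_on B" "x \<in> sites t" "l \<notin> B"
  shows "insert_leaf l t x \<in> trees_on (insert l B)"
  using assms
proof (induction t arbitrary: B)
  case (Leaf a)
  then show ?case using trees_on_finite[OF Leaf(1)] by (auto simp: sites_def trees_on_def)
next
  case (Branch M)
  have fin: "finite B" using Branch.prems(1) by (rule trees_on_finite)
  from Branch.prems(1,2) show ?case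
  proof (cases rule: insert_leaf_cases[where l = l])
    case Edge
    then show ?thesis using Branch.prems fin by (auto simp: trees_on_def)
  next
    case (Vertex M')
    then show ?thesis using Branch.prems fin by (auto simp: trees_on_def)
  next
    case (child c N)
    have c: "c \<in># M" using child by auto
    have ct: "c \<in> trees_on (set_ptree c)" using Branch.prems(1) c by (rule child_trees_on)
    have "set_ptree c \<subseteq> B" using trees_on_set[OF Branch.prems(1)] c by auto
    then have "l \<notin> set_ptree c" using Branch.prems(3) by auto
    from Branch.IH[OF c ct child(2) this]
    have I: "insert_leaf l c x \<in> trees_on (insert l (set_ptree c))" .
    have "leaf_labels (insert_leaf l c x) = add_mset l (leaf_labels c)"
      using I ct \<open>l \<notin> set_ptree c\<close> trees_on_finite[OF ct] by (simp add: trees_on_def)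
    moreover have "branching (insert_leaf l c x)" using I by (simp add: trees_on_def)
    ultimately show ?thesis using Branch.prems fin child by (auto simp: trees_on_def)
  qed
qed

text \<open>Consequently, if \<open>Leaf l\<close> is a child of the root branch point after
  insertion of a new label l, the site was the lowest edge or the lowest branch point. This
  separates the cases in the injectivity proof.\<close>

lemma insert_leaf_not_Leaf:
  assumes "t \<in> trees_on B" "x \<in> sites t" shows "insert_leaf l t x \<noteq> Leaf a"
  using assms by (cases rule: insert_leaf_cases[where l = l]) auto

text \<open>The position of the leaf l reveals the site. If l is a child of the first branch point,
  it has one sibling when an edge was split and at least two when a branch point was enlarged, as no
  branch point has a single child. Otherwise the child containing l is determined by l, and the
  induction hypothesis applies to it.\<close>

lemma insert_leaf_inj:
  assumes "t \<in> trees_on B" "x \<in> sites t" "l \<notin> B" "t' \<in> trees_on B'" "x' \<in> sites t'" "l \<notin> B'"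
    and "insert_leaf l t x = insert_leaf l t' x'"
  shows "t = t' \<and> x = x'"
  using assms
proof (induction t arbitrary: B t' B')
  case (Leaf a)
  then have x: "x = Edge (Leaf a)" by (auto simp: sites_def)
  from Leaf(4,5) show ?case
  proof (cases rule: insert_leaf_cases[where l = l])
    case Edge
    then show ?thesis using x Leaf.prems by (auto simp: add_eq_conv_ex)
  next
    case (Vertex M)
    then have "{#Leaf a, Leaf l#} = add_mset (Leaf l) M" using x Leaf.prems by auto
    then have "M = {#Leaf a#}" using Leaf.prems(1,3) by (auto simp: add_eq_conv_ex)
    then show ?thesis using Vertex Leaf(4) by (simp add: trees_on_def)
  next
    case (child c N)
    then have "{#Leaf a, Leaf l#} = add_mset (insert_leaf l c x') N" using x Leaf.prems by auto
    then have "Leaf l \<in># add_mset (insert_leaf l c x') N"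
        by (simp flip: \<open>_ = add_mset (insert_leaf l c x') N\<close>)
    moreover have "insert_leaf l c x' \<noteq> Leaf l"
      using child Leaf.prems(4) child_trees_on insert_leaf_not_Leaf by (metis union_single_eq_member)
    ultimately have "l \<in> set_ptree t'" using child by force
    then show ?thesis using trees_on_set Leaf.prems by metis
  qed
next
  case (Branch M)
  let ?t = "Branch M"
  have child_no: "Leaf l \<notin># add_mset (insert_leaf l c y) N"
    if "u = Branch (add_mset c N)" "y \<in> sites c" "u \<in> trees_on A" "l \<notin> A" for u c N y A
  proof
    assume "Leaf l \<in># add_mset (insert_leaf l c y) N"
    moreover have "insert_leaf l c y \<noteq> Leaf l"
      using that child_trees_on insert_leaf_not_Leaf by (metis union_single_eq_member)
    ultimately have "l \<in> set_ptree u" using that by force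
    then show False using trees_on_set that by metis
  qed
  from Branch.prems(1,2) show ?case
  proof (cases rule: insert_leaf_cases[where l = l])
    case Edge
    note E = this
    from Branch.prems(4,5) show ?thesis
    proof (cases rule: insert_leaf_cases[where l = l])
      case Edge
      then show ?thesis using E Branch.prems by (auto simp: add_eq_conv_ex)
    next
      case (Vertex M')
      then have "{#?t, Leaf l#} = add_mset (Leaf l) M'" using E Branch.prems by auto
      then have "M' = {#?t#}" by (simp add: add_eq_conv_ex)
      then show ?thesis using Vertex Branch.prems(4) by (simp add: trees_on_def)
    next
      case (child c N)
      then have "{#?t, Leaf l#} = add_mset (insert_leaf l c x') N" using E Branch.prems by auto
      then have "Leaf l \<in># add_mset (insert_leaf l c x') N"
        by (simp flip: \<open>_ = add_mset (insert_leaf l c x') N\<close>)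
      then show ?thesis using child_no[OF child(1,2) Branch.prems(4,6)] by blast
    qed
  next
    case (Vertex M0)
    note V = this
    from Branch.prems(4,5) show ?thesis
    proof (cases rule: insert_leaf_cases[where l = l])
      case Edge
      then have "{#t', Leaf l#} = add_mset (Leaf l) M" using V Branch.prems by auto
      then have "M = {#t'#}" using Branch.prems(4,6) by (auto simp: add_eq_conv_ex)
      then show ?thesis using Branch.prems(1) by (simp add: trees_on_def)
    next
      case (Vertex M')
      then show ?thesis using V Branch.prems by auto
    next
      case (child c N)
      then have "add_mset (Leaf l) M = add_mset (insert_leaf l c x') N" using V Branch.prems by auto
      then have "Leaf l \<in># add_mset (insert_leaf l c x') N" by (metis union_single_eq_member)
      then show ?thesis using child_no[OF child(1,2) Branch.prems(4,6)] by blast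
    qed
  next
    case (child c N)
    note C = this
    note no = child_no[OF child(1,2) Branch.prems(1,3)]
    from Branch.prems(4,5) show ?thesis
    proof (cases rule: insert_leaf_cases[where l = l])
      case Edge
      then have "add_mset (insert_leaf l c x) N = {#t', Leaf l#}" using C Branch.prems by auto
      then have "Leaf l \<in># add_mset (insert_leaf l c x) N" by simp
      then show ?thesis using no by blast
    next
      case (Vertex M')
      then have "add_mset (insert_leaf l c x) N = add_mset (Leaf l) M'" using C Branch.prems by auto
      then have "Leaf l \<in># add_mset (insert_leaf l c x) N" by simp
      then show ?thesis using no by blast
    next
      case (child c' N')
      have c: "c \<in> trees_on (set_ptree c)" "c' \<in> trees_on (set_ptree c')"
        using C child Branch.prems(1,4) by (auto intro: child_trees_on)
      have l: "l \<notin> set_ptree c" "l \<notin> set_ptree c'" "\<And>d. d \<in># N' \<Longrightarrow> l \<notin> set_ptree d"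
        using C child Branch.prems trees_on_set[OF Branch.prems(1)] trees_on_set[OF Branch.prems(4)]
        by auto
      \<comment> \<open>The modified child is the only one that carries l, so it must be the
        modified child on the other side as well.\<close>
      have "l \<in> set_ptree (insert_leaf l c x)"
        using trees_on_set[OF insert_leaf_trees_on[OF c(1) C(2) l(1)]] by auto
      then have nin: "insert_leaf l c x \<notin># N'" using l(3) by auto
      have eq: "add_mset (insert_leaf l c x) N = add_mset (insert_leaf l c' x') N'"
        using C child Branch.prems(7) by auto
      with nin have eq1: "insert_leaf l c x = insert_leaf l c' x'"
        by (auto simp: add_eq_conv_ex)
      with eq have "N = N'" by simp
      moreover have "c = c' \<and> x = x'"
        using C(1) by (intro Branch.IH[OF _ c(1) C(2) l(1) c(2) child(2) l(2) eq1]) auto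
      ultimately show ?thesis using C child by auto
    qed
  qed
qed

text \<open>Deletion of the leaf l, by recursion into the child that contains l. If that child is
  the leaf itself, its branch point either keeps at least two children or is suppressed.\<close>

lemma insert_leaf_surj:
  assumes "t' \<in> trees_on B'" "l \<in> B'" "B' \<noteq> {l}"
  shows "\<exists>t x. t \<in> trees_on (B' - {l}) \<and> x \<in> sites t \<and> t' = insert_leaf l t x"
  using assms
proof (induction t' arbitrary: B')
  case (Leaf a)
  then show ?case by auto
next
  case (Branch M)
  have fin: "finite B'" using Branch.prems(1) by (rule trees_on_finite)
  have "l \<in> set_ptree (Branch M)" using trees_on_set Branch.prems by metis
  then obtain c where c: "c \<in># M" "l \<in> set_ptree c" by auto
  then obtain N where N: "M = add_mset c N" by (meson mset_add)
  have ct: "c \<in> trees_on (set_ptree c)" using Branch.prems(1) c(1) by (rule child_trees_on)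
  have mB: "mset_set B' = add_mset l (mset_set (B' - {l}))"
    using Branch.prems fin by (simp add: mset_set.remove)
  show ?case
  proof (cases "set_ptree c = {l}")
    case False
    from Branch.IH[OF c(1) ct c(2) False] obtain d x where
      d: "d \<in> trees_on (set_ptree c - {l})" "x \<in> sites d" "c = insert_leaf l d x" by blast
    have "leaf_labels c = add_mset l (leaf_labels d)"
      using ct d(1) c trees_on_finite[OF ct]
      by (simp add: trees_on_def mset_set.remove)
    then have t: "Branch (add_mset d N) \<in> trees_on (B' - {l})"
      using Branch.prems(1) d(1) N mB by (auto simp: trees_on_def)
    moreover have "Branch M = insert_leaf l (Branch (add_mset d N)) x"
      using insert_leaf_child[OF t d(2)] d(3) N by simp
    moreover have "x \<in> sites (Branch (add_mset d N))"
      using d(2) by (auto simp: sites_Branch)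
    ultimately show ?thesis by blast
  next
    case True
    \<comment> \<open>A branch point would have two children with disjoint nonempty label sets, both
      contained in {l}.\<close>
    have "c = Leaf l"
    proof (cases c)
      case (Leaf b)
      then show ?thesis using True by simp
    next
      case (Branch K)
      obtain d e K' where K: "K = {#d, e#} + K'"
        using two_children ct Branch by blast
      then have "set_ptree d \<inter> set_ptree e = {}"
        using child_labels_disjoint[of d "add_mset e K'" "set_ptree c" e] ct Branch by auto
      moreover have "set_ptree d \<subseteq> {l}" "set_ptree e \<subseteq> {l}" using True K Branch by auto
      moreover have "set_ptree d \<noteq> {}" "set_ptree e \<noteq> {}"
        using child_trees_on[of K "set_ptree c"] ct Branch K trees_on_nonempty
        by (metis add_mset_add_single union_iff union_single_eq_member)+
      ultimately show ?thesis by blast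
    qed
    have NB: "leaf_labels (Branch N) = mset_set (B' - {l})"
      using Branch.prems(1) N \<open>c = Leaf l\<close> mB by (simp add: trees_on_def)
    show ?thesis
    proof (cases "size N \<ge> 2")
      case True
      then have "Branch N \<in> trees_on (B' - {l})"
        using Branch.prems(1) N NB by (simp add: trees_on_def)
      moreover have "Branch M = insert_leaf l (Branch N) (Vertex (Branch N))"
        using N \<open>c = Leaf l\<close> by simp
      moreover have "Vertex (Branch N) \<in> sites (Branch N)" by (simp add: sites_Branch)
      ultimately show ?thesis by blast
    next
      case False
      \<comment> \<open>Without l the branch point would have degree 2 and disappears, so l was
        inserted in the edge carrying its sibling d.\<close>
      then have "size N = 1" using size_children_ge_2[OF Branch.prems(1)] N by simp
      then obtain d where d: "N = {#d#}" using size_1_singleton_mset by blast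
      then have "d \<in> trees_on (B' - {l})" using Branch.prems(1) N NB by (simp add: trees_on_def)
      moreover have "Branch M = insert_leaf l d (Edge d)"
        using N \<open>c = Leaf l\<close> d by (cases d) auto
      moreover have "Edge d \<in> sites d" by (simp add: sites_def self_subtree)
      ultimately show ?thesis by blast
    qed
  qed
qed


subsection \<open>Product formula for the law of the labelled tree\<close>

lemma card_Branch_ge_2:
  assumes t: "Branch M \<in> trees_on B" shows "2 \<le> card B"
proof -
  obtain d e K where K: "M = {#d, e#} + K" using two_children[OF t] .
  have "set_ptree d \<inter> set_ptree e = {}"
    using child_labels_disjoint[of d "add_mset e K" B e] t K by simp
  moreover have "set_ptree d \<noteq> {}" "set_ptree e \<noteq> {}"
    using child_trees_on[OF t, THEN trees_on_nonempty] K by auto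
  moreover have "set_ptree d \<subseteq> B" "set_ptree e \<subseteq> B"
    using trees_on_set[OF t] K by auto
  ultimately obtain a b where "a \<in> B" "b \<in> B" "a \<noteq> b" by blast
  moreover have "finite B" using t by (rule trees_on_finite)
  ultimately show ?thesis using card_mono[of B "{a, b}"] by auto
qed

definition two_least :: "'a::linorder set \<Rightarrow> 'a set" where
  "two_least B = {Min B, Min (B - {Min B})}"

text \<open>Leaves arrive in increasing order of their labels. Once two labels are present above a
  branch point, the pair is therefore final, and so is the choice between the factors \<gamma> and 1
  - \<alpha> there.\<close>

lemma two_least_insert:
  assumes fin: "finite B" and B: "2 \<le> card B" and l: "\<And>b. b \<in> B \<Longrightarrow> b < l"
  shows "two_least (insert l B) = two_least B"
proof -
  have ne: "B \<noteq> {}" using B by auto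
  have m: "Min (insert l B) = Min B"
    using fin ne less_imp_le[OF l[OF Min_in[OF fin ne]]] by (metis Min_insert min.absorb2)
  have "card (B - {Min B}) \<noteq> 0"
    using B fin ne by simp
  then have ne': "B - {Min B} \<noteq> {}" by (metis card.empty)
  have "insert l B - {Min B} = insert l (B - {Min B})"
    using l[OF Min_in[OF fin ne]] by auto
  moreover have "Min (insert l (B - {Min B})) = Min (B - {Min B})"
    using fin ne' l[of "Min (B - {Min B})"] Min_in[OF _ ne']
    by (metis Diff_iff Min_insert finite_Diff less_imp_le min.absorb2)
  ultimately show ?thesis using m by (simp add: two_least_def)
qed

lemma two_least_subset:
  assumes fin: "finite B" and B: "2 \<le> card B"
  shows "two_least B \<subseteq> B"
proof -
  have "B \<noteq> {}" using B by auto
  moreover from this have "card (B - {Min B}) \<noteq> 0" using B fin by simp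
  then have "B - {Min B} \<noteq> {}" by (metis card.empty)
  ultimately show ?thesis
    using fin Min_in[of B] Min_in[of "B - {Min B}"] by (auto simp: two_least_def)
qed

text \<open>The number k of children is passed separately from the set C of their label sets. It
  need not be recovered as a cardinality, and the same expression applies to the set of blocks of an
  ordered partition.\<close>

definition split_weight :: "real \<Rightarrow> real \<Rightarrow> nat \<Rightarrow> 'a::linorder set set \<Rightarrow> real" where
  "split_weight \<alpha> \<gamma> k C =
     PD_a \<alpha> (- \<alpha> - \<gamma>) k * (if \<exists>X\<in>C. two_least (\<Union>C) \<subseteq> X then \<gamma> else 1 - \<alpha>)"

primrec tree_weight :: "real \<Rightarrow> real \<Rightarrow> 'a::linorder ptree \<Rightarrow> real" where
  "tree_weight \<alpha> \<gamma> (Leaf l) = 1"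
| "tree_weight \<alpha> \<gamma> (Branch M) = split_weight \<alpha> \<gamma> (size M) (set_ptree ` set_mset M) *
     prod_mset (image_mset (tree_weight \<alpha> \<gamma>) M)"

lemma PD_a_2: "PD_a \<alpha> \<theta> 2 = 1"
  by (simp add: PD_a_def)

text \<open>For \<theta> = - \<alpha> - \<gamma> the new factor is (k - 1) \<alpha> - \<gamma>, the
  weight of a branch point with k children. This is where the second parameter of
  \<open>q_PD\<close> comes from.\<close>

lemma PD_a_Suc: "2 \<le> k \<Longrightarrow> PD_a \<alpha> \<theta> (Suc k) = PD_a \<alpha> \<theta> k * (\<theta> + real k * \<alpha>)"
  by (simp add: PD_a_def atLeastLessThanSuc mult.commute)

lemma two_least_Leaf:
  assumes "a < l" shows "two_least {a, l} = {a, l}"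
  using assms by (simp add: two_least_def min_def insert_Diff_if less_imp_le less_imp_neq)

text \<open>Only the factor of the created or enlarged branch point changes. A branch point created
  on a leaf edge separates its two labels and contributes 1 - \<alpha>; one created on an inner edge
  has all earlier labels in one child and contributes \<gamma>; an enlarged one gains a factor of
  \<open>PD_a\<close>. All other factors stay the same because l exceeds every label.\<close>

lemma tree_weight_insert_leaf:
  fixes t :: "'a::linorder ptree"
  assumes "t \<in> trees_on B" "x \<in> sites t" "\<And>b. b \<in> B \<Longrightarrow> b < l"
  shows "tree_weight \<alpha> \<gamma> (insert_leaf l t x) = tree_weight \<alpha> \<gamma> t * weight \<alpha> \<gamma> x"
  using assms
proof (induction t arbitrary: B)
  case (Leaf a)
  then have "x = Edge (Leaf a)" "B = {a}" by (auto simp: sites_def)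
  moreover have "a < l" "a \<noteq> l" using Leaf by auto
  ultimately show ?case
    using two_least_Leaf[of a l]
    by (simp add: split_weight_def PD_a_2 numeral_2_eq_2[symmetric] insert_commute)
next
  case (Branch M)
  have fin: "finite B" using Branch.prems(1) by (rule trees_on_finite)
  have card: "2 \<le> card B" using Branch.prems(1) by (rule card_Branch_ge_2)
  have B: "(\<Union>c\<in>set_mset M. set_ptree c) = B" using trees_on_set[OF Branch.prems(1)] by simp
  have lB: "l \<notin> B" using Branch.prems(3) by auto
  have tl: "two_least (insert l B) = two_least B"
    using fin card Branch.prems(3) by (rule two_least_insert)
  have tlB: "two_least B \<subseteq> B" using fin card by (rule two_least_subset)
  then have ltl: "l \<notin> two_least B" using lB by auto
  have tl0: "two_least B \<noteq> {}" by (simp add: two_least_def)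
  from Branch.prems(1,2) show ?case
  proof (cases rule: insert_leaf_cases[where l = l])
    case Edge
    then show ?thesis
      using tlB B tl
      by (simp add: split_weight_def PD_a_2 numeral_2_eq_2[symmetric] Un_commute)
  next
    case (Vertex M')
    \<comment> \<open>The new block {l} cannot contain the two least labels, and the old blocks are
      unchanged.\<close>
    then have "(\<exists>X\<in>insert {l} (set_ptree ` set_mset M). two_least B \<subseteq> X) \<longleftrightarrow>
        (\<exists>X\<in>set_ptree ` set_mset M. two_least B \<subseteq> X)"
      using ltl tl0 by auto
    moreover have "2 \<le> size M" using size_children_ge_2 Branch.prems(1) .
    ultimately show ?thesis
      using Vertex B tl by (simp add: split_weight_def PD_a_Suc algebra_simps)
  next
    case (child c N)
    have M: "M = add_mset c N" using child by simp
    have ct: "c \<in> trees_on (set_ptree c)"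
      using Branch.prems(1) by (rule child_trees_on) (simp add: M)
    have cB: "set_ptree c \<subseteq> B" using B M by auto
    have set_c: "set_ptree (insert_leaf l c x) = insert l (set_ptree c)"
      using insert_leaf_trees_on[OF ct child(2), of l] cB lB by (intro trees_on_set) auto
    have IH: "tree_weight \<alpha> \<gamma> (insert_leaf l c x) = tree_weight \<alpha> \<gamma> c * weight \<alpha> \<gamma> x"
      using M cB Branch.prems(3) by (intro Branch.IH[OF _ ct child(2)]) auto
    have "two_least B \<subseteq> insert l (set_ptree c) \<longleftrightarrow> two_least B \<subseteq> set_ptree c"
      using ltl by auto
    then have "(\<exists>X\<in>set_ptree ` set_mset (add_mset (insert_leaf l c x) N). two_least B \<subseteq> X) \<longleftrightarrow>
        (\<exists>X\<in>set_ptree ` set_mset M. two_least B \<subseteq> X)"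
      using set_c M by simp
    moreover have "\<Union> (set_ptree ` set_mset (add_mset (insert_leaf l c x) N)) = insert l B"
      using B set_c M by auto
    ultimately have "split_weight \<alpha> \<gamma> (size M) (set_ptree ` set_mset (add_mset (insert_leaf l c x) N)) =
        split_weight \<alpha> \<gamma> (size M) (set_ptree ` set_mset M)"
      using B tl by (simp add: split_weight_def)
    then show ?thesis using child IH M by simp
  qed
qed

text \<open>The sum runs over a finite superset A of the support. A can thus be chosen independently
  of \<alpha> and \<gamma>, which makes termwise limits possible.\<close>

lemma pmf_map_finite:
  assumes "finite A" "set_pmf p \<subseteq> A"
  shows "pmf (map_pmf f p) y = (\<Sum>x | x \<in> A \<and> f x = y. pmf p x)"
proof -
  have "pmf (map_pmf f p) y = measure p ((f -` {y}) \<inter> set_pmf p)"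
    by (simp add: pmf_map measure_Int_set_pmf)
  also have "\<dots> = sum (pmf p) ((f -` {y}) \<inter> set_pmf p)"
    by (rule measure_measure_pmf_finite) (use assms finite_subset in blast)
  also have "\<dots> = (\<Sum>x | x \<in> A \<and> f x = y. pmf p x)"
    using assms by (intro sum.mono_neutral_left) (auto simp: set_pmf_eq)
  finally show ?thesis .
qed

lemma set_pmf_select_site:
  fixes t :: "nat ptree"
  assumes "t \<in> trees_on {1..n}" "n \<ge> 2" "0 \<le> \<alpha>" "\<alpha> \<le> 1" "0 \<le> \<gamma>" "\<gamma> \<le> \<alpha>"
  shows "set_pmf (select_site \<alpha> \<gamma> t) \<subseteq> sites t"
  using pmf_select_site[of t n \<alpha> \<gamma>] assms
  by (auto simp: labelled_trees_eq set_pmf_eq split: if_splits)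

text \<open>By injectivity of insertion only one pair of a tree and a site leads to the given tree,
  so the sum over histories has a single term. The recursion covers \<alpha> = 1, since n - \<alpha>
  is positive for n \<ge> 2.\<close>

lemma pmf_alpha_gamma_tree_Suc:
  assumes par: "0 \<le> \<alpha>" "\<alpha> \<le> 1" "0 \<le> \<gamma>" "\<gamma> \<le> \<alpha>" and n: "2 \<le> n"
    and t: "t \<in> trees_on {1..n}" and x: "x \<in> sites t"
  shows "pmf (alpha_gamma_tree \<alpha> \<gamma> (Suc n)) (insert_leaf (Suc n) t x) =
    pmf (alpha_gamma_tree \<alpha> \<gamma> n) t * (weight \<alpha> \<gamma> x / (real n - \<alpha>))"
proof -
  let ?T = "alpha_gamma_tree \<alpha> \<gamma> n"
  let ?f = "\<lambda>u. pmf (map_pmf (insert_leaf (Suc n) u) (select_site \<alpha> \<gamma> u)) (insert_leaf (Suc n) t x)"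
  have supp: "set_pmf ?T \<subseteq> trees_on {1..n}"
    using alpha_gamma_tree_labelled_trees[of n \<alpha> \<gamma>] par n by (simp add: labelled_trees_eq)
  have l: "Suc n \<notin> {1..n}" by simp
  obtain m where m: "n = Suc (Suc m)"
    using le_Suc_ex[OF n] by auto
  have "alpha_gamma_tree \<alpha> \<gamma> (Suc n) =
      bind_pmf ?T (\<lambda>t. map_pmf (insert_leaf (Suc n) t) (select_site \<alpha> \<gamma> t))"
    by (simp add: m)
  then have "pmf (alpha_gamma_tree \<alpha> \<gamma> (Suc n)) (insert_leaf (Suc n) t x) =
      (\<integral>u. ?f u \<partial>measure_pmf ?T)"
    by (simp add: pmf_bind)
  also have "\<dots> = (\<Sum>u\<in>{t}. ?f u * pmf ?T u)"
  proof (rule integral_measure_pmf_real)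
    fix u assume u: "u \<in> set_pmf ?T" "?f u \<noteq> 0"
    then have ut: "u \<in> trees_on {1..n}" using supp by auto
    from u(2) obtain y where "y \<in> set_pmf (select_site \<alpha> \<gamma> u)"
      "insert_leaf (Suc n) t x = insert_leaf (Suc n) u y"
      by (auto simp flip: set_pmf_iff)
    then show "u \<in> {t}"
      using insert_leaf_inj[OF t x l ut _ l] set_pmf_select_site[OF ut n par] by blast
  qed auto
  also have "\<dots> = ?f t * pmf ?T t" by simp
  also have "?f t = (\<Sum>y | y \<in> sites t \<and> insert_leaf (Suc n) t y = insert_leaf (Suc n) t x.
      pmf (select_site \<alpha> \<gamma> t) y)"
    by (rule pmf_map_finite[OF finite_sites set_pmf_select_site[OF t n par]])
  also have "{y. y \<in> sites t \<and> insert_leaf (Suc n) t y = insert_leaf (Suc n) t x} = {x}"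
    using insert_leaf_inj[OF t _ l t x l] x by blast
  finally show ?thesis
    using pmf_select_site[of t n \<alpha> \<gamma> x] t n par x by (simp add: labelled_trees_eq)
qed

lemma PD_w_1: "\<alpha> < 1 \<Longrightarrow> PD_w \<alpha> (Suc 0) = 1"
  using Gamma_real_pos[of "1 - \<alpha>"] by (simp add: PD_w_def less_imp_neq[symmetric])

lemma PD_w_Suc:
  assumes "\<alpha> < 1" "1 \<le> n"
  shows "PD_w \<alpha> (Suc n) = (real n - \<alpha>) * PD_w \<alpha> n"
proof -
  have "real n - \<alpha> > 0" using assms by linarith
  then have "Gamma (real n - \<alpha> + 1) = (real n - \<alpha>) * Gamma (real n - \<alpha>)"
    by (intro Gamma_plus1) (auto elim!: nonpos_Ints_cases)
  then show ?thesis by (simp add: PD_w_def algebra_simps)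
qed

lemma PD_w_pos:
  assumes "\<alpha> < 1" "1 \<le> n" shows "PD_w \<alpha> n > 0"
proof -
  have "real n - \<alpha> > 0" using assms by linarith
  then show ?thesis using assms by (simp add: PD_w_def Gamma_real_pos)
qed

lemma trees_on_Suc:
  assumes "t' \<in> trees_on {1..Suc n}" "1 \<le> n"
  obtains t x where "t \<in> trees_on {1..n}" "x \<in> sites t" "t' = insert_leaf (Suc n) t x"
proof -
  have "{1..Suc n} - {Suc n} = {1..n}" by auto
  moreover have "n \<in> {1..Suc n}" using assms(2) by simp
  then have "{1..Suc n} \<noteq> {Suc n}" by (metis n_not_Suc_n singletonD)
  ultimately show ?thesis
    using insert_leaf_surj[OF assms(1), of "Suc n"] that by auto
qed

text \<open>Each insertion multiplies \<open>tree_weight\<close> by the weight of the site and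
  \<open>PD_w\<close> by the total weight n - \<alpha>, so the quotient obeys the recursion of the
  probabilities.\<close>

lemma pmf_alpha_gamma_tree:
  assumes par: "0 \<le> \<alpha>" "\<alpha> < 1" "0 \<le> \<gamma>" "\<gamma> \<le> \<alpha>" and "1 \<le> n"
    and "t \<in> trees_on {1..n}"
  shows "pmf (alpha_gamma_tree \<alpha> \<gamma> n) t = tree_weight \<alpha> \<gamma> t / PD_w \<alpha> n"
  using assms(5,6)
proof (induction n arbitrary: t rule: nat_induct_at_least)
  case base
  then obtain u where u: "t = Leaf 1"
    using card_Branch_ge_2[of _ "{1::nat..1}"] by (cases t) auto
  then show ?case using PD_w_1 par by simp
next
  case (Suc n)
  obtain u x where u: "u \<in> trees_on {1..n}" and x: "x \<in> sites u"
    and t: "t = insert_leaf (Suc n) u x"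
    using Suc by (meson trees_on_Suc)
  have tw: "tree_weight \<alpha> \<gamma> t = tree_weight \<alpha> \<gamma> u * weight \<alpha> \<gamma> x"
    unfolding t using u x by (rule tree_weight_insert_leaf) auto
  show ?case
  proof (cases "n = 1")
    case True
    then obtain u': "u = Leaf 1" "x = Edge (Leaf 1)"
      using u x card_Branch_ge_2[of _ "{1::nat..1}"] by (cases u) (auto simp: sites_def)
    then have "t = Branch {#Leaf 1, Leaf 2#}" using t True by (simp add: numeral_2_eq_2)
    \<comment> \<open>The tree with two leaves is prescribed rather than grown. The formula still
      fits, because the weight 1 - \<alpha> of the only site of \<open>Leaf 1\<close> equals this
      denominator.\<close>
    moreover have "PD_w \<alpha> (Suc n) = 1 - \<alpha>"
      using PD_w_Suc[of \<alpha> 1] PD_w_1 par True by simp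
    ultimately show ?thesis using tw u' True par by simp
  next
    case False
    then have "2 \<le> n" using Suc.hyps by simp
    then show ?thesis
      using pmf_alpha_gamma_tree_Suc[OF par(1) _ par(3,4) _ u x] Suc.IH[OF u] par Suc.hyps tw t
      by (simp add: PD_w_Suc)
  qed
qed


subsection \<open>Relabelling\<close>

lemma trees_on_singleton: "trees_on {l} = {Leaf l}"
proof -
  have "t = Leaf l" if t: "t \<in> trees_on {l}" for t
  proof (cases t)
    case (Leaf a)
    then show ?thesis using t by simp
  next
    case (Branch M)
    with t have "2 \<le> card {l}" by (metis card_Branch_ge_2)
    then show ?thesis by simp
  qed
  moreover have "Leaf l \<in> trees_on {l}" by simp
  ultimately show ?thesis by (intro equalityI subsetI) auto
qed

text \<open>Every tree over \<open>insert l B\<close> comes from one of finitely many trees over B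
  by insertion at one of finitely many sites.\<close>

lemma finite_trees_on:
  fixes B :: "'a set" shows "finite (trees_on B)"
proof (cases "finite B")
  case True
  then show ?thesis
  proof (induction B)
    case empty
    have "trees_on {} = ({} :: 'a ptree set)" using trees_on_nonempty by blast
    then show ?case by simp
  next
    case (insert l B)
    show ?case
    proof (cases "B = {}")
      case True
      then show ?thesis by (simp add: trees_on_singleton)
    next
      case False
      have "trees_on (insert l B) \<subseteq> (\<Union>t\<in>trees_on B. insert_leaf l t ` sites t)"
      proof
        fix t' assume "t' \<in> trees_on (insert l B)"
        moreover have "insert l B \<noteq> {l}" using False insert.hyps by blast
        ultimately show "t' \<in> (\<Union>t\<in>trees_on B. insert_leaf l t ` sites t)"
          using insert_leaf_surj[of t' "insert l B" l] insert.hyps by auto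
      qed
      then show ?thesis
        by (rule finite_subset) (use insert.IH finite_sites in blast)
    qed
  qed
next
  case False
  then have "trees_on B = {}" using trees_on_finite by blast
  then show ?thesis by simp
qed

lemma branching_map [simp]: "branching (map_ptree f t) \<longleftrightarrow> branching t"
  by (induction t) auto

lemma map_trees_on:
  assumes "inj_on f A" "t \<in> trees_on A"
  shows "map_ptree f t \<in> trees_on (f ` A)"
  using assms by (simp add: trees_on_def leaf_labels_map image_mset_mset_set)

lemma bij_betw_trees_on:
  assumes f: "bij_betw f A B"
  shows "bij_betw (map_ptree f) (trees_on A) (trees_on B)"
proof (rule bij_betwI)
  define g where "g = inv_into A f"
  have g: "bij_betw g B A" unfolding g_def by (rule bij_betw_inv_into[OF f])
  have gf: "g (f x) = x" if "x \<in> A" for x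
    using that f by (simp add: g_def bij_betw_inv_into_left)
  have fg: "f (g y) = y" if "y \<in> B" for y
    using that f by (simp add: g_def bij_betw_inv_into_right)
  show "map_ptree f \<in> trees_on A \<rightarrow> trees_on B"
    using map_trees_on[of f A] f by (auto simp: bij_betw_def)
  show "map_ptree g \<in> trees_on B \<rightarrow> trees_on A"
    using map_trees_on[of g B] g by (auto simp: bij_betw_def)
  show "map_ptree g (map_ptree f t) = t" if "t \<in> trees_on A" for t
  proof -
    have "map_ptree (g \<circ> f) t = map_ptree id t"
      using trees_on_set[OF that] gf by (intro ptree.map_cong0) auto
    then show ?thesis by (simp add: ptree.map_comp ptree.map_id)
  qed
  show "map_ptree f (map_ptree g t) = t" if "t \<in> trees_on B" for t
  proof -
    have "map_ptree (f \<circ> g) t = map_ptree id t"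
      using trees_on_set[OF that] fg by (intro ptree.map_cong0) auto
    then show ?thesis by (simp add: ptree.map_comp ptree.map_id)
  qed
qed

lemma delabel_map: "delabel (map_ptree f t) = delabel t"
  by (simp add: delabel_def ptree.map_comp o_def)

lemma Min_image_strict_mono:
  fixes f :: "'a::linorder \<Rightarrow> 'b::linorder"
  assumes "strict_mono_on B f" "finite B" "B \<noteq> {}"
  shows "Min (f ` B) = f (Min B)"
proof (rule Min_eqI)
  fix y assume "y \<in> f ` B"
  then obtain x where "x \<in> B" "y = f x" by blast
  then show "f (Min B) \<le> y"
    using assms strict_mono_on_leD[OF assms(1), of "Min B" x] by simp
qed (use assms in auto)

lemma two_least_image:
  fixes f :: "'a::linorder \<Rightarrow> 'b::linorder"
  assumes f: "strict_mono_on B f" and fin: "finite B" and B: "2 \<le> card B"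
  shows "two_least (f ` B) = f ` two_least B"
proof -
  have ne: "B \<noteq> {}" using B by auto
  then have "card (B - {Min B}) \<noteq> 0" using B fin by simp
  then have ne': "B - {Min B} \<noteq> {}" by (metis card.empty)
  have inj: "inj_on f B" using f by (rule strict_mono_on_imp_inj_on)
  have m: "Min (f ` B) = f (Min B)" using f fin ne by (rule Min_image_strict_mono)
  have "f ` B - {f (Min B)} = f ` (B - {Min B})"
    using inj Min_in[OF fin ne] by (auto simp: inj_on_def)
  moreover have "Min (f ` (B - {Min B})) = f (Min (B - {Min B}))"
    using f fin ne' by (intro Min_image_strict_mono) (auto simp: strict_mono_on_def)
  ultimately show ?thesis by (simp add: two_least_def m)
qed

text \<open>The weight depends on the labels only through their relative order, since
  \<open>two_least\<close> commutes with increasing maps.\<close>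

lemma tree_weight_map:
  fixes f :: "'a::linorder \<Rightarrow> 'b::linorder"
  assumes "t \<in> trees_on B" "strict_mono_on B f"
  shows "tree_weight \<alpha> \<gamma> (map_ptree f t) = tree_weight \<alpha> \<gamma> t"
  using assms
proof (induction t arbitrary: B)
  case (Branch M)
  have fin: "finite B" using Branch.prems(1) by (rule trees_on_finite)
  have card: "2 \<le> card B" using Branch.prems(1) by (rule card_Branch_ge_2)
  have B: "(\<Union>c\<in>set_mset M. set_ptree c) = B" using trees_on_set[OF Branch.prems(1)] by simp
  have inj: "inj_on f B" using Branch.prems(2) by (rule strict_mono_on_imp_inj_on)
  have tlB: "two_least B \<subseteq> B" using fin card by (rule two_least_subset)
  have "image_mset (tree_weight \<alpha> \<gamma> \<circ> map_ptree f) M = image_mset (tree_weight \<alpha> \<gamma>) M"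
  proof (rule image_mset_cong)
    fix c assume c: "c \<in># M"
    have "set_ptree c \<subseteq> B" using c B by auto
    with Branch.prems(2) have "strict_mono_on (set_ptree c) f"
      by (auto simp: strict_mono_on_def)
    from Branch.IH[OF c child_trees_on[OF Branch.prems(1) c] this]
    show "(tree_weight \<alpha> \<gamma> \<circ> map_ptree f) c = tree_weight \<alpha> \<gamma> c" by simp
  qed
  moreover have "(\<exists>X\<in>set_ptree ` set_mset (image_mset (map_ptree f) M). two_least (f ` B) \<subseteq> X) \<longleftrightarrow>
      (\<exists>X\<in>set_ptree ` set_mset M. two_least B \<subseteq> X)"
  proof -
    have "f ` two_least B \<subseteq> f ` set_ptree c \<longleftrightarrow> two_least B \<subseteq> set_ptree c" if "c \<in># M" for c
      using that B tlB inj by (intro inj_on_image_subset_iff[of f B]) auto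
    then show ?thesis
      using two_least_image[OF Branch.prems(2) fin card]
      by (auto simp: ptree.set_map)
  qed
  moreover have "\<Union> (set_ptree ` set_mset (image_mset (map_ptree f) M)) = f ` B"
    using B by (auto simp: ptree.set_map)
  ultimately show ?case
    using B by (simp add: split_weight_def multiset.map_comp)
qed simp

lemma set_pmf_alpha_gamma_tree:
  assumes "0 \<le> \<alpha>" "\<alpha> \<le> 1" "0 \<le> \<gamma>" "\<gamma> \<le> \<alpha>" "1 \<le> n"
  shows "set_pmf (alpha_gamma_tree \<alpha> \<gamma> n) \<subseteq> trees_on {1..n}"
  using alpha_gamma_tree_labelled_trees[of n \<alpha> \<gamma>] assms by (simp add: labelled_trees_eq)

lemma pmf_delabelled:
  assumes "0 \<le> \<alpha>" "\<alpha> \<le> 1" "0 \<le> \<gamma>" "\<gamma> \<le> \<alpha>" "1 \<le> n"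
  shows "pmf (delabelled_alpha_gamma_tree \<alpha> \<gamma> n) u =
    (\<Sum>t | t \<in> trees_on {1..n} \<and> delabel t = u. pmf (alpha_gamma_tree \<alpha> \<gamma> n) t)"
  unfolding delabelled_alpha_gamma_tree_def
  by (rule pmf_map_finite[OF finite_trees_on set_pmf_alpha_gamma_tree[OF assms]])

text \<open>The increasing bijection from {1..card X} to X preserves both the weight and the shape,
  which reduces the sum to the standard labels, where the product formula applies. This makes the
  contribution of a component depend only on the size of its label set.\<close>

lemma sum_tree_weight:
  fixes X :: "nat set"
  assumes par: "0 \<le> \<alpha>" "\<alpha> < 1" "0 \<le> \<gamma>" "\<gamma> \<le> \<alpha>" and X: "finite X" "X \<noteq> {}"
  shows "(\<Sum>t | t \<in> trees_on X \<and> delabel t = u. tree_weight \<alpha> \<gamma> t) =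
    PD_w \<alpha> (card X) * pmf (delabelled_alpha_gamma_tree \<alpha> \<gamma> (card X)) u"
proof -
  let ?n = "card X"
  have n: "1 \<le> ?n" using X by (simp add: Suc_le_eq card_gt_0_iff)
  obtain h0 where h0: "bij_betw h0 {..<?n} X" "strict_mono_on {..<?n} h0"
    using ex_bij_betw_strict_mono_card[OF X(1)] by (metis lessThan_atLeast0)
  \<comment> \<open>The library enumeration starts at 0, the leaf labels at 1.\<close>
  define h where "h i = h0 (i - 1)" for i
  have "bij_betw (\<lambda>i::nat. i - 1) {1..?n} {..<?n}"
    by (rule bij_betwI[of _ _ _ Suc]) auto
  from bij_betw_trans[OF this h0(1)] have h: "bij_betw h {1..?n} X"
    by (simp add: h_def o_def cong: bij_betw_cong)
  have mono: "strict_mono_on {1..?n} h"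
  proof (rule strict_mono_onI)
    fix r s assume "r \<in> {1..?n}" "s \<in> {1..?n}" "r < s"
    then show "h r < h s"
      unfolding h_def by (intro strict_mono_onD[OF h0(2)]) auto
  qed
  have "bij_betw (map_ptree h) {t \<in> trees_on {1..?n}. delabel t = u} {t \<in> trees_on X. delabel t = u}"
    using bij_betw_trees_on[OF h] by (rule bij_betw_Collect) (simp_all add: delabel_map)
  then have "(\<Sum>t | t \<in> trees_on X \<and> delabel t = u. tree_weight \<alpha> \<gamma> t) =
      (\<Sum>t | t \<in> trees_on {1..?n} \<and> delabel t = u. tree_weight \<alpha> \<gamma> (map_ptree h t))"
    by (simp add: sum.reindex_bij_betw[symmetric] Collect_conj_eq)
  also have "\<dots> = (\<Sum>t | t \<in> trees_on {1..?n} \<and> delabel t = u.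
      PD_w \<alpha> ?n * pmf (alpha_gamma_tree \<alpha> \<gamma> ?n) t)"
    using PD_w_pos[of \<alpha> ?n] par n
    by (intro sum.cong refl) (auto simp: tree_weight_map[OF _ mono] pmf_alpha_gamma_tree)
  finally show ?thesis
    using par n by (simp add: pmf_delabelled sum_distrib_left)
qed

subsection \<open>Ordered set partitions\<close>

text \<open>The single multiset equation expresses both that the blocks cover B and that they are
  disjoint. Finiteness of the blocks is demanded because an infinite block would contribute the
  empty multiset. A size 0 in ms stands for an empty block.\<close>

definition block_lists :: "'a set \<Rightarrow> nat list \<Rightarrow> 'a set list set" where
  "block_lists B ms =
     {Bs. map card Bs = ms \<and> (\<forall>X\<in>set Bs. finite X) \<and> sum_list (map mset_set Bs) = mset_set B}"

lemma block_lists_Nil: "finite B \<Longrightarrow> block_lists B [] = (if B = {} then {[]} else {})"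
  by (auto simp: block_lists_def mset_set_empty_iff)

lemma block_lists_Cons:
  assumes "finite B"
  shows "block_lists B (m # ms) = (\<Union>X\<in>{X. X \<subseteq> B \<and> card X = m}. (#) X ` block_lists (B - X) ms)"
proof (intro equalityI subsetI)
  fix Bs assume "Bs \<in> block_lists B (m # ms)"
  then obtain X Xs where Bs: "Bs = X # Xs" "card X = m" "map card Xs = ms"
    "finite X" "\<forall>X\<in>set Xs. finite X" "mset_set X + sum_list (map mset_set Xs) = mset_set B"
    by (cases Bs) (auto simp: block_lists_def)
  then have "mset_set X \<subseteq># mset_set B" by (metis mset_subset_eq_add_left)
  then have X: "X \<subseteq> B" using assms Bs(4) by simp
  have "sum_list (map mset_set Xs) = mset_set B - mset_set X"
    using Bs(6) by (metis add_diff_cancel_left')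
  then have "sum_list (map mset_set Xs) = mset_set (B - X)"
    using X assms by (simp add: mset_set_Diff)
  then show "Bs \<in> (\<Union>X\<in>{X. X \<subseteq> B \<and> card X = m}. (#) X ` block_lists (B - X) ms)"
    using Bs X by (auto simp: block_lists_def)
next
  fix Bs assume "Bs \<in> (\<Union>X\<in>{X. X \<subseteq> B \<and> card X = m}. (#) X ` block_lists (B - X) ms)"
  then obtain X Xs where Bs: "Bs = X # Xs" "X \<subseteq> B" "card X = m" "Xs \<in> block_lists (B - X) ms"
    by blast
  have "finite X" using Bs(2) assms by (rule finite_subset)
  moreover have "mset_set X + mset_set (B - X) = mset_set B"
    using Bs(2) assms by (simp add: mset_set_Diff subset_mset.add_diff_inverse \<open>finite X\<close>)
  ultimately show "Bs \<in> block_lists B (m # ms)"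
    using Bs by (simp add: block_lists_def)
qed

lemma block_lists_Union:
  assumes "finite B" "Bs \<in> block_lists B ms" shows "\<Union> (set Bs) = B"
proof -
  have "set_mset (sum_list (map mset_set Xs)) = \<Union> (set Xs)" if "\<forall>X\<in>set Xs. finite X" for Xs :: "'a set list"
    using that by (induction Xs) auto
  moreover have "set_mset (mset_set B) = B" using assms(1) by simp
  ultimately show ?thesis using assms(2) by (metis (mono_tags, lifting) block_lists_def mem_Collect_eq)
qed

lemma finite_block_lists:
  assumes "finite B" shows "finite (block_lists B ms)"
  using assms
proof (induction ms arbitrary: B)
  case (Cons m ms)
  have "finite {X. X \<subseteq> B \<and> card X = m}"
    using Cons.prems by (auto intro: finite_subset[of _ "Pow B"])
  moreover have "finite (block_lists (B - X) ms)" for X using Cons by simp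
  ultimately show ?case using Cons.prems by (simp add: block_lists_Cons)
qed (simp add: block_lists_Nil)

text \<open>The multinomial coefficient in a form without division: the first block is any m-subset,
  and the remaining blocks partition its complement.\<close>

lemma card_block_lists:
  assumes "finite B" "sum_list ms = card B"
  shows "card (block_lists B ms) * (\<Prod>m\<leftarrow>ms. fact m) = fact (card B)"
  using assms
proof (induction ms arbitrary: B)
  case Nil
  then show ?case by (simp add: block_lists_Nil)
next
  case (Cons m ms)
  let ?S = "{X. X \<subseteq> B \<and> card X = m}"
  let ?p = "\<Prod>m\<leftarrow>ms. fact m :: nat"
  have fS: "finite ?S"
    using Cons.prems by (auto intro: finite_subset[of _ "Pow B"])
  have mB: "m \<le> card B" using Cons.prems by simp
  have "card (block_lists B (m # ms)) = (\<Sum>X\<in>?S. card ((#) X ` block_lists (B - X) ms))"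
    using Cons.prems fS
    by (subst block_lists_Cons) (auto intro!: card_UN_disjoint finite_block_lists)
  also have "\<dots> = (\<Sum>X\<in>?S. card (block_lists (B - X) ms))"
    by (intro sum.cong refl card_image) auto
  finally have "card (block_lists B (m # ms)) * ?p = (\<Sum>X\<in>?S. card (block_lists (B - X) ms) * ?p)"
    by (simp add: sum_distrib_right)
  also have "\<dots> = (\<Sum>X\<in>?S. fact (card B - m))"
  proof (rule sum.cong)
    fix X assume X: "X \<in> ?S"
    then have "card (B - X) = card B - m"
      using Cons.prems finite_subset[of X B] by (simp add: card_Diff_subset)
    then show "card (block_lists (B - X) ms) * ?p = fact (card B - m)"
      using Cons.IH[of "B - X"] Cons.prems by simp
  qed simp
  also have "\<dots> = (card B choose m) * fact (card B - m)"
    using n_subsets[OF Cons.prems(1), of m] by simp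
  finally have "card (block_lists B (m # ms)) * ?p * fact m = fact (card B)"
    using binomial_fact_lemma[OF mB] by (simp add: ac_simps)
  then show ?case by (simp add: ac_simps)
qed

lemma card_same_block_pairs:
  assumes "finite B" "Bs \<in> block_lists B ms"
  shows "card {(x, y). x \<noteq> y \<and> (\<exists>X\<in>set Bs. x \<in> X \<and> y \<in> X)} = (\<Sum>m\<leftarrow>ms. m * (m - 1))"
  using assms
proof (induction ms arbitrary: B Bs)
  case Nil
  then show ?case by (simp add: block_lists_Nil split: if_splits)
next
  case (Cons m ms)
  from Cons.prems obtain X Xs where
    Bs: "Bs = X # Xs" "X \<subseteq> B" "card X = m" "Xs \<in> block_lists (B - X) ms"
    by (auto simp: block_lists_Cons)
  have fX: "finite X" using Bs(2) Cons.prems(1) by (rule finite_subset)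
  have U: "\<Union> (set Xs) = B - X"
    using Cons.prems(1) Bs(4) by (intro block_lists_Union) auto
  let ?P = "\<lambda>Bs. {(x, y). x \<noteq> y \<and> (\<exists>X\<in>set Bs. x \<in> X \<and> y \<in> X)}"
  have P: "?P Bs = (X \<times> X - Id_on X) \<union> ?P Xs" by (auto simp: Bs(1))
  have "?P Xs \<subseteq> B \<times> B" using U by blast
  moreover have "finite (B \<times> B)" using Cons.prems(1) by simp
  ultimately have "finite (?P Xs)" by (rule finite_subset)
  then have "card (?P Bs) = card (X \<times> X - Id_on X) + card (?P Xs)"
    unfolding P using fX U by (intro card_Un_disjoint) (simp, simp, blast)
  also have "card (X \<times> X - Id_on X) = m * (m - 1)"
  proof -
    have "Id_on X = (\<lambda>x. (x, x)) ` X" by auto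
    then have "card (Id_on X) = m" using Bs(3) by (simp add: card_image inj_on_def)
    moreover have "card (X \<times> X - Id_on X) = card (X \<times> X) - card (Id_on X)"
      using fX by (intro card_Diff_subset) (auto simp: Id_on_def)
    ultimately show ?thesis
      using Bs(3) by (simp add: diff_mult_distrib2 card_cartesian_product)
  qed
  also have "card (?P Xs) = (\<Sum>m\<leftarrow>ms. m * (m - 1))"
    using Cons.IH[OF _ Bs(4)] Cons.prems(1) by simp
  finally show ?case by simp
qed

lemma map_block_lists:
  assumes p: "\<pi> permutes B" and Bs: "Bs \<in> block_lists B ms"
  shows "map ((`) \<pi>) Bs \<in> block_lists B ms"
proof -
  have inj: "inj \<pi>" using p by (rule permutes_inj)
  have m: "mset_set (\<pi> ` X) = image_mset \<pi> (mset_set X)" for X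
    using inj by (simp add: image_mset_mset_set inj_on_subset)
  have "sum_list (map mset_set (map ((`) \<pi>) Xs)) = image_mset \<pi> (sum_list (map mset_set Xs))" for Xs
    by (induction Xs) (auto simp: m)
  moreover have "image_mset \<pi> (mset_set B) = mset_set B"
    using permutes_image[OF p] by (simp flip: m)
  moreover have "card (\<pi> ` X) = card X" for X
    using inj by (simp add: card_image inj_on_subset)
  ultimately show ?thesis using Bs by (auto simp: block_lists_def o_def)
qed

text \<open>Double counting of pairs consisting of a block list and an ordered pair of distinct
  points in one block. Each list admits \<Sum> m (m - 1) such pairs, and each of the n (n - 1) pairs
  of points, n = \<open>card B\<close>, belongs to equally many lists, because permutations of B act
  transitively on ordered pairs of distinct points.\<close>

lemma card_block_lists_same_block:
  assumes B: "finite B" and xy: "x \<in> B" "y \<in> B" "x \<noteq> y"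
  shows "card B * (card B - 1) * card {Bs \<in> block_lists B ms. \<exists>X\<in>set Bs. x \<in> X \<and> y \<in> X} =
    card (block_lists B ms) * (\<Sum>m\<leftarrow>ms. m * (m - 1))"
proof -
  define N where "N = (\<lambda>(x, y). {Bs \<in> block_lists B ms. \<exists>X\<in>set Bs. x \<in> X \<and> y \<in> X})"
  let ?D = "B \<times> B - Id_on B"
  have le: "card (N (a, b)) \<le> card (N (a', b'))"
    if ab: "a \<in> B" "b \<in> B" "a \<noteq> b" "a' \<in> B" "b' \<in> B" "a' \<noteq> b'" for a b a' b'
  proof -
    \<comment> \<open>A permutation sending (a, b) to (a', b'): \<sigma> moves a to a', and then
      \<tau> moves \<sigma> b to b' while fixing a', which differs from both.\<close>
    define \<sigma> where "\<sigma> = Transposition.transpose a a'"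
    define \<tau> where "\<tau> = Transposition.transpose (\<sigma> b) b'"
    have \<sigma>: "\<sigma> permutes B" unfolding \<sigma>_def using ab by (intro permutes_swap_id)
    then have "\<sigma> b \<in> B" using ab by (simp add: permutes_in_image)
    then have "\<tau> permutes B" unfolding \<tau>_def using ab by (intro permutes_swap_id)
    with \<sigma> have p: "\<tau> \<circ> \<sigma> permutes B" by (rule permutes_compose)
    have "a' \<noteq> \<sigma> b" using ab by (auto simp: \<sigma>_def Transposition.transpose_def)
    then have im: "(\<tau> \<circ> \<sigma>) a = a'" "(\<tau> \<circ> \<sigma>) b = b'"
      using ab by (auto simp: \<tau>_def \<sigma>_def Transposition.transpose_def)
    have "map ((`) (\<tau> \<circ> \<sigma>)) ` N (a, b) \<subseteq> N (a', b')"
    proof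
      fix Cs assume "Cs \<in> map ((`) (\<tau> \<circ> \<sigma>)) ` N (a, b)"
      then obtain Bs X where "Bs \<in> block_lists B ms" "X \<in> set Bs" "a \<in> X" "b \<in> X"
        "Cs = map ((`) (\<tau> \<circ> \<sigma>)) Bs" by (auto simp: N_def)
      moreover from this have "a' \<in> (\<tau> \<circ> \<sigma>) ` X" "b' \<in> (\<tau> \<circ> \<sigma>) ` X"
        using im by (metis image_eqI)+
      ultimately show "Cs \<in> N (a', b')"
        using map_block_lists[OF p] unfolding N_def by auto
    qed
    moreover have "inj_on (map ((`) (\<tau> \<circ> \<sigma>))) (N (a, b))"
    proof -
      have "inj ((`) (\<tau> \<circ> \<sigma>))"
        using permutes_inj[OF p] by (intro injI) (simp only: inj_image_eq_iff)
      then show ?thesis by (rule inj_on_subset[OF inj_mapI subset_UNIV])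
    qed
    moreover have "finite (N (a', b'))"
      using finite_block_lists[OF B, of ms] by (simp add: N_def)
    ultimately show ?thesis by (intro card_inj_on_le)
  qed
  have eq: "card (N p) = card (N (x, y))" if "p \<in> ?D" for p
    using that le[of "fst p" "snd p" x y] le[of x y "fst p" "snd p"] xy by (cases p) (auto simp: Id_on_def)
  have "card ?D = card B * (card B - 1)"
  proof -
    have "Id_on B = (\<lambda>x. (x, x)) ` B" by auto
    then have "card (Id_on B) = card B" by (simp add: card_image inj_on_def)
    moreover have "card ?D = card (B \<times> B) - card (Id_on B)"
      using B by (intro card_Diff_subset) (auto simp: Id_on_def)
    ultimately show ?thesis
      by (simp add: diff_mult_distrib2 card_cartesian_product)
  qed
  then have "card B * (card B - 1) * card (N (x, y)) = (\<Sum>p\<in>?D. card (N p))"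
    using eq by simp
  also have "\<dots> = (\<Sum>p\<in>?D. \<Sum>Bs\<in>block_lists B ms. if Bs \<in> N p then 1 else 0)"
  proof (rule sum.cong)
    fix p
    have "N p = {Bs \<in> block_lists B ms. Bs \<in> N p}" by (auto simp: N_def split: prod.splits)
    then show "card (N p) = (\<Sum>Bs\<in>block_lists B ms. if Bs \<in> N p then 1 else 0)"
      using finite_block_lists[OF B, of ms] by (simp add: sum.If_cases Int_def)
  qed simp
  also have "\<dots> = (\<Sum>Bs\<in>block_lists B ms. \<Sum>p\<in>?D. if Bs \<in> N p then 1 else 0)"
    by (rule sum.swap)
  also have "\<dots> = (\<Sum>Bs\<in>block_lists B ms. \<Sum>m\<leftarrow>ms. m * (m - 1))"
  proof (rule sum.cong)
    fix Bs assume Bs: "Bs \<in> block_lists B ms"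
    have "{p \<in> ?D. Bs \<in> N p} = {(x, y). x \<noteq> y \<and> (\<exists>X\<in>set Bs. x \<in> X \<and> y \<in> X)}"
      using block_lists_Union[OF B Bs] Bs by (auto simp: N_def Id_on_def)
    then have "card {p \<in> ?D. Bs \<in> N p} = (\<Sum>m\<leftarrow>ms. m * (m - 1))"
      using card_same_block_pairs[OF B Bs] by simp
    then show "(\<Sum>p\<in>?D. if Bs \<in> N p then 1 else 0) = (\<Sum>m\<leftarrow>ms. m * (m - 1))"
      using B by (simp add: sum.If_cases Int_def)
  qed simp
  finally show ?thesis by (simp add: N_def)
qed

text \<open>Among all block lists, the two least labels share a block in the proportion r = \<Sum> m
  (m - 1) / (n (n - 1)), where n = \<open>card B\<close>. The mean of the factor is thus (1 -
  \<alpha>) - (1 - \<alpha> - \<gamma>) r, which is \<gamma> + (1 - \<alpha> - \<gamma>) (1 -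
  r).\<close>

lemma sum_split_weight:
  fixes B :: "'a::linorder set"
  assumes B: "finite B" "2 \<le> card B" and ms: "sum_list ms = card B"
  shows "(\<Sum>Bs\<in>block_lists B ms. split_weight \<alpha> \<gamma> k (set Bs)) =
    PD_a \<alpha> (- \<alpha> - \<gamma>) k * (fact (card B) / (\<Prod>m\<leftarrow>ms. fact m)) *
    (\<gamma> + (1 - \<alpha> - \<gamma>) * (1 - (\<Sum>m\<leftarrow>ms. real m * (real m - 1)) / (real (card B) * (real (card B) - 1))))"
proof -
  let ?a = "PD_a \<alpha> (- \<alpha> - \<gamma>) k" and ?n = "card B"
  let ?L = "block_lists B ms"
  let ?S = "{Bs \<in> ?L. \<exists>X\<in>set Bs. two_least B \<subseteq> X}"
  define x y where "x = Min B" and "y = Min (B - {Min B})"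
  have ne: "B \<noteq> {}" using B by auto
  then have "card (B - {Min B}) \<noteq> 0" using B by simp
  then have ne': "B - {Min B} \<noteq> {}" by (metis card.empty)
  have xy: "x \<in> B" "y \<in> B" "x \<noteq> y"
    using Min_in[OF B(1) ne] Min_in[OF _ ne'] B(1) by (auto simp: x_def y_def)
  have "?S = {Bs \<in> ?L. \<exists>X\<in>set Bs. x \<in> X \<and> y \<in> X}"
    by (simp add: two_least_def x_def y_def)
  then have "?n * (?n - 1) * card ?S = card ?L * (\<Sum>m\<leftarrow>ms. m * (m - 1))"
    using card_block_lists_same_block[OF B(1) xy, of ms] by simp
  then have "real (?n * (?n - 1) * card ?S) = real (card ?L * (\<Sum>m\<leftarrow>ms. m * (m - 1)))"
    by simp
  moreover have "real (\<Sum>m\<leftarrow>ms. m * (m - 1)) = (\<Sum>m\<leftarrow>ms. real m * (real m - 1))"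
  proof (induction ms)
    case (Cons m ms)
    \<comment> \<open>The case distinction deals with the truncated subtraction at m = 0, where the
      factor m vanishes anyway.\<close>
    then show ?case by (cases m) (auto simp: algebra_simps)
  qed simp
  ultimately have "real ?n * (real ?n - 1) * real (card ?S) =
      real (card ?L) * (\<Sum>m\<leftarrow>ms. real m * (real m - 1))"
    using B by (simp add: of_nat_diff)
  moreover have "real ?n * (real ?n - 1) \<noteq> 0" using B by auto
  ultimately have S: "real (card ?S) = real (card ?L) *
      ((\<Sum>m\<leftarrow>ms. real m * (real m - 1)) / (real ?n * (real ?n - 1)))"
    by (simp add: field_simps)
  have "real (card ?L * (\<Prod>m\<leftarrow>ms. fact m)) = real (fact ?n)"
    using card_block_lists[OF B(1) ms] by simp
  moreover have "real (\<Prod>m\<leftarrow>ms. fact m) = (\<Prod>m\<leftarrow>ms. fact m)"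
    by (induction ms) auto
  moreover have "(\<Prod>m\<leftarrow>ms. fact m) \<noteq> (0::real)"
    by (induction ms) auto
  ultimately have L: "real (card ?L) = fact ?n / (\<Prod>m\<leftarrow>ms. fact m)"
    by (simp add: field_simps)
  have fin: "finite ?L" using B(1) by (rule finite_block_lists)
  have "(\<Sum>Bs\<in>?L. split_weight \<alpha> \<gamma> k (set Bs)) =
      (\<Sum>Bs\<in>?L. ?a * (1 - \<alpha>) - (if Bs \<in> ?S then ?a * (1 - \<alpha> - \<gamma>) else 0))"
    using block_lists_Union[OF B(1)]
    by (intro sum.cong) (auto simp: split_weight_def algebra_simps)
  also have "\<dots> = real (card ?L) * (?a * (1 - \<alpha>)) - real (card ?S) * (?a * (1 - \<alpha> - \<gamma>))"
    using fin by (simp add: sum_subtractf sum.If_cases Int_def)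
  also have "\<dots> = ?a * real (card ?L) * (\<gamma> + (1 - \<alpha> - \<gamma>) *
      (1 - (\<Sum>m\<leftarrow>ms. real m * (real m - 1)) / (real ?n * (real ?n - 1))))"
    unfolding S by (simp add: algebra_simps)
  finally show ?thesis unfolding L .
qed


subsection \<open>Law of the components\<close>

lemma in_listset_iff: "xs \<in> listset As \<longleftrightarrow> list_all2 (\<in>) xs As"
proof (induction As arbitrary: xs)
  case (Cons A As)
  then show ?case by (cases xs) (auto simp: set_Cons_def)
qed simp

lemma finite_listset: "(\<And>A. A \<in> set As \<Longrightarrow> finite A) \<Longrightarrow> finite (listset As)"
proof (induction As)
  case (Cons A As)
  have "listset (A # As) = (\<lambda>(x, xs). x # xs) ` (A \<times> listset As)"
    by (auto simp: set_Cons_def)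
  then show ?case using Cons by simp
qed simp

text \<open>The distributive law for lists. It turns a sum over independent choices of one tree per
  component into a product over the components.\<close>

lemma sum_prod_listset:
  fixes g :: "'i \<Rightarrow> 'a \<Rightarrow> 'b::comm_semiring_1"
  assumes "\<And>i. i \<in> set ks \<Longrightarrow> finite (A i)"
  shows "(\<Sum>xs\<in>listset (map A ks). \<Prod>(i, x)\<leftarrow>zip ks xs. g i x) = (\<Prod>i\<leftarrow>ks. \<Sum>x\<in>A i. g i x)"
  using assms
proof (induction ks)
  case (Cons i ks)
  have eq: "listset (map A (i # ks)) = (\<lambda>(x, xs). x # xs) ` (A i \<times> listset (map A ks))"
    by (auto simp: set_Cons_def)
  have "(\<Sum>xs\<in>listset (map A (i # ks)). \<Prod>(i, x)\<leftarrow>zip (i # ks) xs. g i x) =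
      (\<Sum>(x, xs)\<in>A i \<times> listset (map A ks). g i x * (\<Prod>(i, x)\<leftarrow>zip ks xs. g i x))"
    unfolding eq by (subst sum.reindex) (auto simp: inj_on_def intro!: sum.cong)
  also have "\<dots> = (\<Sum>x\<in>A i. g i x) * (\<Sum>xs\<in>listset (map A ks). \<Prod>(i, x)\<leftarrow>zip ks xs. g i x)"
    by (simp add: sum.cartesian_product[symmetric] sum_product)
  finally show ?case using Cons by simp
qed simp

lemma leaf_labels_Branch_mset: "leaf_labels (Branch (mset ts)) = sum_list (map leaf_labels ts)"
  by (simp flip: mset_map add: sum_mset_sum_list)

lemma delabel_Branch: "delabel (Branch M) = Branch (image_mset delabel M)"
  by (simp add: delabel_def)

lemma leaf_count_delabel: "leaf_count (delabel t) = leaf_count t"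
  by (simp add: delabel_def leaf_count_def leaf_labels_map)

lemma leaf_count_trees_on: "t \<in> trees_on B \<Longrightarrow> leaf_count t = card B"
  by (simp add: trees_on_def leaf_count_def)

text \<open>Once the blocks are fixed, the conditions on the components decouple: component i is any
  tree over block i with the prescribed shape. This is the source of the independence of the
  components.\<close>

lemma component_lists_eq:
  assumes B: "finite B" and Bs: "Bs \<in> block_lists B ms" and us: "2 \<le> length us"
    and ms: "ms = map leaf_count us"
  shows "{ts. Branch (mset ts) \<in> trees_on B \<and> map delabel ts = us \<and> map set_ptree ts = Bs} =
    listset (map (\<lambda>(X, u). {t \<in> trees_on X. delabel t = u}) (zip Bs us))" (is "?L = ?R")
proof -
  have len: "length Bs = length us"
    using Bs ms by (auto simp: block_lists_def dest: map_eq_imp_length_eq)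
  have R: "ts \<in> ?R \<longleftrightarrow> length ts = length us \<and>
      (\<forall>i<length us. ts ! i \<in> trees_on (Bs ! i) \<and> delabel (ts ! i) = us ! i)" for ts
    using len by (auto simp: in_listset_iff list_all2_conv_all_nth)
  show ?thesis
  proof (intro equalityI subsetI)
    fix ts assume "ts \<in> ?L"
    then have ts: "Branch (mset ts) \<in> trees_on B" "us = map delabel ts" "Bs = map set_ptree ts"
      by auto
    have "ts ! i \<in> trees_on (set_ptree (ts ! i))" if "i < length ts" for i
      using that by (intro child_trees_on[OF ts(1)]) auto
    then show "ts \<in> ?R" unfolding R using ts by simp
  next
    fix ts assume "ts \<in> ?R"
    then have ts: "length ts = length us"
      "\<And>i. i < length us \<Longrightarrow> ts ! i \<in> trees_on (Bs ! i)"
      "\<And>i. i < length us \<Longrightarrow> delabel (ts ! i) = us ! i"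
      by (auto simp: R)
    have "map leaf_labels ts = map mset_set Bs"
      using ts len by (intro nth_equalityI) (auto simp: trees_on_def)
    then have "leaf_labels (Branch (mset ts)) = mset_set B"
      using Bs by (simp only: leaf_labels_Branch_mset) (simp add: block_lists_def)
    moreover have "branching t" if t: "t \<in> set ts" for t
    proof -
      obtain i where "i < length us" "t = ts ! i" using t ts(1) by (metis in_set_conv_nth)
      then show ?thesis using ts(2)[of i] by (simp add: trees_on_def)
    qed
    ultimately have "Branch (mset ts) \<in> trees_on B"
      using us ts(1) by (auto simp: trees_on_def)
    moreover have "map delabel ts = us" using ts by (intro nth_equalityI) auto
    moreover have "map set_ptree ts = Bs"
      using ts(1) len trees_on_set[OF ts(2)] by (intro nth_equalityI) simp_all
    ultimately show "ts \<in> ?L" by simp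
  qed
qed

text \<open>A repeated component would have a nonempty label set disjoint from itself. So all
  multiplicities are 1 and no two orderings coincide.\<close>

lemma card_orderings_of_components:
  assumes "Branch M \<in> trees_on B"
  shows "card (permutations_of_multiset M) = fact (size M)"
proof -
  have "count M c = 1" if c: "c \<in># M" for c
  proof -
    obtain N where N: "M = add_mset c N" using c by (meson mset_add)
    have "c \<notin># N"
    proof
      assume "c \<in># N"
      then have "set_ptree c \<inter> set_ptree c = {}"
        using child_labels_disjoint assms N by blast
      then show False using trees_on_nonempty[OF child_trees_on[OF assms c]] by simp
    qed
    then show ?thesis using N by (simp add: not_in_iff)
  qed
  then have "(\<Prod>c\<in>set_mset M. fact (count M c)) = (1::nat)"
    by (intro prod.neutral) simp
  then show ?thesis using card_permutations_of_multiset_aux[of M] by simp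
qed

text \<open>Lists ts of labelled components are grouped in two ways: by their list of shapes, and by
  the tree they form. In the second grouping every class has \<open>fact (size U)\<close> members,
  even when U has repeated elements and hence fewer orderings.\<close>

lemma sum_over_orderings:
  fixes F :: "nat ptree \<Rightarrow> real"
  shows "(\<Sum>us\<in>permutations_of_multiset U. \<Sum>ts | Branch (mset ts) \<in> trees_on B \<and> map delabel ts = us.
      F (Branch (mset ts))) =
    fact (size U) * (\<Sum>t | t \<in> trees_on B \<and> delabel t = Branch U. F t)"
proof -
  define \<T> where "\<T> = {ts. Branch (mset ts) \<in> trees_on B \<and> mset (map delabel ts) = U}"
  let ?T = "{t. t \<in> trees_on B \<and> delabel t = Branch U}"
  have finT: "finite ?T" using finite_trees_on[of B] by simp
  have \<T>: "\<T> = (\<Union>t\<in>?T. permutations_of_multiset (components t))"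
  proof (intro equalityI subsetI)
    fix ts assume "ts \<in> \<T>"
    then show "ts \<in> (\<Union>t\<in>?T. permutations_of_multiset (components t))"
      by (intro UN_I[of "Branch (mset ts)"]) (auto simp: \<T>_def delabel_Branch permutations_of_multiset_def)
  next
    fix ts assume "ts \<in> (\<Union>t\<in>?T. permutations_of_multiset (components t))"
    then obtain t where t: "t \<in> trees_on B" "delabel t = Branch U" "mset ts = components t"
      by (auto simp: permutations_of_multiset_def)
    then obtain M where "t = Branch M" by (cases t) (auto simp: delabel_def)
    then show "ts \<in> \<T>" using t by (simp add: \<T>_def delabel_Branch)
  qed
  then have fin\<T>: "finite \<T>" using finT by simp
  have "(\<Sum>us\<in>permutations_of_multiset U. \<Sum>ts | Branch (mset ts) \<in> trees_on B \<and> map delabel ts = us.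
      F (Branch (mset ts))) =
      (\<Sum>us\<in>permutations_of_multiset U. \<Sum>ts | ts \<in> \<T> \<and> map delabel ts = us. F (Branch (mset ts)))"
    by (intro sum.cong) (auto simp: \<T>_def permutations_of_multiset_def)
  also have "\<dots> = (\<Sum>ts\<in>\<T>. F (Branch (mset ts)))"
    using fin\<T> by (intro sum.group) (simp, simp, auto simp: \<T>_def permutations_of_multiset_def)
  also have "\<dots> = (\<Sum>t\<in>?T. \<Sum>ts | ts \<in> \<T> \<and> Branch (mset ts) = t. F (Branch (mset ts)))"
    using fin\<T> finT by (intro sum.group[symmetric]) (auto simp: \<T>_def delabel_Branch)
  also have "\<dots> = (\<Sum>t\<in>?T. fact (size U) * F t)"
  proof (rule sum.cong)
    fix t assume t: "t \<in> ?T"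
    then obtain M where M: "t = Branch M" by (cases t) (auto simp: delabel_def)
    then have U: "U = image_mset delabel M" using t by (simp add: delabel_Branch)
    have "{ts. ts \<in> \<T> \<and> Branch (mset ts) = t} = permutations_of_multiset M"
      using t M U by (auto simp: \<T>_def permutations_of_multiset_def)
    then have "(\<Sum>ts | ts \<in> \<T> \<and> Branch (mset ts) = t. F (Branch (mset ts))) =
        (\<Sum>ts\<in>permutations_of_multiset M. F t)"
      using M by (intro sum.cong) (auto simp: permutations_of_multiset_def)
    also have "\<dots> = fact (size U) * F t"
      using t M U card_orderings_of_components[of M B] by simp
    finally show "(\<Sum>ts | ts \<in> \<T> \<and> Branch (mset ts) = t. F (Branch (mset ts))) = fact (size U) * F t" .
  qed simp
  finally show ?thesis by (simp add: sum_distrib_left)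
qed

text \<open>For \<alpha> < 1 and ns in \<open>splits n\<close>, this is
  \<open>fact (length ns)\<close> times the probability that the components, listed in uniformly
  random order, have sizes ns. The last line combines the \<open>PD_w\<close> of the components with
  that of the whole tree.\<close>

definition split_mass :: "real \<Rightarrow> real \<Rightarrow> nat list \<Rightarrow> real" where
  "split_mass \<alpha> \<gamma> ns = PD_a \<alpha> (- \<alpha> - \<gamma>) (length ns) * (fact (sum_list ns) / (\<Prod>m\<leftarrow>ns. fact m)) *
     (\<gamma> + (1 - \<alpha> - \<gamma>) * (1 - (\<Sum>m\<leftarrow>ns. real m * (real m - 1)) /
        (real (sum_list ns) * (real (sum_list ns) - 1)))) *
     ((\<Prod>m\<leftarrow>ns. PD_w \<alpha> m) / PD_w \<alpha> (sum_list ns))"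

lemma split_mass_cong:
  assumes "mset ns = mset ns'" shows "split_mass \<alpha> \<gamma> ns = split_mass \<alpha> \<gamma> ns'"
proof -
  have P: "prod_list (map f ns) = prod_list (map f ns')" for f :: "nat \<Rightarrow> real"
    using arg_cong[OF assms, of "\<lambda>M. prod_mset (image_mset f M)"]
    by (simp flip: mset_map add: prod_mset_prod_list)
  have S: "sum_list (map f ns) = sum_list (map f ns')" for f :: "nat \<Rightarrow> real"
    using arg_cong[OF assms, of "\<lambda>M. sum_mset (image_mset f M)"]
    by (simp flip: mset_map add: sum_mset_sum_list)
  have "sum_list ns = sum_list ns'" using assms by (metis sum_mset_sum_list)
  moreover have "length ns = length ns'" using assms by (metis size_mset)
  ultimately show ?thesis by (simp only: split_mass_def P S)
qed

text \<open>The sum is split according to the list of label sets. For fixed blocks it is the split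
  weight times a product over the components; this product depends only on the block sizes, so only
  the split weights remain to be summed over the block lists.\<close>

lemma sum_tree_weight_ordered:
  fixes us :: "unit ptree list"
  assumes par: "0 \<le> \<alpha>" "\<alpha> < 1" "0 \<le> \<gamma>" "\<gamma> \<le> \<alpha>"
    and us: "2 \<le> length us" "\<And>u. u \<in> set us \<Longrightarrow> 1 \<le> leaf_count u"
    and n: "n = sum_list (map leaf_count us)"
  shows "(\<Sum>ts | Branch (mset ts) \<in> trees_on {1..n} \<and> map delabel ts = us.
      tree_weight \<alpha> \<gamma> (Branch (mset ts))) =
    PD_w \<alpha> n * split_mass \<alpha> \<gamma> (map leaf_count us) *
    (\<Prod>u\<leftarrow>us. pmf (delabelled_alpha_gamma_tree \<alpha> \<gamma> (leaf_count u)) u)"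
proof -
  let ?ms = "map leaf_count us"
  let ?L = "block_lists {1..n} ?ms"
  let ?P = "\<lambda>u. pmf (delabelled_alpha_gamma_tree \<alpha> \<gamma> (leaf_count u)) u"
  define \<T> where "\<T> = {ts. Branch (mset ts) \<in> trees_on {1..n} \<and> map delabel ts = us}"
  have fL: "finite ?L" by (intro finite_block_lists) simp
  have memL: "map set_ptree ts \<in> ?L" if "ts \<in> \<T>" for ts
  proof -
    have t: "t \<in> trees_on (set_ptree t)" if "t \<in> set ts" for t
      using \<open>ts \<in> \<T>\<close> that child_trees_on by (fastforce simp: \<T>_def)
    have "map (card \<circ> set_ptree) ts = map (leaf_count \<circ> delabel) ts"
      using leaf_count_trees_on[OF t] by (simp add: leaf_count_delabel)
    moreover have "us = map delabel ts" using that by (simp add: \<T>_def)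
    moreover have "map mset_set (map set_ptree ts) = map leaf_labels ts"
      using t by (simp add: trees_on_def)
    moreover have "sum_list (map leaf_labels ts) = mset_set {1..n}"
      using that unfolding leaf_labels_Branch_mset[symmetric] by (simp add: \<T>_def trees_on_def)
    ultimately show ?thesis
      using trees_on_finite[OF t] unfolding block_lists_def by (auto simp del: map_map) auto
  qed
  have fib: "{ts. ts \<in> \<T> \<and> map set_ptree ts = Bs} =
      listset (map (\<lambda>(X, u). {t \<in> trees_on X. delabel t = u}) (zip Bs us))" if "Bs \<in> ?L" for Bs
    using component_lists_eq[OF _ that us(1) refl] by (simp add: \<T>_def conj_assoc)
  have "\<T> = (\<Union>Bs\<in>?L. {ts. ts \<in> \<T> \<and> map set_ptree ts = Bs})" using memL by auto
  also have "finite \<dots>"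
    using fL fib by (auto intro!: finite_listset simp: finite_trees_on)
  finally have fT: "finite \<T>" .
  have inner: "(\<Sum>ts | ts \<in> \<T> \<and> map set_ptree ts = Bs. tree_weight \<alpha> \<gamma> (Branch (mset ts))) =
      split_weight \<alpha> \<gamma> (length us) (set Bs) * (\<Prod>u\<leftarrow>us. PD_w \<alpha> (leaf_count u) * ?P u)"
    if Bs: "Bs \<in> ?L" for Bs
  proof -
    let ?A = "\<lambda>(X, u). {t \<in> trees_on X. delabel t = u}"
    have len: "length Bs = length us"
      using Bs by (auto simp: block_lists_def dest: map_eq_imp_length_eq)
    have "(\<Sum>ts | ts \<in> \<T> \<and> map set_ptree ts = Bs. tree_weight \<alpha> \<gamma> (Branch (mset ts))) =
        (\<Sum>ts | ts \<in> \<T> \<and> map set_ptree ts = Bs.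
          split_weight \<alpha> \<gamma> (length us) (set Bs) * (\<Prod>(i, t)\<leftarrow>zip (zip Bs us) ts. tree_weight \<alpha> \<gamma> t))"
    proof (rule sum.cong)
      fix ts assume "ts \<in> {ts. ts \<in> \<T> \<and> map set_ptree ts = Bs}"
      then have ts: "length ts = length us" "set Bs = set_ptree ` set ts"
        by (auto simp: \<T>_def)
      have "map (\<lambda>(i, t). tree_weight \<alpha> \<gamma> t) (zip (zip Bs us) ts) = map (tree_weight \<alpha> \<gamma>) ts"
        using ts(1) len by (intro nth_equalityI) auto
      then have "(\<Prod>(i, t)\<leftarrow>zip (zip Bs us) ts. tree_weight \<alpha> \<gamma> t) = (\<Prod>t\<leftarrow>ts. tree_weight \<alpha> \<gamma> t)"
        by simp
      also have "\<dots> = prod_mset (image_mset (tree_weight \<alpha> \<gamma>) (mset ts))"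
        by (simp flip: mset_map add: prod_mset_prod_list)
      finally show "tree_weight \<alpha> \<gamma> (Branch (mset ts)) = split_weight \<alpha> \<gamma> (length us) (set Bs) *
          (\<Prod>(i, t)\<leftarrow>zip (zip Bs us) ts. tree_weight \<alpha> \<gamma> t)"
        using ts by simp
    qed simp
    also have "\<dots> = split_weight \<alpha> \<gamma> (length us) (set Bs) *
        (\<Prod>i\<leftarrow>zip Bs us. \<Sum>t\<in>?A i. tree_weight \<alpha> \<gamma> t)"
      unfolding fib[OF Bs] sum_distrib_left[symmetric]
      by (subst sum_prod_listset) (auto simp: finite_trees_on)
    also have "map (\<lambda>i. \<Sum>t\<in>?A i. tree_weight \<alpha> \<gamma> t) (zip Bs us) =
        map (\<lambda>u. PD_w \<alpha> (leaf_count u) * ?P u) us"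
    proof (rule nth_equalityI)
      fix i assume "i < length (map (\<lambda>i. \<Sum>t\<in>?A i. tree_weight \<alpha> \<gamma> t) (zip Bs us))"
      then have i: "i < length us" by simp
      have "map card Bs ! i = map leaf_count us ! i" using Bs by (simp add: block_lists_def)
      then have c: "card (Bs ! i) = leaf_count (us ! i)" using i len by simp
      moreover have "1 \<le> leaf_count (us ! i)" using i us(2) by simp
      moreover have "finite (Bs ! i)" using Bs i len by (simp add: block_lists_def)
      moreover have "Bs ! i \<noteq> {}"
        using c \<open>1 \<le> leaf_count (us ! i)\<close> by (metis card.empty not_one_le_zero)
      ultimately show "map (\<lambda>i. \<Sum>t\<in>?A i. tree_weight \<alpha> \<gamma> t) (zip Bs us) ! i =
          map (\<lambda>u. PD_w \<alpha> (leaf_count u) * ?P u) us ! i"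
        using i len sum_tree_weight[OF par, of "Bs ! i" "us ! i"] by auto
    qed (simp add: len)
    finally show ?thesis .
  qed
  have n2: "2 \<le> n"
  proof -
    \<comment> \<open>There are at least two components, each with at least one leaf.\<close>
    have "(\<Sum>u\<leftarrow>us. 1) \<le> n" unfolding n using us(2) by (intro sum_list_mono)
    then show ?thesis using us(1) by (simp add: sum_list_triv)
  qed
  have "(\<Sum>ts\<in>\<T>. tree_weight \<alpha> \<gamma> (Branch (mset ts))) =
      (\<Sum>Bs\<in>?L. \<Sum>ts | ts \<in> \<T> \<and> map set_ptree ts = Bs. tree_weight \<alpha> \<gamma> (Branch (mset ts)))"
    using fT fL memL by (intro sum.group[symmetric]) auto
  also have "\<dots> = (\<Sum>Bs\<in>?L. split_weight \<alpha> \<gamma> (length us) (set Bs)) *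
      (\<Prod>u\<leftarrow>us. PD_w \<alpha> (leaf_count u) * ?P u)"
    using inner by (simp add: sum_distrib_right)
  also have "(\<Prod>u\<leftarrow>us. PD_w \<alpha> (leaf_count u) * ?P u) = (\<Prod>m\<leftarrow>?ms. PD_w \<alpha> m) * (\<Prod>u\<leftarrow>us. ?P u)"
    by (induction us) (auto simp: ac_simps)
  also have "(\<Sum>Bs\<in>?L. split_weight \<alpha> \<gamma> (length us) (set Bs)) * ((\<Prod>m\<leftarrow>?ms. PD_w \<alpha> m) * (\<Prod>u\<leftarrow>us. ?P u)) =
      PD_w \<alpha> n * split_mass \<alpha> \<gamma> ?ms * (\<Prod>u\<leftarrow>us. ?P u)"
    using PD_w_pos[of \<alpha> n] par n2 n
    by (subst sum_split_weight) (simp_all add: split_mass_def)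
  finally show ?thesis by (simp add: \<T>_def)
qed

lemma pmf_delabelled_Branch:
  fixes U :: "unit ptree multiset"
  assumes par: "0 \<le> \<alpha>" "\<alpha> < 1" "0 \<le> \<gamma>" "\<gamma> \<le> \<alpha>"
    and U: "2 \<le> size U" "\<And>u. u \<in># U \<Longrightarrow> 1 \<le> leaf_count u"
    and n: "n = sum_mset (image_mset leaf_count U)"
  shows "fact (size U) * pmf (delabelled_alpha_gamma_tree \<alpha> \<gamma> n) (Branch U) =
    (\<Sum>us\<in>permutations_of_multiset U. split_mass \<alpha> \<gamma> (map leaf_count us) *
      (\<Prod>u\<leftarrow>us. pmf (delabelled_alpha_gamma_tree \<alpha> \<gamma> (leaf_count u)) u))"
proof -
  obtain us0 where us0: "mset us0 = U" using ex_mset by blast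
  have n2: "2 \<le> n"
  proof -
    have "(\<Sum>u\<leftarrow>us0. 1) \<le> (\<Sum>u\<leftarrow>us0. leaf_count u)"
      using U(2) us0 by (intro sum_list_mono) auto
    also have "\<dots> = n" unfolding n us0[symmetric] by (simp flip: mset_map add: sum_mset_sum_list)
    finally show ?thesis using U(1) us0 by (auto simp: sum_list_triv)
  qed
  have w: "PD_w \<alpha> n > 0" using par n2 by (intro PD_w_pos) auto
  have "PD_w \<alpha> n * (fact (size U) * pmf (delabelled_alpha_gamma_tree \<alpha> \<gamma> n) (Branch U)) =
      fact (size U) * (\<Sum>t | t \<in> trees_on {1..n} \<and> delabel t = Branch U. tree_weight \<alpha> \<gamma> t)"
    using sum_tree_weight[OF par, of "{1..n}" "Branch U"] n2 by simp
  also have "\<dots> = (\<Sum>us\<in>permutations_of_multiset U.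
      \<Sum>ts | Branch (mset ts) \<in> trees_on {1..n} \<and> map delabel ts = us. tree_weight \<alpha> \<gamma> (Branch (mset ts)))"
    by (rule sum_over_orderings[symmetric])
  also have "\<dots> = (\<Sum>us\<in>permutations_of_multiset U. PD_w \<alpha> n * (split_mass \<alpha> \<gamma> (map leaf_count us) *
      (\<Prod>u\<leftarrow>us. pmf (delabelled_alpha_gamma_tree \<alpha> \<gamma> (leaf_count u)) u)))"
  proof (rule sum.cong)
    fix us assume "us \<in> permutations_of_multiset U"
    then have us: "mset us = U" by (simp add: permutations_of_multiset_def)
    then have "2 \<le> length us" "\<And>u. u \<in> set us \<Longrightarrow> 1 \<le> leaf_count u"
      using U by auto
    moreover have "n = sum_list (map leaf_count us)"
      unfolding n us[symmetric] by (simp flip: mset_map add: sum_mset_sum_list)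
    ultimately show "(\<Sum>ts | Branch (mset ts) \<in> trees_on {1..n} \<and> map delabel ts = us.
        tree_weight \<alpha> \<gamma> (Branch (mset ts))) = PD_w \<alpha> n * (split_mass \<alpha> \<gamma> (map leaf_count us) *
        (\<Prod>u\<leftarrow>us. pmf (delabelled_alpha_gamma_tree \<alpha> \<gamma> (leaf_count u)) u))"
      using sum_tree_weight_ordered[OF par, of us n] by simp
  qed simp
  finally show ?thesis using w by (simp add: sum_distrib_left[symmetric])
qed


section \<open>First split, independent components, and the branching identity for \<alpha> <
  1\<close>

lemma first_split_Branch:
  assumes "ns \<in> splits n"
  shows "first_split u = ns \<longleftrightarrow> (\<exists>U. u = Branch U \<and> image_mset leaf_count U = mset ns)"
proof (cases u)
  case (Leaf l)
  then show ?thesis using assms by (auto simp: first_split_def splits_def)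
next
  case (Branch U)
  have s: "sorted (rev ns)" using assms by (simp add: splits_def sorted_wrt_rev)
  have "rev (sorted_list_of_multiset M) = ns \<longleftrightarrow> M = mset ns" for M
  proof
    assume "rev (sorted_list_of_multiset M) = ns"
    then show "M = mset ns" by (metis mset_rev mset_sorted_list_of_multiset)
  next
    assume "M = mset ns"
    then have "sorted_list_of_multiset M = sort (rev ns)"
      by (metis mset_rev sorted_list_of_multiset_mset)
    also have "\<dots> = rev ns" using s by (rule sorted_sort_id)
    finally show "rev (sorted_list_of_multiset M) = ns" by simp
  qed
  then show ?thesis using Branch by (simp add: first_split_def)
qed

text \<open>The orderings of U are classified by their images under f, which are the rearrangements
  of xs. All classes are equally large, since a permutation of positions that carries one
  rearrangement to another carries the corresponding classes into each other.\<close>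

lemma card_permutations_fibre:
  fixes f :: "'a \<Rightarrow> 'b"
  assumes xs: "mset xs = image_mset f U"
  shows "card (permutations_of_multiset U) =
    card (permutations_of_multiset (mset xs)) * card {us \<in> permutations_of_multiset U. map f us = xs}"
proof -
  let ?F = "\<lambda>ys. {us \<in> permutations_of_multiset U. map f us = ys}"
  have le: "card (?F ys) \<le> card (?F zs)" if "mset ys = mset xs" "mset zs = mset xs" for ys zs
  proof -
    from that have "mset zs = mset ys" by simp
    then obtain p where p: "p permutes {..<length ys}" "permute_list p ys = zs"
      by (rule mset_eq_permutation)
    show ?thesis
    proof (rule card_inj_on_le[of "permute_list p"])
      show "inj_on (permute_list p) (?F ys)"
      proof (rule inj_onI)
        fix us vs assume u: "us \<in> ?F ys" "vs \<in> ?F ys" and eq: "permute_list p us = permute_list p vs"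
        then have "map f us = ys" "map f vs = ys" by auto
        from this[THEN arg_cong, of length] have len: "length us = length ys" "length vs = length ys"
          by simp_all
        show "us = vs"
        proof (rule nth_equalityI)
          fix i assume "i < length us"
          \<comment> \<open>Entry i of the original list is found at position \<open>inv p i\<close>
            of the permuted list, which gives injectivity.\<close>
          then have i: "inv p i < length ys" "p (inv p i) = i"
            using permutes_in_image[OF permutes_inv[OF p(1)], of i] p(1) len
            by (auto simp: permutes_inverses)
          have "permute_list p us ! inv p i = permute_list p vs ! inv p i" using eq by simp
          then show "us ! i = vs ! i" using i p(1) len by (simp add: permute_list_nth)
        qed (simp add: len)
      qed
      show "permute_list p ` ?F ys \<subseteq> ?F zs"
      proof
        fix us assume "us \<in> permute_list p ` ?F ys"
        then obtain vs where v: "us = permute_list p vs" "mset vs = U" "map f vs = ys"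
          by (auto simp: permutations_of_multiset_def)
        then have "p permutes {..<length vs}" using p(1) by auto
        then show "us \<in> ?F zs"
          using v p(2) by (auto simp: permutations_of_multiset_def permute_list_map[symmetric])
      qed
    qed simp
  qed
  have "card (permutations_of_multiset U) = card (\<Union>ys\<in>permutations_of_multiset (mset xs). ?F ys)"
    using xs by (intro arg_cong[where f = card]) (auto simp: permutations_of_multiset_def)
  also have "\<dots> = (\<Sum>ys\<in>permutations_of_multiset (mset xs). card (?F ys))"
    by (intro card_UN_disjoint) auto
  also have "\<dots> = (\<Sum>ys\<in>permutations_of_multiset (mset xs). card (?F xs))"
    by (intro sum.cong antisym le) (auto simp: permutations_of_multiset_def)
  finally show ?thesis by simp
qed

text \<open>On the support the function S takes the default value outside the index set, so the list
  of its values determines it. The mass of a list is then a single product.\<close>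

lemma pmf_independent_list:
  "pmf (map_pmf (\<lambda>S. map S [0..<length ns]) (Pi_pmf {..<length ns} dflt (\<lambda>i. T (ns ! i)))) us =
    (if length us = length ns then \<Prod>(m, u)\<leftarrow>zip ns us. pmf (T m) u else 0)"
proof (cases "length us = length ns")
  case True
  let ?p = "Pi_pmf {..<length ns} dflt (\<lambda>i. T (ns ! i))"
  define S where "S i = (if i < length ns then us ! i else dflt)" for i
  have us: "map S [0..<length ns] = us"
    using True by (intro nth_equalityI) (auto simp: S_def)
  have supp: "set_pmf ?p \<subseteq> {S. \<forall>i. \<not> i < length ns \<longrightarrow> S i = dflt}"
    using set_Pi_pmf_subset[of "{..<length ns}" dflt "\<lambda>i. T (ns ! i)"] by simp
  have "pmf (map_pmf (\<lambda>S. map S [0..<length ns]) ?p) us =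
      measure ?p ((\<lambda>S. map S [0..<length ns]) -` {us} \<inter> set_pmf ?p)"
    by (simp add: pmf_map measure_Int_set_pmf)
  also have "(\<lambda>S. map S [0..<length ns]) -` {us} \<inter> set_pmf ?p = {S} \<inter> set_pmf ?p"
  proof -
    have "S' = S" if "map S' [0..<length ns] = us" "S' \<in> set_pmf ?p" for S'
    proof
      fix i
      show "S' i = S i"
      proof (cases "i < length ns")
        case True
        then have "map S' [0..<length ns] ! i = S' i" by simp
        then show ?thesis using that(1) True by (simp add: S_def)
      next
        case False
        then show ?thesis using that(2) supp by (auto simp: S_def)
      qed
    qed
    then show ?thesis using us by auto
  qed
  also have "measure ?p ({S} \<inter> set_pmf ?p) = pmf ?p S"
    by (simp add: measure_Int_set_pmf measure_pmf_single)
  also have "\<dots> = (\<Prod>i<length ns. pmf (T (ns ! i)) (us ! i))"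
    by (subst pmf_Pi') (auto simp: S_def)
  also have "\<dots> = (\<Prod>(m, u)\<leftarrow>zip ns us. pmf (T m) u)"
    using True by (simp add: prod.list_conv_set_nth atLeast0LessThan)
  finally show ?thesis using True by simp
next
  case False
  then have "us \<notin> (\<lambda>S. map S [0..<length ns]) ` set_pmf (Pi_pmf {..<length ns} dflt (\<lambda>i. T (ns ! i)))"
    by auto
  then show ?thesis using False by (simp add: pmf_map_outside)
qed

lemma pmf_independent_multiset:
  "pmf (map_pmf (\<lambda>S. image_mset S (mset_set {..<length ns}))
      (Pi_pmf {..<length ns} dflt (\<lambda>i. T (ns ! i)))) U =
    (\<Sum>us\<in>permutations_of_multiset U. if length us = length ns then \<Prod>(m, u)\<leftarrow>zip ns us. pmf (T m) u else 0)"
proof -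
  let ?p = "Pi_pmf {..<length ns} dflt (\<lambda>i. T (ns ! i))"
  let ?q = "map_pmf (\<lambda>S. map S [0..<length ns]) ?p"
  have "image_mset S (mset_set {..<length ns}) = mset (map S [0..<length ns])" for S :: "nat \<Rightarrow> 'a"
    by (simp add: mset_map lessThan_atLeast0)
  then have "map_pmf (\<lambda>S. image_mset S (mset_set {..<length ns})) ?p = map_pmf mset ?q"
    by (simp add: map_pmf_comp)
  then have "pmf (map_pmf (\<lambda>S. image_mset S (mset_set {..<length ns})) ?p) U =
      measure ?q (permutations_of_multiset U)"
    by (simp add: pmf_map permutations_of_multiset_def vimage_def)
  also have "\<dots> = (\<Sum>us\<in>permutations_of_multiset U. pmf ?q us)"
    by (rule measure_measure_pmf_finite) simp
  finally show ?thesis by (simp only: pmf_independent_list)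
qed

lemma set_pmf_delabelled:
  assumes "0 \<le> \<alpha>" "\<alpha> \<le> 1" "0 \<le> \<gamma>" "\<gamma> \<le> \<alpha>" "1 \<le> n"
  shows "set_pmf (delabelled_alpha_gamma_tree \<alpha> \<gamma> n) \<subseteq> delabel ` trees_on {1..n}"
  using set_pmf_alpha_gamma_tree[OF assms] by (auto simp: delabelled_alpha_gamma_tree_def)

lemma leaf_count_delabelled:
  assumes "u \<in> delabel ` trees_on B" shows "leaf_count u = card B"
  using assms by (auto simp: leaf_count_delabel leaf_count_trees_on)

lemma pmf_delabelled_leaf_count:
  assumes "0 \<le> \<alpha>" "\<alpha> \<le> 1" "0 \<le> \<gamma>" "\<gamma> \<le> \<alpha>" "1 \<le> n" "leaf_count u \<noteq> n"
  shows "pmf (delabelled_alpha_gamma_tree \<alpha> \<gamma> n) u = 0"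
proof (rule ccontr)
  assume "\<not> ?thesis"
  then have "u \<in> delabel ` trees_on {1..n}"
    using set_pmf_delabelled[OF assms(1-5)] by (auto simp: set_pmf_iff)
  then have "leaf_count u = card {1..n}" by (rule leaf_count_delabelled)
  then show False using assms(6) by simp
qed

lemma splitsD:
  assumes "ns \<in> splits n"
  shows "2 \<le> length ns" "\<And>m. m \<in> set ns \<Longrightarrow> 1 \<le> m" "sum_list ns = n"
  using assms by (auto simp: splits_def)

text \<open>\<open>split_mass\<close> is symmetric in the sizes, so it has the same value for all
  orderings of U and can be taken out of the sum.\<close>

lemma pmf_delabelled_Branch_split:
  fixes U :: "unit ptree multiset"
  assumes par: "0 \<le> \<alpha>" "\<alpha> < 1" "0 \<le> \<gamma>" "\<gamma> \<le> \<alpha>"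
    and ns: "ns \<in> splits n" "image_mset leaf_count U = mset ns"
  shows "fact (length ns) * pmf (delabelled_alpha_gamma_tree \<alpha> \<gamma> n) (Branch U) =
    split_mass \<alpha> \<gamma> ns * (\<Sum>us\<in>permutations_of_multiset U.
      \<Prod>u\<leftarrow>us. pmf (delabelled_alpha_gamma_tree \<alpha> \<gamma> (leaf_count u)) u)"
proof -
  have sz: "size U = length ns" using ns(2) by (metis size_image_mset size_mset)
  have u: "1 \<le> leaf_count u" if "u \<in># U" for u
  proof -
    have "leaf_count u \<in># image_mset leaf_count U" using that by simp
    then have "leaf_count u \<in> set ns" unfolding ns(2) by simp
    then show ?thesis using splitsD(2)[OF ns(1)] by blast
  qed
  have "n = sum_mset (image_mset leaf_count U)"
    using splitsD(3)[OF ns(1)] ns(2) by (simp add: sum_mset_sum_list)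
  from pmf_delabelled_Branch[OF par _ u this]
  have "fact (length ns) * pmf (delabelled_alpha_gamma_tree \<alpha> \<gamma> n) (Branch U) =
      (\<Sum>us\<in>permutations_of_multiset U. split_mass \<alpha> \<gamma> (map leaf_count us) *
      (\<Prod>u\<leftarrow>us. pmf (delabelled_alpha_gamma_tree \<alpha> \<gamma> (leaf_count u)) u))"
    using splitsD(1)[OF ns(1)] by (simp only: sz)
  also have "\<dots> = (\<Sum>us\<in>permutations_of_multiset U. split_mass \<alpha> \<gamma> ns *
      (\<Prod>u\<leftarrow>us. pmf (delabelled_alpha_gamma_tree \<alpha> \<gamma> (leaf_count u)) u))"
  proof (rule sum.cong)
    fix us assume "us \<in> permutations_of_multiset U"
    then have m: "mset (map leaf_count us) = mset ns"
      using ns(2) by (simp add: permutations_of_multiset_def)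
    show "split_mass \<alpha> \<gamma> (map leaf_count us) *
        (\<Prod>u\<leftarrow>us. pmf (delabelled_alpha_gamma_tree \<alpha> \<gamma> (leaf_count u)) u) = split_mass \<alpha> \<gamma> ns *
        (\<Prod>u\<leftarrow>us. pmf (delabelled_alpha_gamma_tree \<alpha> \<gamma> (leaf_count u)) u)"
      by (simp only: split_mass_cong[OF m])
  qed simp
  finally show ?thesis by (simp add: sum_distrib_left)
qed

lemma prod_zip_leaf_count:
  "map leaf_count us = ns \<Longrightarrow> (\<Prod>(m, u)\<leftarrow>zip ns us. g m u) = (\<Prod>u\<leftarrow>us. g (leaf_count u) u)"
  by (induction us arbitrary: ns) auto

text \<open>Summation over all multisets U of components with sizes ns becomes summation over all
  lists of shapes whose sizes form a rearrangement of ns. For each rearrangement the sum of the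
  products factorises into total masses of delabelled trees, which are all 1, so every rearrangement
  contributes \<open>split_mass\<close> once.\<close>

lemma pmf_first_split:
  assumes par: "0 \<le> \<alpha>" "\<alpha> < 1" "0 \<le> \<gamma>" "\<gamma> \<le> \<alpha>" and ns: "ns \<in> splits n"
  shows "fact (length ns) * pmf (map_pmf first_split (delabelled_alpha_gamma_tree \<alpha> \<gamma> n)) ns =
    real (card (permutations_of_multiset (mset ns))) * split_mass \<alpha> \<gamma> ns"
proof -
  let ?D = "delabelled_alpha_gamma_tree \<alpha> \<gamma>"
  let ?UT = "\<lambda>m. delabel ` trees_on {1::nat..m}"
  let ?P = "\<lambda>us. \<Prod>u\<leftarrow>us. pmf (?D (leaf_count u)) u"
  have par1: "\<alpha> \<le> 1" using par by simp
  have n: "1 \<le> n"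
  proof -
    have "ns \<noteq> []" using splitsD(1)[OF ns] by auto
    then have "hd ns \<in> set ns" by simp
    then show ?thesis using splitsD(2,3)[OF ns] member_le_sum_list[of "hd ns" ns] by fastforce
  qed
  define V where "V = (\<Union>ms\<in>permutations_of_multiset (mset ns). listset (map ?UT ms))"
  have UT: "map leaf_count us = ms" if "us \<in> listset (map ?UT ms)" for us ms
  proof (rule nth_equalityI)
    show "length (map leaf_count us) = length ms"
      using that by (simp add: in_listset_iff list_all2_conv_all_nth)
    fix i assume "i < length (map leaf_count us)"
    then have i: "i < length us" by simp
    then have "us ! i \<in> ?UT (ms ! i)"
      using that by (auto simp: in_listset_iff list_all2_conv_all_nth)
    then show "map leaf_count us ! i = ms ! i"
      using leaf_count_delabelled[of "us ! i" "{1..ms ! i}"] i by simp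
  qed
  have finV: "finite V"
    unfolding V_def by (auto intro!: finite_listset simp: finite_trees_on)
  have Vms: "mset (map leaf_count us) = mset ns" if "us \<in> V" for us
    using that UT by (fastforce simp: V_def permutations_of_multiset_def)
  \<comment> \<open>A finite superset of the support suffices. Adjoining all trees formed from lists
    in V makes the part with first split ns a full product set, without a proof that each such tree
    is attained.\<close>
  let ?A = "?UT n \<union> Branch ` mset ` V"
  have finA: "finite ?A" using finV by (simp add: finite_trees_on)
  have A: "{u. u \<in> ?A \<and> first_split u = ns} = Branch ` mset ` V"
  proof (intro equalityI subsetI)
    fix u assume u: "u \<in> {u. u \<in> ?A \<and> first_split u = ns}"
    then obtain U where U: "u = Branch U" "image_mset leaf_count U = mset ns"
      using first_split_Branch[OF ns] by blast
    show "u \<in> Branch ` mset ` V"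
    proof (cases "u \<in> ?UT n")
      case True
      then obtain t where t: "t \<in> trees_on {1..n}" "u = delabel t" by blast
      then obtain M where M: "t = Branch M" using U by (cases t) (auto simp: delabel_def)
      obtain us where us: "mset us = U" using ex_mset by blast
      have "v \<in> ?UT (leaf_count v)" if v: "v \<in># U" for v
      proof -
        obtain c where c: "c \<in># M" "v = delabel c" using v t M U by (auto simp: delabel_Branch)
        have ct: "c \<in> trees_on (set_ptree c)" using child_trees_on t(1) M c(1) by blast
        have "card (set_ptree c) = card {1..card (set_ptree c)}" by simp
        \<comment> \<open>Any bijection to the standard labels will do here, since only the shape of
          the component matters.\<close>
        then obtain h where "bij_betw h (set_ptree c) {1..card (set_ptree c)}"
          using trees_on_finite[OF ct] by (metis finite_atLeastAtMost finite_same_card_bij)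
        from bij_betw_trees_on[OF this] have "map_ptree h c \<in> trees_on {1..card (set_ptree c)}"
          using ct by (auto simp: bij_betw_def)
        then have "v \<in> ?UT (card (set_ptree c))"
          using c(2) delabel_map by (metis image_eqI)
        then show ?thesis using leaf_count_delabelled[of v "{1..card (set_ptree c)}"] by simp
      qed
      then have "us \<in> listset (map ?UT (map leaf_count us))"
        using us by (auto simp: in_listset_iff list_all2_conv_all_nth)
      moreover have "map leaf_count us \<in> permutations_of_multiset (mset ns)"
        using us U by (simp add: permutations_of_multiset_def)
      ultimately have "us \<in> V" unfolding V_def by blast
      then show ?thesis using us U by blast
    next
      case False
      then show ?thesis using u by blast
    qed
  next
    fix u assume "u \<in> Branch ` mset ` V"
    then show "u \<in> {u. u \<in> ?A \<and> first_split u = ns}"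
      using Vms by (auto simp: first_split_Branch[OF ns])
  qed
  \<comment> \<open>V is closed under rearrangement, because it is the union over all rearrangements
    of ns.\<close>
  have perm: "{us. us \<in> V \<and> mset us = U} = permutations_of_multiset U" if U: "U \<in> mset ` V" for U
  proof (intro equalityI subsetI)
    fix us assume "us \<in> permutations_of_multiset U"
    then have us: "mset us = U" by (simp add: permutations_of_multiset_def)
    obtain vs where vs: "vs \<in> V" "mset vs = U" using U by blast
    have mem: "v \<in> ?UT (leaf_count v)" if v: "v \<in># U" for v
    proof -
      obtain ms where "vs \<in> listset (map ?UT ms)" using vs(1) by (auto simp: V_def)
      with UT[of vs ms] have "vs \<in> listset (map ?UT (map leaf_count vs))" by simp
      moreover obtain i where "i < length vs" "v = vs ! i"
        using v vs(2) by (metis in_set_conv_nth set_mset_mset)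
      ultimately show ?thesis by (auto simp: in_listset_iff list_all2_conv_all_nth)
    qed
    then have "us \<in> listset (map ?UT (map leaf_count us))"
      using us by (auto simp: in_listset_iff list_all2_conv_all_nth)
    moreover have "mset (map leaf_count us) = mset (map leaf_count vs)" using us vs by simp
    then have "map leaf_count us \<in> permutations_of_multiset (mset ns)"
      using Vms[OF vs(1)] by (simp add: permutations_of_multiset_def)
    ultimately have "us \<in> V" unfolding V_def by blast
    then show "us \<in> {us. us \<in> V \<and> mset us = U}" using us by simp
  qed (auto simp: permutations_of_multiset_def)
  have "fact (length ns) * pmf (map_pmf first_split (?D n)) ns =
      fact (length ns) * (\<Sum>u\<in>Branch ` mset ` V. pmf (?D n) u)"
    using pmf_map_finite[OF finA, of "?D n" first_split ns]
      set_pmf_delabelled[OF par(1) par1 par(3,4) n] A by auto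
  also have "\<dots> = (\<Sum>U\<in>mset ` V. fact (length ns) * pmf (?D n) (Branch U))"
    by (subst sum.reindex) (auto simp: inj_on_def sum_distrib_left)
  also have "\<dots> = (\<Sum>U\<in>mset ` V. split_mass \<alpha> \<gamma> ns * (\<Sum>us | us \<in> V \<and> mset us = U. ?P us))"
  proof (rule sum.cong)
    fix U assume U: "U \<in> mset ` V"
    then have "image_mset leaf_count U = mset ns" using Vms by auto
    then show "fact (length ns) * pmf (?D n) (Branch U) =
        split_mass \<alpha> \<gamma> ns * (\<Sum>us | us \<in> V \<and> mset us = U. ?P us)"
      using pmf_delabelled_Branch_split[OF par ns] perm[OF U] by simp
  qed simp
  also have "\<dots> = split_mass \<alpha> \<gamma> ns * (\<Sum>us\<in>V. ?P us)"
    using finV by (simp add: sum_distrib_left[symmetric] sum.group)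
  also have "(\<Sum>us\<in>V. ?P us) = (\<Sum>ms\<in>permutations_of_multiset (mset ns). \<Sum>us\<in>listset (map ?UT ms). ?P us)"
    unfolding V_def using UT
    by (intro sum.UNION_disjoint) (auto intro!: finite_listset simp: finite_trees_on)
  also have "\<dots> = (\<Sum>ms\<in>permutations_of_multiset (mset ns). 1)"
  proof (rule sum.cong)
    fix ms assume ms: "ms \<in> permutations_of_multiset (mset ns)"
    have "(\<Sum>us\<in>listset (map ?UT ms). ?P us) =
        (\<Sum>us\<in>listset (map ?UT ms). \<Prod>(m, u)\<leftarrow>zip ms us. pmf (?D m) u)"
      using UT by (intro sum.cong refl prod_zip_leaf_count[symmetric])
    also have "\<dots> = (\<Prod>m\<leftarrow>ms. \<Sum>u\<in>?UT m. pmf (?D m) u)"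
      by (rule sum_prod_listset) (simp add: finite_trees_on)
    also have "map (\<lambda>m. \<Sum>u\<in>?UT m. pmf (?D m) u) ms = map (\<lambda>_. 1) ms"
    proof (rule map_cong)
      fix m assume "m \<in> set ms"
      moreover have "set ms = set ns" using ms by (metis permutations_of_multisetD set_mset_mset)
      ultimately have "1 \<le> m" using splitsD(2)[OF ns] by simp
      then show "(\<Sum>u\<in>?UT m. pmf (?D m) u) = 1"
        using set_pmf_delabelled[OF par(1) par1 par(3,4)]
        by (intro sum_pmf_eq_1) (auto simp: finite_trees_on)
    qed simp
    finally show "(\<Sum>us\<in>listset (map ?UT ms). ?P us) = 1" by (simp add: map_replicate_const)
  qed simp
  finally show ?thesis by simp
qed

text \<open>At some position the tree has the wrong number of leaves, and there the factor of the
  product vanishes.\<close>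

lemma pmf_list_leaf_counts:
  assumes par: "0 \<le> \<alpha>" "\<alpha> \<le> 1" "0 \<le> \<gamma>" "\<gamma> \<le> \<alpha>"
    and ns: "ns \<in> splits n" and len: "length us = length ns" and ne: "map leaf_count us \<noteq> ns"
  shows "(\<Prod>(m, u)\<leftarrow>zip ns us. pmf (delabelled_alpha_gamma_tree \<alpha> \<gamma> m) u) = 0"
proof -
  from ne len obtain i where i: "i < length ns" "leaf_count (us ! i) \<noteq> ns ! i"
    by (metis length_map nth_equalityI nth_map)
  have "1 \<le> ns ! i" using splitsD(2)[OF ns] i(1) by simp
  then have "pmf (delabelled_alpha_gamma_tree \<alpha> \<gamma> (ns ! i)) (us ! i) = 0"
    using par i(2) by (intro pmf_delabelled_leaf_count) auto
  moreover have "(ns ! i, us ! i) \<in> set (zip ns us)"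
    using i(1) len by (auto simp: in_set_zip)
  ultimately show ?thesis by (force simp: prod_list_zero_iff)
qed

text \<open>The product of the component probabilities is the same for every ordering of U. Hence
  the independent law of the components gives U this product times the number of orderings with
  sizes exactly ns, and the claim reduces to counting orderings of U by their sizes. Writing the
  identity as a product keeps it meaningful when the split has probability zero.\<close>

lemma branching_identity_less_1:
  fixes U :: "unit ptree multiset"
  assumes par: "0 \<le> \<alpha>" "\<alpha> < 1" "0 \<le> \<gamma>" "\<gamma> \<le> \<alpha>"
    and ns: "ns \<in> splits n" "image_mset leaf_count U = mset ns"
  shows "pmf (delabelled_alpha_gamma_tree \<alpha> \<gamma> n) (Branch U) =
    pmf (map_pmf first_split (delabelled_alpha_gamma_tree \<alpha> \<gamma> n)) ns *
    (\<Sum>us\<in>permutations_of_multiset U. if length us = length ns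
      then \<Prod>(m, u)\<leftarrow>zip ns us. pmf (delabelled_alpha_gamma_tree \<alpha> \<gamma> m) u else 0)"
proof -
  let ?D = "delabelled_alpha_gamma_tree \<alpha> \<gamma>"
  let ?P = "\<lambda>u. pmf (?D (leaf_count u)) u"
  let ?Q = "prod_mset (image_mset ?P U)"
  let ?F = "{us \<in> permutations_of_multiset U. map leaf_count us = ns}"
  have Q: "(\<Prod>u\<leftarrow>us. ?P u) = ?Q" if "us \<in> permutations_of_multiset U" for us
    using that by (auto simp: permutations_of_multiset_def prod_mset_prod_list simp flip: mset_map)
  have "(\<Sum>us\<in>permutations_of_multiset U. if length us = length ns
      then \<Prod>(m, u)\<leftarrow>zip ns us. pmf (?D m) u else 0) =
      (\<Sum>us\<in>permutations_of_multiset U. if map leaf_count us = ns then ?Q else 0)"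
  proof (rule sum.cong)
    fix us assume us: "us \<in> permutations_of_multiset U"
    show "(if length us = length ns then \<Prod>(m, u)\<leftarrow>zip ns us. pmf (?D m) u else 0) =
        (if map leaf_count us = ns then ?Q else 0)"
    proof (cases "map leaf_count us = ns")
      case True
      then have "length us = length ns" by auto
      then show ?thesis using Q[OF us] prod_zip_leaf_count[OF True, of "\<lambda>m. pmf (?D m)"] True by simp
    next
      case False
      have "(\<Prod>(m, u)\<leftarrow>zip ns us. pmf (?D m) u) = 0" if "length us = length ns"
        using pmf_list_leaf_counts[of \<alpha> \<gamma>, OF _ _ _ _ ns(1) that False] par by simp
      then show ?thesis using False by simp
    qed
  qed simp
  also have "\<dots> = real (card ?F) * ?Q"
    by (simp add: sum.If_cases Int_def)
  finally have R: "(\<Sum>us\<in>permutations_of_multiset U. if length us = length ns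
      then \<Prod>(m, u)\<leftarrow>zip ns us. pmf (?D m) u else 0) = real (card ?F) * ?Q" .
  have "fact (length ns) * pmf (?D n) (Branch U) =
      split_mass \<alpha> \<gamma> ns * (real (card (permutations_of_multiset U)) * ?Q)"
    using pmf_delabelled_Branch_split[OF par ns] Q by simp
  also have "card (permutations_of_multiset U) = card (permutations_of_multiset (mset ns)) * card ?F"
    using ns(2) by (intro card_permutations_fibre) simp
  also have "split_mass \<alpha> \<gamma> ns * (real (card (permutations_of_multiset (mset ns)) * card ?F) * ?Q) =
      fact (length ns) * (pmf (map_pmf first_split (?D n)) ns * (real (card ?F) * ?Q))"
    using pmf_first_split[OF par ns(1)] by (simp add: algebra_simps)
  finally show ?thesis unfolding R by simp
qed


subsection \<open>Continuity in the parameters\<close>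

lemma tendsto_prod_list:
  fixes f :: "'i \<Rightarrow> 'j \<Rightarrow> real"
  assumes "\<And>i. i \<in> set is \<Longrightarrow> ((\<lambda>j. f i j) \<longlongrightarrow> l i) F"
  shows "((\<lambda>j. \<Prod>i\<leftarrow>is. f i j) \<longlongrightarrow> (\<Prod>i\<leftarrow>is. l i)) F"
  using assms by (induction "is") (auto intro!: tendsto_mult)

lemma tendsto_weight:
  assumes "(a \<longlongrightarrow> \<alpha>) F" "(g \<longlongrightarrow> \<gamma>) F" "x \<in> sites t"
  shows "((\<lambda>j. weight (a j) (g j) x) \<longlongrightarrow> weight \<alpha> \<gamma> x) F"
proof -
  consider l where "x = Edge (Leaf l)" | M where "x = Edge (Branch M)" | M where "x = Vertex (Branch M)"
    using assms(3) by (auto simp: sites_def) (metis ptree.exhaust)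
  then show ?thesis
    by cases (use assms(1,2) in \<open>auto intro!: tendsto_intros\<close>)
qed

context
  fixes a g :: "nat \<Rightarrow> real" and \<alpha> \<gamma> :: real
  assumes params: "\<And>j. 0 \<le> a j" "\<And>j. a j \<le> 1" "\<And>j. 0 \<le> g j" "\<And>j. g j \<le> a j"
    and lim: "a \<longlonglongrightarrow> \<alpha>" "g \<longlonglongrightarrow> \<gamma>"
begin

lemma limit_params: "0 \<le> \<alpha>" "\<alpha> \<le> 1" "0 \<le> \<gamma>" "\<gamma> \<le> \<alpha>"
  using LIMSEQ_le_const[OF lim(1), of 0] LIMSEQ_le_const2[OF lim(1), of 1]
    LIMSEQ_le_const[OF lim(2), of 0] LIMSEQ_le[OF lim(2,1)] params by auto

text \<open>Continuity is derived from the one-step recursion, whose denominator n - \<alpha> stays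
  positive for n \<ge> 2 even at \<alpha> = 1. The case n = 2 is separate because that tree is
  prescribed.\<close>

lemma pmf_alpha_gamma_tree_tendsto:
  assumes "1 \<le> n" "t \<in> trees_on {1..n}"
  shows "(\<lambda>j. pmf (alpha_gamma_tree (a j) (g j) n) t) \<longlonglongrightarrow> pmf (alpha_gamma_tree \<alpha> \<gamma> n) t"
  using assms
proof (induction n arbitrary: t rule: nat_induct_at_least)
  case base
  then show ?case by simp
next
  case (Suc n)
  show ?case
  proof (cases "n = 1")
    case True
    then show ?thesis by (simp add: numeral_2_eq_2)
  next
    case False
    then have n: "2 \<le> n" using Suc.hyps by simp
    obtain u x where u: "u \<in> trees_on {1..n}" and x: "x \<in> sites u"
      and t: "t = insert_leaf (Suc n) u x"
      using Suc by (meson trees_on_Suc)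
    have "real n - \<alpha> \<noteq> 0" using n limit_params by linarith
    then have "(\<lambda>j. pmf (alpha_gamma_tree (a j) (g j) n) u * (weight (a j) (g j) x / (real n - a j)))
        \<longlonglongrightarrow> pmf (alpha_gamma_tree \<alpha> \<gamma> n) u * (weight \<alpha> \<gamma> x / (real n - \<alpha>))"
      using Suc.IH[OF u] tendsto_weight[OF lim x] lim by (intro tendsto_intros)
    then show ?thesis
      unfolding t using pmf_alpha_gamma_tree_Suc[OF params n u x]
        pmf_alpha_gamma_tree_Suc[OF limit_params n u x] by simp
  qed
qed

lemma pmf_map_alpha_gamma_tree_tendsto:
  assumes "1 \<le> n"
  shows "(\<lambda>j. pmf (map_pmf f (alpha_gamma_tree (a j) (g j) n)) y)
    \<longlonglongrightarrow> pmf (map_pmf f (alpha_gamma_tree \<alpha> \<gamma> n)) y"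
  unfolding pmf_map_finite[OF finite_trees_on set_pmf_alpha_gamma_tree[OF params assms]]
    pmf_map_finite[OF finite_trees_on set_pmf_alpha_gamma_tree[OF limit_params assms]]
  by (intro tendsto_sum) (auto intro: pmf_alpha_gamma_tree_tendsto[OF assms])

end

text \<open>The product formula for the tree weights degenerates at \<open>\<alpha> = 1\<close>, where \<open>PD_w 1 n = 0\<close>,
  so this case is obtained by letting \<open>\<alpha>\<close> tend to 1.\<close>

lemma ex_approximating_params:
  assumes "0 \<le> \<gamma>" "\<gamma> \<le> (1::real)"
  obtains a g where "\<And>j::nat. 0 \<le> a j" "\<And>j. a j < 1" "\<And>j. 0 \<le> g j" "\<And>j. g j \<le> a j"
    "a \<longlonglongrightarrow> 1" "g \<longlonglongrightarrow> \<gamma>"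
proof -
  define a where "a j = 1 - inverse (real (Suc j))" for j
  have lim: "a \<longlonglongrightarrow> 1"
    unfolding a_def using tendsto_diff[OF tendsto_const LIMSEQ_inverse_real_of_nat, of 1] by simp
  have "0 \<le> a j" "a j < 1" for j
    by (auto simp: a_def inverse_le_1_iff)
  \<comment> \<open>Cutting \<gamma> down to \<open>a j\<close> keeps the pair admissible; the limit
    is still \<gamma> because \<gamma> \<le> 1.\<close>
  moreover have "(\<lambda>j. min \<gamma> (a j)) \<longlonglongrightarrow> min \<gamma> 1"
    by (intro tendsto_min tendsto_const lim)
  ultimately show ?thesis
    using that[of a "\<lambda>j. min \<gamma> (a j)"] assms lim by simp
qed

text \<open>For fixed U and ns both sides are finite sums and products over index sets that do not
  involve the parameters. The case \<alpha> = 1 is therefore the limit of the identity along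
  admissible parameters with \<alpha> < 1.\<close>

lemma branching_identity:
  fixes U :: "unit ptree multiset"
  assumes par: "0 \<le> \<alpha>" "\<alpha> \<le> 1" "0 \<le> \<gamma>" "\<gamma> \<le> \<alpha>"
    and ns: "ns \<in> splits n" "image_mset leaf_count U = mset ns" and n: "1 \<le> n"
  shows "pmf (delabelled_alpha_gamma_tree \<alpha> \<gamma> n) (Branch U) =
    pmf (map_pmf first_split (delabelled_alpha_gamma_tree \<alpha> \<gamma> n)) ns *
    (\<Sum>us\<in>permutations_of_multiset U. if length us = length ns
      then \<Prod>(m, u)\<leftarrow>zip ns us. pmf (delabelled_alpha_gamma_tree \<alpha> \<gamma> m) u else 0)"
proof (cases "\<alpha> < 1")
  case True
  then show ?thesis using branching_identity_less_1 par ns by blast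
next
  case False
  then have \<alpha>: "\<alpha> = 1" using par by simp
  obtain a g where ag: "\<And>j::nat. 0 \<le> a j" "\<And>j. a j < 1" "\<And>j. 0 \<le> g j" "\<And>j. g j \<le> a j"
    and lim: "a \<longlonglongrightarrow> \<alpha>" "g \<longlonglongrightarrow> \<gamma>"
    using ex_approximating_params[of \<gamma>] par \<alpha> by auto
  note ag' = ag(1) less_imp_le[OF ag(2)] ag(3,4)
  have D: "(\<lambda>j. pmf (delabelled_alpha_gamma_tree (a j) (g j) m) u)
      \<longlonglongrightarrow> pmf (delabelled_alpha_gamma_tree \<alpha> \<gamma> m) u" if "1 \<le> m" for m u
    unfolding delabelled_alpha_gamma_tree_def
    by (rule pmf_map_alpha_gamma_tree_tendsto[OF ag' lim that])
  have "(\<lambda>j. pmf (map_pmf first_split (delabelled_alpha_gamma_tree (a j) (g j) n)) ns *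
      (\<Sum>us\<in>permutations_of_multiset U. if length us = length ns
        then \<Prod>(m, u)\<leftarrow>zip ns us. pmf (delabelled_alpha_gamma_tree (a j) (g j) m) u else 0))
      \<longlonglongrightarrow> pmf (map_pmf first_split (delabelled_alpha_gamma_tree \<alpha> \<gamma> n)) ns *
      (\<Sum>us\<in>permutations_of_multiset U. if length us = length ns
        then \<Prod>(m, u)\<leftarrow>zip ns us. pmf (delabelled_alpha_gamma_tree \<alpha> \<gamma> m) u else 0)"
  proof (intro tendsto_mult tendsto_sum)
    show "(\<lambda>j. pmf (map_pmf first_split (delabelled_alpha_gamma_tree (a j) (g j) n)) ns)
        \<longlonglongrightarrow> pmf (map_pmf first_split (delabelled_alpha_gamma_tree \<alpha> \<gamma> n)) ns"
      unfolding delabelled_alpha_gamma_tree_def map_pmf_comp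
      by (rule pmf_map_alpha_gamma_tree_tendsto[OF ag' lim n])
    fix us
    have "(\<lambda>j. \<Prod>p\<leftarrow>zip ns us. (case p of (m, u) \<Rightarrow> pmf (delabelled_alpha_gamma_tree (a j) (g j) m) u))
        \<longlonglongrightarrow> (\<Prod>p\<leftarrow>zip ns us. case p of (m, u) \<Rightarrow> pmf (delabelled_alpha_gamma_tree \<alpha> \<gamma> m) u)"
      using D splitsD(2)[OF ns(1)] by (intro tendsto_prod_list) (auto dest: set_zip_leftD)
    then show "(\<lambda>j. if length us = length ns
        then \<Prod>(m, u)\<leftarrow>zip ns us. pmf (delabelled_alpha_gamma_tree (a j) (g j) m) u else 0)
        \<longlonglongrightarrow> (if length us = length ns
        then \<Prod>(m, u)\<leftarrow>zip ns us. pmf (delabelled_alpha_gamma_tree \<alpha> \<gamma> m) u else 0)"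
      by simp
  qed
  then have "(\<lambda>j. pmf (delabelled_alpha_gamma_tree (a j) (g j) n) (Branch U))
      \<longlonglongrightarrow> pmf (map_pmf first_split (delabelled_alpha_gamma_tree \<alpha> \<gamma> n)) ns *
      (\<Sum>us\<in>permutations_of_multiset U. if length us = length ns
        then \<Prod>(m, u)\<leftarrow>zip ns us. pmf (delabelled_alpha_gamma_tree \<alpha> \<gamma> m) u else 0)"
    using branching_identity_less_1[OF ag ns] by simp
  with D[OF n] show ?thesis by (rule LIMSEQ_unique)
qed

section \<open>The Markov branching property\<close>

lemma first_split_splits:
  assumes "t \<in> trees_on {1..n}" "2 \<le> n"
  shows "first_split (delabel t) \<in> splits n"
proof -
  obtain M where M: "t = Branch M"
  proof (cases t)
    case (Leaf l)
    then have "{1..n} = {l}" using assms(1) by simp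
    then have "card {1..n} = 1" by simp
    then show ?thesis using assms(2) by simp
  qed
  let ?C = "image_mset leaf_count M"
  have f: "first_split (delabel t) = rev (sorted_list_of_multiset ?C)"
    by (simp add: first_split_def M delabel_Branch leaf_count_delabel image_mset.compositionality o_def)
  have "1 \<le> leaf_count c" if "c \<in># M" for c
    using child_trees_on[OF assms(1)[unfolded M] that]
    by (metis card_0_eq leaf_count_trees_on not_less_eq_eq le_zero_eq One_nat_def trees_on_finite trees_on_nonempty)
  moreover have "leaf_count t = sum_mset ?C"
    unfolding M leaf_count_def leaf_labels.simps by (induction M) auto
  moreover have "leaf_count t = n" using leaf_count_trees_on[OF assms(1)] by simp
  moreover have "sum_list (rev (sorted_list_of_multiset ?C)) = sum_mset ?C"
    by (metis mset_rev mset_sorted_list_of_multiset sum_mset_sum_list)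
  moreover have "length (sorted_list_of_multiset ?C) = size M"
    by (metis mset_sorted_list_of_multiset size_image_mset size_mset)
  moreover have "2 \<le> size M" using size_children_ge_2 assms(1) M by blast
  moreover have "sorted_wrt (\<ge>) (rev (sorted_list_of_multiset ?C))"
    by (simp add: sorted_wrt_rev)
  moreover have "set (sorted_list_of_multiset ?C) = leaf_count ` set_mset M"
    by simp
  ultimately show ?thesis unfolding splits_def f by auto
qed

lemma set_pmf_first_split:
  assumes "0 \<le> \<alpha>" "\<alpha> \<le> 1" "0 \<le> \<gamma>" "\<gamma> \<le> \<alpha>" "2 \<le> n"
  shows "set_pmf (map_pmf first_split (delabelled_alpha_gamma_tree \<alpha> \<gamma> n)) \<subseteq> splits n"
  using set_pmf_delabelled[OF assms(1-4), of n] first_split_splits[OF _ assms(5)] assms(5) by auto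

text \<open>On the conditioning event the tree is a branch point and hence is recovered from its
  components, so the mass of U is the conditional probability of \<open>Branch U\<close>. If the
  sizes match ns, division by the positive probability of the split gives the branching identity;
  otherwise both sides vanish.\<close>

lemma markov_branching_alpha_gamma:
  assumes par: "0 \<le> \<alpha>" "\<alpha> \<le> 1" "0 \<le> \<gamma>" "\<gamma> \<le> \<alpha>"
  shows "markov_branching (delabelled_alpha_gamma_tree \<alpha> \<gamma>)"
  unfolding markov_branching_def
proof (intro allI impI ballI pmf_eqI)
  fix n :: nat and ns U
  assume n: "2 \<le> n" and ns_mem: "ns \<in> first_split ` set_pmf (delabelled_alpha_gamma_tree \<alpha> \<gamma> n)"
  let ?D = "delabelled_alpha_gamma_tree \<alpha> \<gamma>"
  let ?A = "{t. first_split t = ns}"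
  let ?S = "\<Sum>us\<in>permutations_of_multiset U. if length us = length ns
      then \<Prod>(m, u)\<leftarrow>zip ns us. pmf (?D m) u else 0"
  have mem: "ns \<in> set_pmf (map_pmf first_split (?D n))"
    using ns_mem by simp
  then have ns: "ns \<in> splits n" using set_pmf_first_split[OF par n] by blast
  have pos: "pmf (map_pmf first_split (?D n)) ns \<noteq> 0" using mem unfolding set_pmf_iff .
  have ne: "set_pmf (?D n) \<inter> ?A \<noteq> {}" using ns_mem by auto
  have A: "u = Branch (components u)" if "u \<in> ?A" for u
    using first_split_Branch[OF ns, of u] that by auto
  have P: "measure (?D n) ?A = pmf (map_pmf first_split (?D n)) ns"
    by (simp add: pmf_map vimage_def)
  have "pmf (map_pmf components (cond_pmf (?D n) ?A)) U =
      measure (cond_pmf (?D n) ?A) ((components -` {U}) \<inter> set_pmf (cond_pmf (?D n) ?A))"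
    by (simp add: pmf_map measure_Int_set_pmf)
  also have "(components -` {U}) \<inter> set_pmf (cond_pmf (?D n) ?A) =
      {Branch U} \<inter> set_pmf (cond_pmf (?D n) ?A)"
    using A by (auto simp: set_cond_pmf[OF ne])
  also have "measure (cond_pmf (?D n) ?A) \<dots> = pmf (cond_pmf (?D n) ?A) (Branch U)"
    by (simp add: measure_Int_set_pmf measure_pmf_single)
  also have "\<dots> = ?S"
  proof (cases "image_mset leaf_count U = mset ns")
    case True
    then have "Branch U \<in> ?A" using first_split_Branch[OF ns] by auto
    then have "pmf (cond_pmf (?D n) ?A) (Branch U) =
        pmf (?D n) (Branch U) / pmf (map_pmf first_split (?D n)) ns"
      using pmf_cond[OF ne] P by simp
    also have "\<dots> = ?S"
      using branching_identity[OF par ns True] n pos by simp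
    finally show ?thesis .
  next
    case False
    then have "Branch U \<notin> ?A" using first_split_Branch[OF ns] by auto
    then have "pmf (cond_pmf (?D n) ?A) (Branch U) = 0" using pmf_cond[OF ne] by simp
    also have "0 = ?S"
    proof (intro sum.neutral[symmetric] ballI)
      fix us assume "us \<in> permutations_of_multiset U"
      then have "map leaf_count us \<noteq> ns" using False by (auto simp: permutations_of_multiset_def)
      then show "(if length us = length ns then \<Prod>(m, u)\<leftarrow>zip ns us. pmf (?D m) u else 0) = 0"
        using pmf_list_leaf_counts[OF par ns] by simp
    qed
    finally show ?thesis .
  qed
  finally show "pmf (map_pmf components (cond_pmf (?D n) ?A)) U =
      pmf (map_pmf (\<lambda>S. image_mset S (mset_set {..<length ns}))
        (Pi_pmf {..<length ns} undefined (\<lambda>i. ?D (ns ! i)))) U"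
    by (simp add: pmf_independent_multiset)
qed

subsection \<open>Splitting rule\<close>

lemma finite_splits: "finite (splits n)"
proof (rule finite_subset)
  show "splits n \<subseteq> {ns. set ns \<subseteq> {..n} \<and> length ns \<le> n}"
  proof
    fix ns assume ns: "ns \<in> splits n"
    have "(\<Sum>m\<leftarrow>ns. 1) \<le> (\<Sum>m\<leftarrow>ns. m)"
      using splitsD(2)[OF ns] by (intro sum_list_mono)
    then have "length ns \<le> n" using splitsD(3)[OF ns] by (simp add: sum_list_triv)
    moreover have "set ns \<subseteq> {..n}" using splitsD(3)[OF ns] member_le_sum_list by auto
    ultimately show "ns \<in> {ns. set ns \<subseteq> {..n} \<and> length ns \<le> n}" by simp
  qed
qed (simp add: finite_lists_length_le)

lemma prod_list_pos:
  fixes f :: "'a \<Rightarrow> real"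
  shows "(\<And>x. x \<in> set xs \<Longrightarrow> 0 < f x) \<Longrightarrow> 0 < (\<Prod>x\<leftarrow>xs. f x)"
  by (induction xs) auto

lemma split_multiplicity_pos: "split_multiplicity ns > 0"
  unfolding split_multiplicity_def
  by (intro mult_pos_pos divide_pos_pos prod_pos prod_list_pos) auto

text \<open>The factor 1 / (\<Prod> m_r!) is the number of rearrangements of ns divided by the
  factorial of its length, which matches the form in which the law of the first split was
  obtained.\<close>

lemma split_multiplicity_eq:
  assumes "ns \<in> splits n"
  shows "split_multiplicity ns = real (card (permutations_of_multiset (mset ns))) / fact (length ns) *
    (fact n / (\<Prod>m\<leftarrow>ns. fact m))"
proof -
  have "set ns \<subseteq> {1..n}"
    using splitsD(2,3)[OF assms] member_le_sum_list by fastforce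
  then have "(\<Prod>r\<in>{1..n}. fact (count_list ns r) :: real) = (\<Prod>r\<in>set ns. fact (count_list ns r))"
    by (intro prod.mono_neutral_right) (auto simp: count_list_0_iff)
  moreover have "real (card (permutations_of_multiset (mset ns)) * (\<Prod>r\<in>set ns. fact (count_list ns r))) =
      real (fact (length ns))"
    using card_permutations_of_multiset_aux[of "mset ns"] by (simp add: count_mset)
  moreover have "(\<Prod>r\<in>set ns. fact (count_list ns r)) \<noteq> (0::real)" by simp
  ultimately have "1 / (\<Prod>r\<in>{1..n}. fact (count_list ns r)) =
      real (card (permutations_of_multiset (mset ns))) / fact (length ns)"
    by (simp add: field_simps)
  then show ?thesis using splitsD(3)[OF assms] by (simp add: split_multiplicity_def)
qed

lemma PD_a_nonneg:
  assumes "0 \<le> \<alpha>" "\<gamma> \<le> \<alpha>" shows "PD_a \<alpha> (- \<alpha> - \<gamma>) k \<ge> 0"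
  unfolding PD_a_def
proof (rule prod_nonneg)
  fix j assume "j \<in> {2..<k}"
  then have "2 * \<alpha> \<le> real j * \<alpha>" using assms(1) by (intro mult_right_mono) auto
  then show "0 \<le> - \<alpha> - \<gamma> + real j * \<alpha>" using assms by linarith
qed

text \<open>Needed so that the normalisation inside \<open>q_PD\<close> can be cancelled.\<close>

lemma PD_Z_pos:
  assumes par: "0 \<le> \<alpha>" "\<alpha> < 1" "\<gamma> \<le> \<alpha>" and n: "2 \<le> n"
  shows "PD_Z \<alpha> (- \<alpha> - \<gamma>) n > 0"
  unfolding PD_Z_def
proof (rule sum_pos2[OF finite_splits])
  \<comment> \<open>For two parts \<open>PD_a\<close> is an empty product, so this term is positive.
    Terms with more parts can vanish, for instance when \<gamma> = \<alpha>.\<close>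
  show "[n - 1, 1] \<in> splits n" using n by (simp add: splits_def)
  show "0 < split_multiplicity [n - 1, 1] *
      (PD_a \<alpha> (- \<alpha> - \<gamma>) (length [n - 1, 1]) * (\<Prod>m\<leftarrow>[n - 1, 1]. PD_w \<alpha> m))"
    using n par PD_w_pos[of \<alpha> "n - 1"] PD_w_pos[of \<alpha> 1]
    by (intro mult_pos_pos split_multiplicity_pos) (auto simp: PD_a_def)
next
  fix ns assume "ns \<in> splits n"
  then have "(\<Prod>m\<leftarrow>ns. PD_w \<alpha> m) > 0"
    using splitsD(2) PD_w_pos[OF par(2)] by (intro prod_list_pos) auto
  then show "0 \<le> split_multiplicity ns * (PD_a \<alpha> (- \<alpha> - \<gamma>) (length ns) * (\<Prod>m\<leftarrow>ns. PD_w \<alpha> m))"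
    using PD_a_nonneg[OF par(1,3)] split_multiplicity_pos[of ns] by (simp add: less_imp_le)
qed

text \<open>With n = \<open>sum_list ns\<close>, both sides are n^2 - \<Sum> m^2: on the left as the
  full square without its diagonal, on the right because the linear terms n cancel.\<close>

lemma sum_distinct_pairs:
  fixes ns :: "nat list"
  shows "(\<Sum>(i, j)\<in>{(i, j). i < length ns \<and> j < length ns \<and> i \<noteq> j}. real (ns ! i) * real (ns ! j)) =
    real (sum_list ns) * (real (sum_list ns) - 1) - (\<Sum>m\<leftarrow>ns. real m * (real m - 1))"
proof -
  let ?k = "length ns" and ?f = "\<lambda>i. real (ns ! i)"
  have eq: "{..<?k} \<times> {..<?k} = {(i, j). i < ?k \<and> j < ?k \<and> i \<noteq> j} \<union> (\<lambda>i. (i, i)) ` {..<?k}"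
    by auto
  have "finite {(i, j). i < ?k \<and> j < ?k \<and> i \<noteq> j}"
    by (rule finite_subset[of _ "{..<?k} \<times> {..<?k}"]) auto
  then have "(\<Sum>(i, j)\<in>{..<?k} \<times> {..<?k}. ?f i * ?f j) =
      (\<Sum>(i, j)\<in>{(i, j). i < ?k \<and> j < ?k \<and> i \<noteq> j}. ?f i * ?f j) +
      (\<Sum>(i, j)\<in>(\<lambda>i. (i, i)) ` {..<?k}. ?f i * ?f j)"
    unfolding eq by (intro sum.union_disjoint) auto
  moreover have "(\<Sum>(i, j)\<in>(\<lambda>i. (i, i)) ` {..<?k}. ?f i * ?f j) = (\<Sum>i<?k. ?f i * ?f i)"
    by (subst sum.reindex) (auto simp: inj_on_def)
  moreover have "(\<Sum>(i, j)\<in>{..<?k} \<times> {..<?k}. ?f i * ?f j) = (\<Sum>i<?k. ?f i) * (\<Sum>i<?k. ?f i)"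
    by (simp add: sum_product sum.cartesian_product)
  moreover have "(\<Sum>i<?k. ?f i) = real (sum_list ns)"
    by (simp add: sum_list_sum_nth atLeast0LessThan)
  moreover have "(\<Sum>m\<leftarrow>ns. real m * (real m - 1)) = (\<Sum>i<?k. ?f i * ?f i) - (\<Sum>i<?k. ?f i)"
    by (simp add: sum_list_sum_nth atLeast0LessThan sum_subtractf algebra_simps)
  ultimately show ?thesis by (simp add: algebra_simps)
qed

text \<open>In the constant, \<open>PD_Z\<close> undoes the normalisation of \<open>q_PD\<close>,
  and \<open>1 / PD_w\<close> is the normalisation of the product formula for trees with n
  leaves.\<close>

lemma splitting_rule_eq:
  assumes par: "0 \<le> \<alpha>" "\<alpha> < 1" "0 \<le> \<gamma>" "\<gamma> \<le> \<alpha>" and n: "2 \<le> n" and ns: "ns \<in> splits n"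
  shows "splitting_rule (delabelled_alpha_gamma_tree \<alpha> \<gamma>) ns =
    PD_Z \<alpha> (- \<alpha> - \<gamma>) n / PD_w \<alpha> n * ((\<gamma> + (1 - \<alpha> - \<gamma>) * (1 / (real n * (real n - 1))) *
      (\<Sum>(i, j)\<in>{(i, j). i < length ns \<and> j < length ns \<and> i \<noteq> j}. real (ns ! i) * real (ns ! j))) *
      q_PD \<alpha> (- \<alpha> - \<gamma>) ns)"
proof -
  let ?N = "real n * (real n - 1)"
  let ?S = "\<Sum>m\<leftarrow>ns. real m * (real m - 1)"
  let ?K = "real (card (permutations_of_multiset (mset ns)))"
  have N: "?N \<noteq> 0" using n by simp
  have sn: "sum_list ns = n" using splitsD(3)[OF ns] .
  have Z: "PD_Z \<alpha> (- \<alpha> - \<gamma>) n \<noteq> 0" using PD_Z_pos[OF par(1,2,4) n] by simp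
  have "splitting_rule (delabelled_alpha_gamma_tree \<alpha> \<gamma>) ns = ?K / fact (length ns) * split_mass \<alpha> \<gamma> ns"
    using pmf_first_split[OF par ns] by (simp add: splitting_rule_def sn field_simps)
  also have "\<dots> = ?K / fact (length ns) * (fact n / (\<Prod>m\<leftarrow>ns. fact m)) * (PD_a \<alpha> (- \<alpha> - \<gamma>) (length ns) *
      (\<Prod>m\<leftarrow>ns. PD_w \<alpha> m) / PD_w \<alpha> n * (\<gamma> + (1 - \<alpha> - \<gamma>) * (1 - ?S / ?N)))"
    by (simp add: split_mass_def sn ac_simps)
  also have "?K / fact (length ns) * (fact n / (\<Prod>m\<leftarrow>ns. fact m)) = split_multiplicity ns"
    using split_multiplicity_eq[OF ns] by simp
  also have "1 - ?S / ?N = 1 / ?N *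
      (\<Sum>(i, j)\<in>{(i, j). i < length ns \<and> j < length ns \<and> i \<noteq> j}. real (ns ! i) * real (ns ! j))"
    unfolding sum_distinct_pairs sn using N by (simp add: diff_divide_distrib)
  finally show ?thesis
    using Z by (simp add: q_PD_def p_PD_def sn mult.assoc)
qed

lemma sum_splitting_rule:
  assumes par: "0 \<le> \<alpha>" "\<alpha> \<le> 1" "0 \<le> \<gamma>" "\<gamma> \<le> \<alpha>" and n: "2 \<le> n"
  shows "(\<Sum>ns\<in>splits n. splitting_rule (delabelled_alpha_gamma_tree \<alpha> \<gamma>) ns) = 1"
proof -
  have "(\<Sum>ns\<in>splits n. splitting_rule (delabelled_alpha_gamma_tree \<alpha> \<gamma>) ns) =
      (\<Sum>ns\<in>splits n. pmf (map_pmf first_split (delabelled_alpha_gamma_tree \<alpha> \<gamma> n)) ns)"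
    by (intro sum.cong) (auto simp: splitting_rule_def splitsD(3))
  also have "\<dots> = 1"
    using finite_splits set_pmf_first_split[OF assms] by (rule sum_pmf_eq_1)
  finally show ?thesis .
qed

subsection \<open>Exchangeability\<close>

text \<open>For \<open>\<gamma> = 1 - \<alpha>\<close> the weight of a branch point no longer depends on the labels above it.\<close>

lemma tree_weight_map_exchangeable:
  fixes f :: "'a::linorder \<Rightarrow> 'b::linorder"
  shows "tree_weight \<alpha> (1 - \<alpha>) (map_ptree f t) = tree_weight \<alpha> (1 - \<alpha>) t"
proof (induction t)
  case (Branch M)
  then have "image_mset (tree_weight \<alpha> (1 - \<alpha>) \<circ> map_ptree f) M = image_mset (tree_weight \<alpha> (1 - \<alpha>)) M"
    by (intro image_mset_cong) simp
  then show ?case by (simp add: split_weight_def multiset.map_comp)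
qed simp

text \<open>Below \<alpha> = 1 this follows from the product formula, whose weights ignore the
  labels when \<gamma> = 1 - \<alpha>. At \<alpha> = 1 it is a limit along the line \<gamma> = 1 -
  \<alpha>.\<close>

lemma pmf_map_exchangeable:
  assumes "1 / 2 \<le> \<alpha>" "\<alpha> \<le> 1" and n: "1 \<le> n" and \<pi>: "\<pi> permutes {1..n}"
    and t: "t \<in> trees_on {1..n}"
  shows "pmf (alpha_gamma_tree \<alpha> (1 - \<alpha>) n) (map_ptree \<pi> t) = pmf (alpha_gamma_tree \<alpha> (1 - \<alpha>) n) t"
proof -
  have t': "map_ptree \<pi> t \<in> trees_on {1..n}"
    using map_trees_on[OF permutes_inj_on[OF \<pi>] t] permutes_image[OF \<pi>] by simp
  have less: "pmf (alpha_gamma_tree a (1 - a) n) (map_ptree \<pi> t) = pmf (alpha_gamma_tree a (1 - a) n) t"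
    if "1 / 2 \<le> a" "a < 1" for a
    using pmf_alpha_gamma_tree[of a "1 - a" n] that n t t' by (simp add: tree_weight_map_exchangeable)
  show ?thesis
  proof (cases "\<alpha> < 1")
    case True
    then show ?thesis using less assms(1) by simp
  next
    case False
    then have \<alpha>: "\<alpha> = 1" using assms(2) by simp
    \<comment> \<open>The sequence starts at 1/2, so that 1 - a j \<le> a j and every pair (a j, 1 -
      a j) is admissible.\<close>
    define a where "a j = 1 - inverse (real (Suc (Suc j)))" for j
    have a: "1 / 2 \<le> a j" "a j < 1" for j
      by (auto simp: a_def field_simps)
    have lim: "a \<longlonglongrightarrow> 1"
      unfolding a_def using tendsto_diff[OF tendsto_const LIMSEQ_Suc[OF LIMSEQ_inverse_real_of_nat], of 1] by simp
    have lim': "(\<lambda>j. 1 - a j) \<longlonglongrightarrow> 1 - 1"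
      by (intro tendsto_diff tendsto_const lim)
    have "0 \<le> a j" "a j \<le> 1" "0 \<le> 1 - a j" "1 - a j \<le> a j" for j
      using a[of j] by linarith+
    note T = pmf_alpha_gamma_tree_tendsto[OF this lim lim' n]
    have "(\<lambda>j. pmf (alpha_gamma_tree (a j) (1 - a j) n) t)
        \<longlonglongrightarrow> pmf (alpha_gamma_tree 1 (1 - 1) n) (map_ptree \<pi> t)"
      using T[OF t'] less[OF a] by simp
    from LIMSEQ_unique[OF this T[OF t]] show ?thesis unfolding \<alpha> .
  qed
qed

text \<open>Relabelling by \<pi> gives t the mass of its preimage s. Since \<pi> preserves
  \<open>trees_on {1..n}\<close>, either both trees lie in that set and have equal mass, or both lie
  outside it and have mass zero.\<close>

lemma exchangeable_alpha_gamma: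
  assumes \<alpha>: "1 / 2 \<le> \<alpha>" "\<alpha> \<le> 1" and n: "1 \<le> n"
  shows "exchangeable_labels n (alpha_gamma_tree \<alpha> (1 - \<alpha>) n)"
  unfolding exchangeable_labels_def
proof (intro allI impI pmf_eqI)
  fix \<pi> t assume \<pi>: "\<pi> permutes {1..n}"
  let ?T = "alpha_gamma_tree \<alpha> (1 - \<alpha>) n"
  define s where "s = map_ptree (inv \<pi>) t"
  have ts: "t = map_ptree \<pi> s"
    using permutes_inv_o(1)[OF \<pi>] by (simp add: s_def ptree.map_comp ptree.map_id0 id_def[symmetric])
  have bij: "bij_betw (map_ptree \<pi>) (trees_on {1..n}) (trees_on {1..n})"
    using permutes_imp_bij[OF \<pi>] by (rule bij_betw_trees_on)
  have inj: "inj (map_ptree \<pi>)" using permutes_inj[OF \<pi>] by (rule ptree.inj_map)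
  have "pmf (map_pmf (map_ptree \<pi>) ?T) t = pmf ?T s"
    unfolding ts by (rule pmf_map_inj'[OF inj])
  also have "\<dots> = pmf ?T t"
  proof (cases "s \<in> trees_on {1..n}")
    case True
    then show ?thesis unfolding ts using pmf_map_exchangeable[OF \<alpha> n \<pi>] by simp
  next
    case False
    have "t \<notin> trees_on {1..n}"
    proof
      assume "t \<in> trees_on {1..n}"
      then obtain r where r: "r \<in> trees_on {1..n}" "t = map_ptree \<pi> r"
        using bij_betw_imp_surj_on[OF bij] by blast
      then have "s = r" using ts inj by (simp add: inj_eq)
      then show False using r False by simp
    qed
    moreover have "set_pmf ?T \<subseteq> trees_on {1..n}"
      using set_pmf_alpha_gamma_tree[of \<alpha> "1 - \<alpha>" n] \<alpha> n by simp
    ultimately show ?thesis using False by (metis pmf_eq_0_set_pmf subsetD)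
  qed
  finally show "pmf (map_pmf (map_ptree \<pi>) ?T) t = pmf ?T t" .
qed

text \<open>The transposition of 2 and 3 exchanges two trees with three leaves: one arises by
  splitting the root edge, of weight \<gamma>, the other by splitting the edge of leaf 1, of weight
  1 - \<alpha>. Equality of their probabilities is equality of these weights.\<close>

lemma exchangeable_3_imp:
  assumes par: "0 \<le> \<alpha>" "\<alpha> \<le> 1" "0 \<le> \<gamma>" "\<gamma> \<le> \<alpha>"
    and ex: "exchangeable_labels 3 (alpha_gamma_tree \<alpha> \<gamma> 3)"
  shows "\<gamma> = 1 - \<alpha>"
proof -
  let ?t = "Branch {#Leaf 1, Leaf (2::nat)#}" and ?T = "alpha_gamma_tree \<alpha> \<gamma> 3"
  let ?t1 = "Branch {#?t, Leaf 3#}" and ?t2 = "Branch {#Branch {#Leaf 1, Leaf 3#}, Leaf (2::nat)#}"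
  let ?\<pi> = "Transposition.transpose 2 (3::nat)"
  have "{1..2::nat} = {1, 2}" by auto
  then have t: "?t \<in> trees_on {1..2}" by (simp add: trees_on_def)
  have sites: "Edge ?t \<in> sites ?t" "Edge (Leaf 1) \<in> sites ?t" by (auto simp: sites_def)
  note P = pmf_alpha_gamma_tree_Suc[OF par order_refl t]
  have "pmf (alpha_gamma_tree \<alpha> \<gamma> 2) ?t = 1" by (simp add: numeral_2_eq_2)
  then have 1: "pmf ?T ?t1 = \<gamma> / (2 - \<alpha>)" and 2: "pmf ?T ?t2 = (1 - \<alpha>) / (2 - \<alpha>)"
    using P[OF sites(1)] P[OF sites(2)] by (simp_all add: numeral_3_eq_3)
  have \<pi>: "?\<pi> permutes {1..3}" by (intro permutes_swap_id) auto
  have "map_ptree ?\<pi> ?t1 = ?t2" by (simp add: add_mset_commute)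
  then have "pmf ?T ?t2 = pmf (map_pmf (map_ptree ?\<pi>) ?T) (map_ptree ?\<pi> ?t1)"
    using ex \<pi> by (simp add: exchangeable_labels_def)
  also have "\<dots> = pmf ?T ?t1"
    by (rule pmf_map_inj'[OF ptree.inj_map[OF permutes_inj[OF \<pi>]]])
  finally show ?thesis using 1 2 par by (simp add: divide_simps split: if_splits)
qed

theorem proposition1:
  fixes \<alpha> \<gamma> :: real
  assumes "0 \<le> \<alpha>" "\<alpha> \<le> 1" "0 \<le> \<gamma>" "\<gamma> \<le> \<alpha>"
  shows "markov_branching (delabelled_alpha_gamma_tree \<alpha> \<gamma>) \<and>
    (\<alpha> < 1 \<longrightarrow>
      (\<forall>n\<ge>2. \<exists>C.
        (\<forall>ns\<in>splits n.
          splitting_rule (delabelled_alpha_gamma_tree \<alpha> \<gamma>) ns =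
          C * ((\<gamma> + (1 - \<alpha> - \<gamma>) * (1 / (real n * (real n - 1))) *
                 (\<Sum>(i, j)\<in>{(i, j). i < length ns \<and> j < length ns \<and> i \<noteq> j}.
                    real (ns ! i) * real (ns ! j))) *
               q_PD \<alpha> (- \<alpha> - \<gamma>) ns)) \<and>
        (\<Sum>ns\<in>splits n. splitting_rule (delabelled_alpha_gamma_tree \<alpha> \<gamma>) ns) = 1)) \<and>
    ((\<forall>n\<ge>1. exchangeable_labels n (alpha_gamma_tree \<alpha> \<gamma> n)) \<longleftrightarrow>
      \<gamma> = 1 - \<alpha> \<and> 1 / 2 \<le> \<alpha> \<and> \<alpha> \<le> 1)"
proof (intro conjI)
  show "markov_branching (delabelled_alpha_gamma_tree \<alpha> \<gamma>)"
    using assms by (rule markov_branching_alpha_gamma)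
  show "\<alpha> < 1 \<longrightarrow>
      (\<forall>n\<ge>2. \<exists>C.
        (\<forall>ns\<in>splits n.
          splitting_rule (delabelled_alpha_gamma_tree \<alpha> \<gamma>) ns =
          C * ((\<gamma> + (1 - \<alpha> - \<gamma>) * (1 / (real n * (real n - 1))) *
                 (\<Sum>(i, j)\<in>{(i, j). i < length ns \<and> j < length ns \<and> i \<noteq> j}.
                    real (ns ! i) * real (ns ! j))) *
               q_PD \<alpha> (- \<alpha> - \<gamma>) ns)) \<and>
        (\<Sum>ns\<in>splits n. splitting_rule (delabelled_alpha_gamma_tree \<alpha> \<gamma>) ns) = 1)"
    using splitting_rule_eq[OF assms(1) _ assms(3,4)] sum_splitting_rule[OF assms] by blast
  show "(\<forall>n\<ge>1. exchangeable_labels n (alpha_gamma_tree \<alpha> \<gamma> n)) \<longleftrightarrow>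
      \<gamma> = 1 - \<alpha> \<and> 1 / 2 \<le> \<alpha> \<and> \<alpha> \<le> 1"
  proof
    assume "\<forall>n\<ge>1. exchangeable_labels n (alpha_gamma_tree \<alpha> \<gamma> n)"
    then have "exchangeable_labels 3 (alpha_gamma_tree \<alpha> \<gamma> 3)" by simp
    with assms have "\<gamma> = 1 - \<alpha>" by (rule exchangeable_3_imp)
    \<comment> \<open>The bound 1/2 \<le> \<alpha> comes from \<gamma> = 1 - \<alpha> together with
      the constraint \<gamma> \<le> \<alpha>.\<close>
    then show "\<gamma> = 1 - \<alpha> \<and> 1 / 2 \<le> \<alpha> \<and> \<alpha> \<le> 1" using assms by simp
  next
    assume "\<gamma> = 1 - \<alpha> \<and> 1 / 2 \<le> \<alpha> \<and> \<alpha> \<le> 1"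
    then show "\<forall>n\<ge>1. exchangeable_labels n (alpha_gamma_tree \<alpha> \<gamma> n)"
      using exchangeable_alpha_gamma by simp
  qed
qed

end
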